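(* Let $X=\mathbb{P}^n_M$ be the $n$-dimensional projective space over an idempotent semifield $M$. Then $$\check{H}^0(X,\mathcal{O}_X)\simeq M,\qquad \check{H}^m(X,\mathcal{U},\mathcal{O}_X)=0\ \text{ for all } m\geq 1,$$ where $\mathcal{U}=\{D(x_0),\dots,D(x_n)\}$ is the standard open covering of $X$ by the principal open affine sets $D(x_i)$.
   Context: Semirings are commutative with $0\neq1$ and absorbing $0$. A semifield is a semiring whose nonzero elements form a multiplicative group; a semiring is idempotent if $x+x=x$ for all $x$. $\operatorname{Spec} A$ of a semiring $A$ is the set of prime ideals (proper ideals $\mathfrak p$ with $xy\in\mathfrak p\Rightarrow x\in\mathfrak p$ or $y\in\mathfrak p$) with Zariski topology and the usual structure sheaf, with $\mathcal O(D(f))\simeq A_f$. A semiring scheme is a locally semiringed space locally isomorphic to such affine ones. Projective space. $\mathbb{P}^n_M=\operatorname{Proj} M[x_0,\dots,x_n]$, i.e. the semiring scheme glued in the usual way from the affine charts $D(x_i)=\operatorname{Spec} M[\frac{x_0}{x_i},\dots,\frac{x_n}{x_i}]$, $i=0,\dots,n$. Čech cohomology. Let $\mathcal F$ be a sheaf of semimodules on $X$ and $\mathcal U=\{U_i\}_{i\in I}$ an open covering of $X$ with $I$ totally ordered. Put $U_{i_0\cdots i_p}=U_{i_0}\cap\dots\cap U_{i_p}$, $C^p=C^p(\mathcal U,\mathcal F)=\prod_{i_0<\dots<i_p}\mathcal F(U_{i_0\cdots i_p})$ for $p\ge0$, $C^p=0$ for $p<0$, and $$(d_p^{+}x)_{i_0\cdots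 i_{p+1}}=\sum_{k\text{ even}} x_{i_0\cdots\hat{i_k}\cdots i_{p+1}}|_{U_{i_0\cdots i_{p+1}}},\qquad (d_p^{-}x)_{i_0\cdots i_{p+1}}=\sum_{k\text{ odd}} x_{i_0\cdots\hat{i_k}\cdots i_{p+1}}|_{U_{i_0\cdots i_{p+1}}},$$ where $0\le k\le p+1$. Put $Z^p=\{x\in C^p: d_p^+(x)=d_p^-(x)\}$ and $\check H^p(X,\mathcal U,\mathcal F)=Z^p/\rho^p$, where $x\,\rho^p\,y$ iff $x+d_{p-1}^+(u)+d_{p-1}^-(v)=y+d_{p-1}^+(v)+d_{p-1}^-(u)$ for some $u,v\in C^{p-1}$. $\check H^0(X,\mathcal F)=\varinjlim_{\mathcal U}\check H^0(X,\mathcal U,\mathcal F)$, the colimit over open coverings ordered by refinement, with transition maps given by restriction along a refinement. *)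

theory Defs
  imports "HOL-Analysis.Abstract_Topology" "HOL-Library.Poly_Mapping" "HOL-Library.FuncSet"
begin

section \<open>Idempotent semifields and semimodules\<close>

text \<open>The class \<^class>\<open>comm_semiring_1\<close> already contains absorption of \<open>0\<close> and \<open>0 \<noteq> 1\<close>.
  In it, existence of inverses for all nonzero elements also makes the nonzero elements closed
  under multiplication, so that they form a group.\<close>

class idempotent_semifield = comm_semiring_1 +
  assumes add_idem: "x + x = x"
    and ex_inverse: "x \<noteq> 0 \<Longrightarrow> \<exists>y. x * y = 1"

record ('k, 's) semimodule =
  smcarrier :: "'s set"
  smadd :: "'s \<Rightarrow> 's \<Rightarrow> 's"
  smzero :: "'s"
  smscale :: "'k \<Rightarrow> 's \<Rightarrow> 's"

definition self_semimodule :: "'k::comm_semiring_1 itself \<Rightarrow> ('k, 'k) semimodule" where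
  "self_semimodule M = \<lparr>smcarrier = UNIV, smadd = (+), smzero = 0, smscale = (*)\<rparr>"

definition semimodule_hom :: "('k, 's) semimodule \<Rightarrow> ('k, 't) semimodule \<Rightarrow> ('s \<Rightarrow> 't) set" where
  "semimodule_hom A B = {f \<in> smcarrier A \<rightarrow> smcarrier B.
     (\<forall>x\<in>smcarrier A. \<forall>y\<in>smcarrier A. f (smadd A x y) = smadd B (f x) (f y)) \<and>
     f (smzero A) = smzero B \<and>
     (\<forall>k. \<forall>x\<in>smcarrier A. f (smscale A k x) = smscale B k (f x))}"

definition semimodule_iso :: "('k, 's) semimodule \<Rightarrow> ('k, 't) semimodule \<Rightarrow> bool" where
  "semimodule_iso A B \<longleftrightarrow> (\<exists>f\<in>semimodule_hom A B. bij_betw f (smcarrier A) (smcarrier B))"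

definition semimodule_trivial :: "('k, 's) semimodule \<Rightarrow> bool" where
  "semimodule_trivial A \<longleftrightarrow> smcarrier A = {smzero A}"


section \<open>Affine semiring schemes\<close>

text \<open>The semirings whose spectra are formed are subsemirings \<open>A\<close> of an ambient commutative
  semiring type; all notions are relative to \<open>A\<close>.\<close>

inductive_set generated_subsemiring :: "'b::comm_semiring_1 set \<Rightarrow> 'b set" for G where
  zero: "0 \<in> generated_subsemiring G"
| one: "1 \<in> generated_subsemiring G"
| gen: "g \<in> G \<Longrightarrow> g \<in> generated_subsemiring G"
| add: "a \<in> generated_subsemiring G \<Longrightarrow> b \<in> generated_subsemiring G
    \<Longrightarrow> a + b \<in> generated_subsemiring G"
| mult: "a \<in> generated_subsemiring G \<Longrightarrow> b \<in> generated_subsemiring G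
    \<Longrightarrow> a * b \<in> generated_subsemiring G"

definition sr_ideal :: "'b::comm_semiring_1 set \<Rightarrow> 'b set \<Rightarrow> bool" where
  "sr_ideal A I \<longleftrightarrow> I \<subseteq> A \<and> 0 \<in> I \<and> (\<forall>x\<in>I. \<forall>y\<in>I. x + y \<in> I) \<and> (\<forall>a\<in>A. \<forall>x\<in>I. a * x \<in> I)"

definition Spec :: "'b::comm_semiring_1 set \<Rightarrow> 'b set set" where
  "Spec A = {p. sr_ideal A p \<and> p \<noteq> A \<and> (\<forall>x\<in>A. \<forall>y\<in>A. x * y \<in> p \<longrightarrow> x \<in> p \<or> y \<in> p)}"

text \<open>The open sets are the complements of the sets \<open>V(E) = {p. E \<subseteq> p}\<close>.\<close>

definition zariski :: "'b::comm_semiring_1 set \<Rightarrow> 'b set topology" where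
  "zariski A = topology (\<lambda>U. \<exists>E\<subseteq>A. U = {p \<in> Spec A. \<not> E \<subseteq> p})"

lemma istopology_zariski:
  assumes "\<And>a b. a \<in> A \<Longrightarrow> b \<in> A \<Longrightarrow> a * b \<in> A"
  shows "istopology (\<lambda>U. \<exists>E\<subseteq>A. U = {p \<in> Spec A. \<not> E \<subseteq> p})"
  unfolding istopology_def
proof (intro conjI allI impI)
  fix S T
  assume "\<exists>E\<subseteq>A. S = {p \<in> Spec A. \<not> E \<subseteq> p}" and "\<exists>E\<subseteq>A. T = {p \<in> Spec A. \<not> E \<subseteq> p}"
  then obtain E F where E: "E \<subseteq> A" "S = {p \<in> Spec A. \<not> E \<subseteq> p}"
    and F: "F \<subseteq> A" "T = {p \<in> Spec A. \<not> F \<subseteq> p}" by auto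
  let ?G = "{a * b | a b. a \<in> E \<and> b \<in> F}"
  have "(\<not> ?G \<subseteq> p) = (\<not> E \<subseteq> p \<and> \<not> F \<subseteq> p)" if p: "p \<in> Spec A" for p
  proof
    assume "\<not> ?G \<subseteq> p"
    then obtain a b where ab: "a \<in> E" "b \<in> F" "a * b \<notin> p" by auto
    then have A: "a \<in> A" "b \<in> A" using E F by auto
    have abs: "\<And>c x. c \<in> A \<Longrightarrow> x \<in> p \<Longrightarrow> c * x \<in> p"
      using p by (auto simp: Spec_def sr_ideal_def)
    have "a \<notin> p" "b \<notin> p"
      using ab A abs[of a b] abs[of b a] by (auto simp: mult.commute[of a b])
    with ab show "\<not> E \<subseteq> p \<and> \<not> F \<subseteq> p" by auto
  next
    assume "\<not> E \<subseteq> p \<and> \<not> F \<subseteq> p"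
    then obtain a b where ab: "a \<in> E" "a \<notin> p" "b \<in> F" "b \<notin> p" by auto
    then have np: "a * b \<notin> p" using p E(1) F(1) by (auto simp: Spec_def)
    with ab show "\<not> ?G \<subseteq> p" by blast
  qed
  then have "S \<inter> T = {p \<in> Spec A. \<not> ?G \<subseteq> p}"
    unfolding E(2) F(2) by (intro set_eqI) (simp only: Int_iff mem_Collect_eq, blast)
  moreover have "?G \<subseteq> A" using assms E F by blast
  ultimately show "\<exists>E\<subseteq>A. S \<inter> T = {p \<in> Spec A. \<not> E \<subseteq> p}" by blast
next
  fix K
  assume "\<forall>S\<in>K. \<exists>E\<subseteq>A. S = {p \<in> Spec A. \<not> E \<subseteq> p}"
  then obtain E where E: "\<And>S. S \<in> K \<Longrightarrow> E S \<subseteq> A \<and> S = {p \<in> Spec A. \<not> E S \<subseteq> p}" by metis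
  have "\<Union>K = {p \<in> Spec A. \<not> (\<Union>S\<in>K. E S) \<subseteq> p}" using E by blast
  with E show "\<exists>E\<subseteq>A. \<Union>K = {p \<in> Spec A. \<not> E \<subseteq> p}" by (metis UN_least)
qed

text \<open>Localization of \<open>A\<close> at a multiplicative subset \<open>S\<close>: classes of pairs (numerator, denominator).\<close>

definition loc_rel :: "'b::comm_semiring_1 set \<Rightarrow> 'b set \<Rightarrow> (('b \<times> 'b) \<times> ('b \<times> 'b)) set" where
  "loc_rel A S = {((a, s), (b, t)). a \<in> A \<and> b \<in> A \<and> s \<in> S \<and> t \<in> S \<and>
     (\<exists>h\<in>S. h * a * t = h * b * s)}"

definition localization :: "'b::comm_semiring_1 set \<Rightarrow> 'b set \<Rightarrow> ('b \<times> 'b) set set" where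
  "localization A S = (A \<times> S) // loc_rel A S"

definition fraction :: "'b::comm_semiring_1 set \<Rightarrow> 'b set \<Rightarrow> 'b \<Rightarrow> 'b \<Rightarrow> ('b \<times> 'b) set" where
  "fraction A S a s = loc_rel A S `` {(a, s)}"

definition loc_add ::
  "'b::comm_semiring_1 set \<Rightarrow> 'b set \<Rightarrow> ('b \<times> 'b) set \<Rightarrow> ('b \<times> 'b) set \<Rightarrow> ('b \<times> 'b) set" where
  "loc_add A S x y = (\<Union>(a, s)\<in>x. \<Union>(b, t)\<in>y. fraction A S (a * t + b * s) (s * t))"

definition loc_mult ::
  "'b::comm_semiring_1 set \<Rightarrow> 'b set \<Rightarrow> ('b \<times> 'b) set \<Rightarrow> ('b \<times> 'b) set \<Rightarrow> ('b \<times> 'b) set" where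
  "loc_mult A S x y = (\<Union>(a, s)\<in>x. \<Union>(b, t)\<in>y. fraction A S (a * b) (s * t))"

text \<open>Sections of the structure sheaf of \<open>Spec A\<close> over an open set \<open>U\<close>: families of stalk elements
  that are locally given by a single fraction.\<close>

definition affine_sections :: "'b::comm_semiring_1 set \<Rightarrow> 'b set set \<Rightarrow> ('b set \<Rightarrow> ('b \<times> 'b) set) set"
  where
  "affine_sections A U = {s \<in> (\<Pi>\<^sub>E p\<in>U. localization A (A - p)).
     \<forall>p\<in>U. \<exists>V a f. openin (zariski A) V \<and> p \<in> V \<and> V \<subseteq> U \<and> a \<in> A \<and> f \<in> A \<and>
       (\<forall>q\<in>V. f \<notin> q \<and> s q = fraction A (A - q) a f)}"


section \<open>Gluing affine semiring schemes\<close>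

text \<open>Gluing data: an index set \<open>I\<close>, semirings \<open>A i\<close> (the charts) and \<open>B i j\<close> (the overlaps) with
  \<open>A i, A j \<subseteq> B i j = B j i\<close>, where \<open>B i j\<close> is a localization both of \<open>A i\<close> and of \<open>A j\<close>, so that
  \<open>P \<mapsto> P \<inter> A i\<close> and \<open>P \<mapsto> P \<inter> A j\<close> are open immersions of \<open>Spec (B i j)\<close> into the two charts.
  A point of the glued space is a class of pairs \<open>(i, p)\<close> with \<open>p \<in> Spec (A i)\<close>.\<close>

definition glue_rel ::
  "'i set \<Rightarrow> ('i \<Rightarrow> 'b::comm_semiring_1 set) \<Rightarrow> ('i \<Rightarrow> 'i \<Rightarrow> 'b set) \<Rightarrow> (('i \<times> 'b set) \<times> ('i \<times> 'b set)) set"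
  where
  "glue_rel I A B = {((i, p), (j, q)). i \<in> I \<and> j \<in> I \<and>
     (\<exists>P\<in>Spec (B i j). p = P \<inter> A i \<and> q = P \<inter> A j)}"

definition glue_point ::
  "'i set \<Rightarrow> ('i \<Rightarrow> 'b::comm_semiring_1 set) \<Rightarrow> ('i \<Rightarrow> 'i \<Rightarrow> 'b set) \<Rightarrow> 'i \<Rightarrow> 'b set \<Rightarrow> ('i \<times> 'b set) set"
  where
  "glue_point I A B i p = glue_rel I A B `` {(i, p)}"

definition glue_points ::
  "'i set \<Rightarrow> ('i \<Rightarrow> 'b::comm_semiring_1 set) \<Rightarrow> ('i \<Rightarrow> 'i \<Rightarrow> 'b set) \<Rightarrow> ('i \<times> 'b set) set set" where
  "glue_points I A B = (SIGMA i:I. Spec (A i)) // glue_rel I A B"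

definition chart_part ::
  "'i set \<Rightarrow> ('i \<Rightarrow> 'b::comm_semiring_1 set) \<Rightarrow> ('i \<Rightarrow> 'i \<Rightarrow> 'b set) \<Rightarrow> ('i \<times> 'b set) set set \<Rightarrow> 'i
    \<Rightarrow> 'b set set" where
  "chart_part I A B U i = {p \<in> Spec (A i). glue_point I A B i p \<in> U}"

definition glue_top ::
  "'i set \<Rightarrow> ('i \<Rightarrow> 'b::comm_semiring_1 set) \<Rightarrow> ('i \<Rightarrow> 'i \<Rightarrow> 'b set) \<Rightarrow> ('i \<times> 'b set) set topology" where
  "glue_top I A B = topology (\<lambda>U. U \<subseteq> glue_points I A B \<and>
     (\<forall>i\<in>I. openin (zariski (A i)) (chart_part I A B U i)))"

lemma istopology_glue:
  "istopology (\<lambda>U. U \<subseteq> glue_points I A B \<and> (\<forall>i\<in>I. openin (zariski (A i)) (chart_part I A B U i)))"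
proof -
  have "chart_part I A B (S \<inter> T) i = chart_part I A B S i \<inter> chart_part I A B T i" for S T i
    by (auto simp: chart_part_def)
  moreover have "chart_part I A B (\<Union>K) i = (\<Union>S\<in>K. chart_part I A B S i)" for K i
    by (auto simp: chart_part_def)
  ultimately show ?thesis
    unfolding istopology_def by (auto intro!: openin_Int openin_Union)
qed

text \<open>A section over \<open>U\<close> is a family of sections \<open>s\<^sub>i\<close> on the chart parts of \<open>U\<close> such that \<open>s\<^sub>i\<close> and
  \<open>s\<^sub>j\<close> have the same pullback to \<open>Spec (B i j)\<close>. For \<open>P \<in> Spec (B i j)\<close>, the canonical map from the
  stalk of \<open>A i\<close> at \<open>P \<inter> A i\<close> to the stalk of \<open>B i j\<close> at \<open>P\<close> sends a class \<open>c\<close> to \<open>loc_rel (B i j)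
  (B i j - P) `` c\<close>. The section \<open>s\<^sub>i\<close> is stored as \<open>\<lambda>p. s (i, p)\<close>.\<close>

definition glue_dom ::
  "'i set \<Rightarrow> ('i \<Rightarrow> 'b::comm_semiring_1 set) \<Rightarrow> ('i \<Rightarrow> 'i \<Rightarrow> 'b set) \<Rightarrow> ('i \<times> 'b set) set set
    \<Rightarrow> ('i \<times> 'b set) set" where
  "glue_dom I A B U = (SIGMA i:I. chart_part I A B U i)"

definition glue_sections ::
  "'i set \<Rightarrow> ('i \<Rightarrow> 'b::comm_semiring_1 set) \<Rightarrow> ('i \<Rightarrow> 'i \<Rightarrow> 'b set) \<Rightarrow> ('i \<times> 'b set) set set
    \<Rightarrow> ('i \<times> 'b set \<Rightarrow> ('b \<times> 'b) set) set" where
  "glue_sections I A B U = {s \<in> extensional (glue_dom I A B U).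
     (\<forall>i\<in>I. (\<lambda>p\<in>chart_part I A B U i. s (i, p)) \<in> affine_sections (A i) (chart_part I A B U i)) \<and>
     (\<forall>i\<in>I. \<forall>j\<in>I. \<forall>P\<in>Spec (B i j). glue_point I A B i (P \<inter> A i) \<in> U \<longrightarrow>
        loc_rel (B i j) (B i j - P) `` s (i, P \<inter> A i) =
        loc_rel (B i j) (B i j - P) `` s (j, P \<inter> A j))}"

record ('p, 'k, 's) semimodule_presheaf =
  sections :: "'p set \<Rightarrow> ('k, 's) semimodule"
  restr :: "'p set \<Rightarrow> 'p set \<Rightarrow> 's \<Rightarrow> 's"

text \<open>The structure sheaf of the glued scheme as a sheaf of semimodules over a coefficient semiring
  that maps to all charts by \<open>\<kappa>\<close>. A scalar acts by multiplication with the constant section it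
  defines. \<open>restr F U V\<close> is the restriction map from \<open>U\<close> to \<open>V \<subseteq> U\<close>.\<close>

definition glue_sheaf ::
  "('k \<Rightarrow> 'b) \<Rightarrow> 'i set \<Rightarrow> ('i \<Rightarrow> 'b::comm_semiring_1 set) \<Rightarrow> ('i \<Rightarrow> 'i \<Rightarrow> 'b set)
    \<Rightarrow> (('i \<times> 'b set) set, 'k, 'i \<times> 'b set \<Rightarrow> ('b \<times> 'b) set) semimodule_presheaf" where
  "glue_sheaf \<kappa> I A B = \<lparr>
     sections = (\<lambda>U. \<lparr>
       smcarrier = glue_sections I A B U,
       smadd = (\<lambda>s t. \<lambda>(i, p)\<in>glue_dom I A B U. loc_add (A i) (A i - p) (s (i, p)) (t (i, p))),
       smzero = (\<lambda>(i, p)\<in>glue_dom I A B U. fraction (A i) (A i - p) 0 1),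
       smscale = (\<lambda>k s. \<lambda>(i, p)\<in>glue_dom I A B U.
         loc_mult (A i) (A i - p) (fraction (A i) (A i - p) (\<kappa> k) 1) (s (i, p)))\<rparr>),
     restr = (\<lambda>U V s. restrict s (glue_dom I A B V))\<rparr>"


section \<open>Projective space\<close>

text \<open>All charts and overlaps of projective space are subsemirings of the Laurent polynomials in
  \<open>x\<^sub>0, x\<^sub>1, \<dots>\<close>, that is, of the semigroup semiring of the finitely supported integer exponent
  vectors.\<close>

type_synonym 'k laurent = "(nat \<Rightarrow>\<^sub>0 int) \<Rightarrow>\<^sub>0 'k"

definition const :: "'k::comm_semiring_1 \<Rightarrow> 'k laurent" where
  "const c = Poly_Mapping.single 0 c"

definition xquot :: "nat \<Rightarrow> nat \<Rightarrow> 'k::comm_semiring_1 laurent" where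
  "xquot j i = Poly_Mapping.single (Poly_Mapping.single j 1 - Poly_Mapping.single i 1) 1"

text \<open>\<open>proj_chart M n i\<close> is \<open>M[x\<^sub>0/x\<^sub>i, \<dots>, x\<^sub>n/x\<^sub>i]\<close> and \<open>proj_overlap M n i j\<close> is its localization
  at \<open>x\<^sub>j/x\<^sub>i\<close>.\<close>

definition proj_chart :: "'k::comm_semiring_1 itself \<Rightarrow> nat \<Rightarrow> nat \<Rightarrow> 'k laurent set" where
  "proj_chart M n i = generated_subsemiring (range const \<union> {xquot j i | j. j \<le> n})"

definition proj_overlap :: "'k::comm_semiring_1 itself \<Rightarrow> nat \<Rightarrow> nat \<Rightarrow> nat \<Rightarrow> 'k laurent set" where
  "proj_overlap M n i j = generated_subsemiring (proj_chart M n i \<union> {xquot i j})"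

type_synonym 'k proj_point = "(nat \<times> 'k laurent set) set"
type_synonym 'k proj_section = "nat \<times> 'k laurent set \<Rightarrow> ('k laurent \<times> 'k laurent) set"

definition proj_space :: "'k::comm_semiring_1 itself \<Rightarrow> nat \<Rightarrow> 'k proj_point topology" where
  "proj_space M n = glue_top {..n} (proj_chart M n) (proj_overlap M n)"

definition proj_structure_sheaf ::
  "'k::comm_semiring_1 itself \<Rightarrow> nat \<Rightarrow> ('k proj_point, 'k, 'k proj_section) semimodule_presheaf" where
  "proj_structure_sheaf M n = glue_sheaf const {..n} (proj_chart M n) (proj_overlap M n)"

definition proj_D :: "'k::comm_semiring_1 itself \<Rightarrow> nat \<Rightarrow> nat \<Rightarrow> 'k proj_point set" where
  "proj_D M n i = glue_point {..n} (proj_chart M n) (proj_overlap M n) i ` Spec (proj_chart M n i)"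


section \<open>Cech cohomology of a covering\<close>

record ('i, 'p) covering =
  cov_index :: "'i set"
  cov_order :: "'i rel"
  cov_set :: "'i \<Rightarrow> 'p set"

definition open_covering :: "'p topology \<Rightarrow> ('i, 'p) covering \<Rightarrow> bool" where
  "open_covering X \<U> \<longleftrightarrow> linear_order_on (cov_index \<U>) (cov_order \<U>) \<and>
     (\<forall>i\<in>cov_index \<U>. openin X (cov_set \<U> i)) \<and> (\<Union>i\<in>cov_index \<U>. cov_set \<U> i) = topspace X"

text \<open>\<open>cech_simplices \<U> p\<close> consists of the sequences \<open>i\<^sub>0 < \<dots> < i\<^sub>p\<close>.\<close>

definition cech_simplices :: "('i, 'p) covering \<Rightarrow> nat \<Rightarrow> 'i list set" where
  "cech_simplices \<U> p = {\<sigma>. length \<sigma> = p + 1 \<and> set \<sigma> \<subseteq> cov_index \<U> \<and>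
     sorted_wrt (\<lambda>i j. (i, j) \<in> cov_order \<U> \<and> i \<noteq> j) \<sigma>}"

definition cov_inter :: "('i, 'p) covering \<Rightarrow> 'i list \<Rightarrow> 'p set" where
  "cov_inter \<U> \<sigma> = (\<Inter>i\<in>set \<sigma>. cov_set \<U> i)"

definition drop_at :: "nat \<Rightarrow> 'i list \<Rightarrow> 'i list" where
  "drop_at k \<sigma> = take k \<sigma> @ drop (Suc k) \<sigma>"

definition cech_cochains ::
  "('p, 'k, 's) semimodule_presheaf \<Rightarrow> ('i, 'p) covering \<Rightarrow> nat \<Rightarrow> ('k, 'i list \<Rightarrow> 's) semimodule" where
  "cech_cochains F \<U> p = \<lparr>
     smcarrier = (\<Pi>\<^sub>E \<sigma>\<in>cech_simplices \<U> p. smcarrier (sections F (cov_inter \<U> \<sigma>))),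
     smadd = (\<lambda>x y. \<lambda>\<sigma>\<in>cech_simplices \<U> p. smadd (sections F (cov_inter \<U> \<sigma>)) (x \<sigma>) (y \<sigma>)),
     smzero = (\<lambda>\<sigma>\<in>cech_simplices \<U> p. smzero (sections F (cov_inter \<U> \<sigma>))),
     smscale = (\<lambda>k x. \<lambda>\<sigma>\<in>cech_simplices \<U> p. smscale (sections F (cov_inter \<U> \<sigma>)) k (x \<sigma>))\<rparr>"

definition sm_sum_list :: "('k, 's) semimodule \<Rightarrow> 's list \<Rightarrow> 's" where
  "sm_sum_list A xs = foldr (smadd A) xs (smzero A)"

text \<open>The partial coboundary \<open>C\<^sup>p \<rightarrow> C\<^sup>p\<^sup>+\<^sup>1\<close> that sums over the positions \<open>0 \<le> k \<le> p + 1\<close> satisfying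
  \<open>Q\<close>.\<close>

definition cech_partial ::
  "(nat \<Rightarrow> bool) \<Rightarrow> ('p, 'k, 's) semimodule_presheaf \<Rightarrow> ('i, 'p) covering \<Rightarrow> nat
    \<Rightarrow> ('i list \<Rightarrow> 's) \<Rightarrow> 'i list \<Rightarrow> 's" where
  "cech_partial Q F \<U> p x = (\<lambda>\<sigma>\<in>cech_simplices \<U> (p + 1).
     sm_sum_list (sections F (cov_inter \<U> \<sigma>))
       (map (\<lambda>k. restr F (cov_inter \<U> (drop_at k \<sigma>)) (cov_inter \<U> \<sigma>) (x (drop_at k \<sigma>)))
         (filter Q [0..<p + 2])))"

abbreviation "cech_dplus \<equiv> cech_partial even"
abbreviation "cech_dminus \<equiv> cech_partial odd"

definition cech_cocycles ::
  "('p, 'k, 's) semimodule_presheaf \<Rightarrow> ('i, 'p) covering \<Rightarrow> nat \<Rightarrow> ('i list \<Rightarrow> 's) set" where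
  "cech_cocycles F \<U> p =
     {x \<in> smcarrier (cech_cochains F \<U> p). cech_dplus F \<U> p x = cech_dminus F \<U> p x}"

text \<open>For \<open>p = 0\<close> the cochains \<open>u, v \<in> C\<^sup>-\<^sup>1 = 0\<close> contribute nothing, which leaves equality.\<close>

definition cech_rho ::
  "('p, 'k, 's) semimodule_presheaf \<Rightarrow> ('i, 'p) covering \<Rightarrow> nat \<Rightarrow> ('i list \<Rightarrow> 's) rel" where
  "cech_rho F \<U> p = {(x, y). x \<in> cech_cocycles F \<U> p \<and> y \<in> cech_cocycles F \<U> p \<and>
     (case p of
        0 \<Rightarrow> x = y
      | Suc q \<Rightarrow> \<exists>u\<in>smcarrier (cech_cochains F \<U> q). \<exists>v\<in>smcarrier (cech_cochains F \<U> q).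
          smadd (cech_cochains F \<U> p)
            (smadd (cech_cochains F \<U> p) x (cech_dplus F \<U> q u)) (cech_dminus F \<U> q v) =
          smadd (cech_cochains F \<U> p)
            (smadd (cech_cochains F \<U> p) y (cech_dplus F \<U> q v)) (cech_dminus F \<U> q u))}"

definition cech_cohomology ::
  "('p, 'k, 's) semimodule_presheaf \<Rightarrow> ('i, 'p) covering \<Rightarrow> nat \<Rightarrow> ('k, ('i list \<Rightarrow> 's) set) semimodule"
  where
  "cech_cohomology F \<U> p = \<lparr>
     smcarrier = cech_cocycles F \<U> p // cech_rho F \<U> p,
     smadd = (\<lambda>\<xi> \<eta>. \<Union>x\<in>\<xi>. \<Union>y\<in>\<eta>. cech_rho F \<U> p `` {smadd (cech_cochains F \<U> p) x y}),
     smzero = cech_rho F \<U> p `` {smzero (cech_cochains F \<U> p)},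
     smscale = (\<lambda>k \<xi>. \<Union>x\<in>\<xi>. cech_rho F \<U> p `` {smscale (cech_cochains F \<U> p) k x})\<rparr>"


section \<open>Cech cohomology in degree zero as a colimit over all coverings\<close>

text \<open>\<open>refines_by \<V> \<U> r\<close>: the map \<open>r\<close> of index sets exhibits \<open>\<V>\<close> as a refinement of \<open>\<U>\<close>.\<close>

definition refines_by :: "('j, 'p) covering \<Rightarrow> ('i, 'p) covering \<Rightarrow> ('j \<Rightarrow> 'i) \<Rightarrow> bool" where
  "refines_by \<V> \<U> r \<longleftrightarrow>
     (\<forall>j\<in>cov_index \<V>. r j \<in> cov_index \<U> \<and> cov_set \<V> j \<subseteq> cov_set \<U> (r j))"

definition cech_refine0 ::
  "('p, 'k, 's) semimodule_presheaf \<Rightarrow> ('i, 'p) covering \<Rightarrow> ('j, 'p) covering \<Rightarrow> ('j \<Rightarrow> 'i)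
    \<Rightarrow> ('i list \<Rightarrow> 's) \<Rightarrow> 'j list \<Rightarrow> 's" where
  "cech_refine0 F \<U> \<V> r x = (\<lambda>\<sigma>\<in>cech_simplices \<V> 0.
     restr F (cov_inter \<U> (map r \<sigma>)) (cov_inter \<V> \<sigma>) (x (map r \<sigma>)))"

definition cech_transition0 ::
  "('p, 'k, 's) semimodule_presheaf \<Rightarrow> ('i, 'p) covering \<Rightarrow> ('j, 'p) covering \<Rightarrow> ('j \<Rightarrow> 'i)
    \<Rightarrow> ('i list \<Rightarrow> 's) set \<Rightarrow> ('j list \<Rightarrow> 's) set" where
  "cech_transition0 F \<U> \<V> r \<xi> = cech_rho F \<V> 0 `` (cech_refine0 F \<U> \<V> r ` \<xi>)"

text \<open>The colimit ranges over all coverings indexed by sets of subsets of \<open>X\<close>. This is no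
  restriction: every open covering is, up to mutual refinement, indexed by the set of its members.\<close>

definition colim_pairs ::
  "'p topology \<Rightarrow> ('p, 'k, 's) semimodule_presheaf
    \<Rightarrow> (('p set, 'p) covering \<times> ('p set list \<Rightarrow> 's) set) set" where
  "colim_pairs X F = {(\<U>, \<xi>). open_covering X \<U> \<and> \<xi> \<in> smcarrier (cech_cohomology F \<U> 0)}"

definition colim_rel ::
  "'p topology \<Rightarrow> ('p, 'k, 's) semimodule_presheaf
    \<Rightarrow> (('p set, 'p) covering \<times> ('p set list \<Rightarrow> 's) set) rel" where
  "colim_rel X F = {((\<U>, \<xi>), (\<V>, \<eta>)). (\<U>, \<xi>) \<in> colim_pairs X F \<and> (\<V>, \<eta>) \<in> colim_pairs X F \<and>
     (\<exists>(\<W> :: ('p set, 'p) covering) r s. open_covering X \<W> \<and> refines_by \<W> \<U> r \<and> refines_by \<W> \<V> s \<and>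
        cech_transition0 F \<U> \<W> r \<xi> = cech_transition0 F \<V> \<W> s \<eta>)}"

text \<open>Two classes are added after moving representatives to a common refinement.\<close>

definition cech_H0 ::
  "'p topology \<Rightarrow> ('p, 'k, 's) semimodule_presheaf
    \<Rightarrow> ('k, (('p set, 'p) covering \<times> ('p set list \<Rightarrow> 's) set) set) semimodule" where
  "cech_H0 X F = \<lparr>
     smcarrier = colim_pairs X F // colim_rel X F,
     smadd = (\<lambda>a b. \<Union>{colim_rel X F `` {(\<W>, smadd (cech_cohomology F \<W> 0)
         (cech_transition0 F \<U> \<W> r \<xi>) (cech_transition0 F \<V> \<W> s \<eta>))} | \<U> \<xi> \<V> \<eta> \<W> r s.
       (\<U>, \<xi>) \<in> a \<and> (\<V>, \<eta>) \<in> b \<and> open_covering X \<W> \<and> refines_by \<W> \<U> r \<and> refines_by \<W> \<V> s}),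
     smzero = \<Union>{colim_rel X F `` {(\<U>, smzero (cech_cohomology F \<U> 0))} | \<U>. open_covering X \<U>},
     smscale = (\<lambda>k a. \<Union>{colim_rel X F `` {(\<U>, smscale (cech_cohomology F \<U> 0) k \<xi>)} | \<U> \<xi>.
       (\<U>, \<xi>) \<in> a})\<rparr>"

definition proj_standard_covering :: "'k::comm_semiring_1 itself \<Rightarrow> nat \<Rightarrow> (nat, 'k proj_point) covering"
  where
  "proj_standard_covering M n =
     \<lparr>cov_index = {..n}, cov_order = {(i, j). i \<le> j \<and> j \<le> n}, cov_set = proj_D M n\<rparr>"

end

theory Submission
  imports Defs
begin

text \<open>In an idempotent semifield \<open>x + y = 0\<close> forces \<open>x = y = 0\<close>, so the non-units of
  \<open>\<O>(D(\<Prod>\<^sub>j\<^sub>\<in>\<^sub>S x\<^sub>j))\<close> form an ideal and this affine open set has a single closed point. A section is a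
  fraction near that point, hence everywhere: sections are the Laurent polynomials of degree \<open>0\<close> whose
  exponents are nonnegative outside \<open>S\<close>.

  For \<open>m \<ge> 1\<close> two cocycles \<open>x\<close> and \<open>y\<close> are identified by \<open>u = v\<close> as soon as \<open>d\<^sup>+ u + d\<^sup>- u\<close> absorbs both. The
  only monomials on \<open>\<sigma>\<close> that no face can absorb are those whose exponents are negative on all of \<open>\<sigma>\<close>, and
  the cocycle condition on a simplex \<open>\<sigma> \<union> {j}\<close> shows that they do not occur.

  In degree \<open>0\<close>, every open covering has for each \<open>i\<close> a member that contains the closed point of \<open>D(x\<^sub>i)\<close> and
  therefore \<open>D(x\<^sub>i)\<close> itself. So the standard covering refines all others, and global sections lie in the
  intersection of the chart semirings, which consists of the constants.\<close>

section \<open>Spectra and stalks of subsemirings\<close>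

text \<open>The obstacle is the lack of cancellation. With \<open>x = x_1/x_0\<close>, idempotence
  gives \<open>(1 + x) * (1 + x + x^2) = (1 + x) * (1 + x^2)\<close>, so the two distinct
  polynomials \<open>1 + x + x^2\<close> and \<open>1 + x^2\<close> have the same germ at the prime
  \<open>{0}\<close>. Localizing a chart can thus identify polynomials, equality of fractions needs
  an extra multiplier, and the germ at an arbitrary point need not determine a section. Stalk
  elements are therefore handled as the set of pairs representing a Laurent polynomial
  (\<open>germ\<close>), and a polynomial is recovered from its germ only at a closed point: there
  every multiplier and every denominator is a unit monomial and cancels. Other points are reached
  from the closed one, since a denominator that is a unit over an affine intersection serves at all
  its points at once, and other charts are reached through a prime of the overlap, whose stalk is
  the stalk of either chart. The same lack of cancellation is what makes higher cohomology collapse: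
  adding a sufficiently large cochain to both sides of the relation erases any difference that it
  dominates. The real content there is that faces can dominate a cocycle at all.\<close>

definition subsemiring :: "'b::comm_semiring_1 set \<Rightarrow> bool" where
  "subsemiring A \<longleftrightarrow> 0 \<in> A \<and> 1 \<in> A \<and> (\<forall>x\<in>A. \<forall>y\<in>A. x + y \<in> A) \<and> (\<forall>x\<in>A. \<forall>y\<in>A. x * y \<in> A)"

lemma subsemiringD:
  assumes "subsemiring A"
  shows "0 \<in> A" "1 \<in> A" "\<And>x y. x \<in> A \<Longrightarrow> y \<in> A \<Longrightarrow> x + y \<in> A"
    "\<And>x y. x \<in> A \<Longrightarrow> y \<in> A \<Longrightarrow> x * y \<in> A"
  using assms by (auto simp: subsemiring_def)

lemma SpecD:
  assumes "p \<in> Spec A"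
  shows "p \<subseteq> A" "0 \<in> p" "\<And>x y. x \<in> p \<Longrightarrow> y \<in> p \<Longrightarrow> x + y \<in> p"
    "\<And>a x. a \<in> A \<Longrightarrow> x \<in> p \<Longrightarrow> a * x \<in> p" "\<And>a x. a \<in> A \<Longrightarrow> x \<in> p \<Longrightarrow> x * a \<in> p"
    "\<And>x y. x \<in> A \<Longrightarrow> y \<in> A \<Longrightarrow> x * y \<in> p \<Longrightarrow> x \<in> p \<or> y \<in> p" "p \<noteq> A"
  using assms by (auto simp: Spec_def sr_ideal_def mult.commute)

lemma Spec_one: "subsemiring A \<Longrightarrow> p \<in> Spec A \<Longrightarrow> 1 \<notin> p"
  using SpecD(1,4,7)[of p A] by (metis mult.right_neutral subset_antisym subsetI)

lemma Spec_mult_notin: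
  "p \<in> Spec A \<Longrightarrow> subsemiring A \<Longrightarrow> x \<in> A - p \<Longrightarrow> y \<in> A - p \<Longrightarrow> x * y \<in> A - p"
  using SpecD(6)[of p A] subsemiringD(4)[of A] by blast

lemma openin_zariski:
  assumes "subsemiring A"
  shows "openin (zariski A) U \<longleftrightarrow> (\<exists>E\<subseteq>A. U = {p \<in> Spec A. \<not> E \<subseteq> p})"
  unfolding zariski_def
  by (subst topology_inverse'[OF istopology_zariski]) (use subsemiringD[OF assms] in auto)

lemma openin_zariski_Spec: "subsemiring A \<Longrightarrow> openin (zariski A) (Spec A)"
  using Spec_one[of A] subsemiringD[of A]
  by (auto simp: openin_zariski intro!: exI[of _ "{1}"])

lemma openin_zariski_basic:
  assumes "subsemiring A" "f \<in> A"
  shows "openin (zariski A) {p \<in> Spec A. f \<notin> p}"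
  using assms by (auto simp: openin_zariski intro!: exI[of _ "{f}"])

lemma Spec_contract:
  assumes A: "subsemiring A" and B: "subsemiring B" and AB: "A \<subseteq> B" and P: "P \<in> Spec B"
  shows "P \<inter> A \<in> Spec A"
proof -
  have "1 \<notin> P" using Spec_one[OF B P] .
  then have "P \<inter> A \<noteq> A" using subsemiringD(2)[OF A] by blast
  then show ?thesis
    using SpecD[OF P] subsemiringD[OF A] AB unfolding Spec_def sr_ideal_def
    by (auto simp: subset_iff)
qed

text \<open>Extension of a prime to a localization: \<open>den\<close> says that elements of
  \<open>B\<close> have denominators outside \<open>p\<close>, and the prime above \<open>p\<close>
  consists of those \<open>b\<close> that some element outside \<open>p\<close> multiplies into
  \<open>p\<close>.\<close>

lemma Spec_extend:
  assumes A: "subsemiring A" and B: "subsemiring B" and AB: "A \<subseteq> B" and p: "p \<in> Spec A"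
    and den: "\<And>b. b \<in> B \<Longrightarrow> \<exists>t\<in>A - p. t * b \<in> A"
  obtains P where "P \<in> Spec B" "P \<inter> A = p"
proof
  let ?P = "{b \<in> B. \<exists>t\<in>A - p. t * b \<in> p}"
  note A' = subsemiringD[OF A] and B' = subsemiringD[OF B] and p' = SpecD[OF p]
    and m = Spec_mult_notin[OF p A]
  have one: "1 \<in> A - p" using A' Spec_one[OF A p] by auto
  show "?P \<inter> A = p"
    using p'(1,6) AB one by (auto intro!: bexI[of _ 1])
  have "sr_ideal B ?P"
    unfolding sr_ideal_def
  proof (intro conjI ballI)
    show "0 \<in> ?P" using B' p'(2) one by auto
    fix x y assume "x \<in> ?P" "y \<in> ?P"
    then obtain s t where st: "x \<in> B" "y \<in> B" "s \<in> A - p" "t \<in> A - p" "s * x \<in> p" "t * y \<in> p" by auto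
    have "(s * t) * (x + y) = t * (s * x) + s * (t * y)" by (simp add: algebra_simps)
    also have "\<dots> \<in> p" using st p' by auto
    finally show "x + y \<in> ?P" using st m[of s t] B' by auto
  next
    fix a x assume "a \<in> B" "x \<in> ?P"
    then obtain s t where st: "x \<in> B" "s \<in> A - p" "t \<in> A - p" "s * x \<in> p" "t * a \<in> A"
      using den by blast
    have "(s * t) * (a * x) = (t * a) * (s * x)" by (simp add: algebra_simps)
    also have "\<dots> \<in> p" using st p' by auto
    finally show "a * x \<in> ?P" using st m[of s t] B' \<open>a \<in> B\<close> by auto
  qed auto
  moreover have "1 \<notin> ?P" by auto
  then have "?P \<noteq> B" using B' by blast
  moreover have "x \<in> ?P \<or> y \<in> ?P" if xy: "x \<in> B" "y \<in> B" "x * y \<in> ?P" for x y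
  proof -
    \<comment> \<open>The denominators of \<open>x\<close> and \<open>y\<close> are cleared
      separately, so that primality of \<open>p\<close> applies to two factors that both lie in
      \<open>A\<close>.\<close>
    obtain r where r: "r \<in> A - p" "r * (x * y) \<in> p" using xy by auto
    obtain s t where st: "s \<in> A - p" "t \<in> A - p" "s * x \<in> A" "t * y \<in> A"
      using den[OF xy(1)] den[OF xy(2)] by blast
    have "r * ((s * x) * (t * y)) = s * t * (r * (x * y))" by (simp add: algebra_simps)
    also have "\<dots> \<in> p" using p'(4)[OF A'(4)[of s t] r(2)] st by blast
    finally have "r * ((s * x) * (t * y)) \<in> p" .
    then have "s * x \<in> p \<or> t * y \<in> p"
      using p'(6)[of r "(s * x) * (t * y)"] p'(6)[of "s * x" "t * y"] A'(4)[of "s * x" "t * y"] r st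
      by blast
    then show ?thesis using st xy by auto
  qed
  ultimately show "?P \<in> Spec B" unfolding Spec_def by blast
qed

text \<open>Membership of \<open>b\<close> is decided in \<open>A\<close> after multiplication by a
  denominator \<open>t\<close>, which avoids both primes because their traces on \<open>A\<close>
  agree.\<close>

lemma Spec_extend_unique:
  assumes A: "subsemiring A" and B: "subsemiring B" and AB: "A \<subseteq> B"
    and P: "P \<in> Spec B" and Q: "Q \<in> Spec B" and eq: "P \<inter> A = Q \<inter> A"
    and den: "\<And>b. b \<in> B \<Longrightarrow> \<exists>t\<in>A - P. t * b \<in> A"
  shows "P = Q"
proof -
  have "b \<in> P \<longleftrightarrow> b \<in> Q" if b: "b \<in> B" for b
  proof -
    obtain t where t: "t \<in> A" "t \<notin> P" "t * b \<in> A" using den[OF b] by auto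
    then have "t \<notin> Q" using eq by blast
    have "b \<in> P \<longleftrightarrow> t * b \<in> P" using SpecD(4)[OF P, of t b] SpecD(6)[OF P, of t b] t b AB by blast
    moreover have "b \<in> Q \<longleftrightarrow> t * b \<in> Q"
      using SpecD(4)[OF Q, of t b] SpecD(6)[OF Q, of t b] t b AB \<open>t \<notin> Q\<close> by blast
    ultimately show ?thesis using eq t by blast
  qed
  then show ?thesis using SpecD(1)[OF P] SpecD(1)[OF Q] by blast
qed

text \<open>The pairs representing, in the stalk of \<open>Spec A\<close> at \<open>p\<close>, an element \<open>g\<close> of an ambient semiring.
  This set is a class of fractions as soon as it is nonempty.\<close>

definition germ :: "'b::comm_semiring_1 set \<Rightarrow> 'b set \<Rightarrow> 'b \<Rightarrow> ('b \<times> 'b) set" where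
  "germ A p g = {(b, t). b \<in> A \<and> t \<in> A - p \<and> (\<exists>h\<in>A - p. h * b = h * (t * g))}"

text \<open>The bridge from equivalence classes to ambient elements: one representing pair generates
  the whole germ. In both directions the multipliers \<open>h\<close> and \<open>k\<close> are
  multiplied together, since nothing may be cancelled.\<close>

lemma fraction_eq_germ:
  assumes A: "subsemiring A" and p: "p \<in> Spec A" and as: "(a, s) \<in> germ A p g"
  shows "fraction A (A - p) a s = germ A p g"
proof -
  note m = Spec_mult_notin[OF p A]
  obtain k where k: "a \<in> A" "s \<in> A - p" "k \<in> A - p" "k * a = k * (s * g)"
    using as by (auto simp: germ_def)
  have "(\<exists>h\<in>A - p. h * a * t = h * b * s) \<longleftrightarrow> (\<exists>h\<in>A - p. h * b = h * (t * g))"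
    if bt: "b \<in> A" "t \<in> A - p" for b t
  proof
    assume "\<exists>h\<in>A - p. h * a * t = h * b * s"
    then obtain h where h: "h \<in> A - p" "h * a * t = h * b * s" by auto
    have "(k * h * s) * b = k * (h * b * s)" by (simp add: algebra_simps)
    also have "\<dots> = h * t * (k * a)" using h(2)[symmetric] by (simp add: algebra_simps)
    also have "\<dots> = (k * h * s) * (t * g)" unfolding k(4) by (simp add: algebra_simps)
    finally show "\<exists>h\<in>A - p. h * b = h * (t * g)" using m[OF m[OF k(3) h(1)] k(2)] by blast
  next
    assume "\<exists>h\<in>A - p. h * b = h * (t * g)"
    then obtain h where h: "h \<in> A - p" "h * b = h * (t * g)" by auto
    have "(k * h) * a * t = (k * a) * (h * t)" by (simp add: algebra_simps)
    also have "\<dots> = k * s * (h * b)" unfolding k(4) h(2) by (simp add: algebra_simps)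
    also have "\<dots> = (k * h) * b * s" by (simp add: algebra_simps)
    finally show "\<exists>h\<in>A - p. h * a * t = h * b * s" using m[OF k(3) h(1)] by blast
  qed
  then show ?thesis
    using k by (auto simp: fraction_def loc_rel_def germ_def)
qed

lemma germ_memI:
  assumes "subsemiring A" "p \<in> Spec A" "s \<in> A - p" "s * g \<in> A"
  shows "(s * g, s) \<in> germ A p g"
  using assms by (auto simp: germ_def)

lemma germ_in_localization:
  assumes A: "subsemiring A" and p: "p \<in> Spec A" and ne: "germ A p g \<noteq> {}"
  shows "germ A p g \<in> localization A (A - p)"
proof -
  obtain a s where as: "(a, s) \<in> germ A p g" using ne by auto
  then have "a \<in> A" "s \<in> A - p" by (auto simp: germ_def)
  with fraction_eq_germ[OF A p as, symmetric] show ?thesis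
    by (auto simp: localization_def quotient_def fraction_def)
qed

lemma germ_add_mem:
  assumes A: "subsemiring A" and p: "p \<in> Spec A"
    and "(a, s) \<in> germ A p f" "(b, t) \<in> germ A p g"
  shows "(a * t + b * s, s * t) \<in> germ A p (f + g)"
proof -
  note m = Spec_mult_notin[OF p A]
  obtain h where as: "a \<in> A" "s \<in> A - p" and h: "h \<in> A - p" "h * a = h * (s * f)"
    using assms by (auto simp: germ_def)
  obtain k where bt: "b \<in> A" "t \<in> A - p" and k: "k \<in> A - p" "k * b = k * (t * g)"
    using assms by (auto simp: germ_def)
  have "(h * k) * (a * t + b * s) = (h * a) * (k * t) + (k * b) * (h * s)" by (simp add: algebra_simps)
  also have "\<dots> = (h * k) * ((s * t) * (f + g))" unfolding h k by (simp add: algebra_simps)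
  finally show ?thesis
    using m[OF h(1) k(1)] m[OF as(2) bt(2)] subsemiringD(3,4)[OF A] as bt unfolding germ_def by auto
qed

lemma germ_mult_mem:
  assumes A: "subsemiring A" and p: "p \<in> Spec A"
    and "(a, s) \<in> germ A p f" "(b, t) \<in> germ A p g"
  shows "(a * b, s * t) \<in> germ A p (f * g)"
proof -
  note m = Spec_mult_notin[OF p A]
  obtain h where as: "a \<in> A" "s \<in> A - p" and h: "h \<in> A - p" "h * a = h * (s * f)"
    using assms by (auto simp: germ_def)
  obtain k where bt: "b \<in> A" "t \<in> A - p" and k: "k \<in> A - p" "k * b = k * (t * g)"
    using assms by (auto simp: germ_def)
  have "(h * k) * (a * b) = (h * a) * (k * b)" by (simp add: algebra_simps)
  also have "\<dots> = (h * k) * ((s * t) * (f * g))" unfolding h k by (simp add: algebra_simps)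
  finally show ?thesis
    using m[OF h(1) k(1)] m[OF as(2) bt(2)] subsemiringD(3,4)[OF A] as bt unfolding germ_def by auto
qed

text \<open>The sum in a stalk is a union over representatives. All members of this union are the
  same class, and nonemptiness of the two germs keeps the union from being empty.\<close>

lemma loc_add_germ:
  assumes A: "subsemiring A" and p: "p \<in> Spec A" and ne: "germ A p f \<noteq> {}" "germ A p g \<noteq> {}"
  shows "loc_add A (A - p) (germ A p f) (germ A p g) = germ A p (f + g)"
proof -
  have "fraction A (A - p) (a * t + b * s) (s * t) = germ A p (f + g)"
    if "(a, s) \<in> germ A p f" "(b, t) \<in> germ A p g" for a s b t
    using fraction_eq_germ[OF A p germ_add_mem[OF A p that]] .
  then show ?thesis unfolding loc_add_def using ne by fastforce
qed

lemma loc_mult_germ: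
  assumes A: "subsemiring A" and p: "p \<in> Spec A" and ne: "germ A p f \<noteq> {}" "germ A p g \<noteq> {}"
  shows "loc_mult A (A - p) (germ A p f) (germ A p g) = germ A p (f * g)"
proof -
  have "fraction A (A - p) (a * b) (s * t) = germ A p (f * g)"
    if "(a, s) \<in> germ A p f" "(b, t) \<in> germ A p g" for a s b t
    using fraction_eq_germ[OF A p germ_mult_mem[OF A p that]] .
  then show ?thesis unfolding loc_mult_def using ne by fastforce
qed

lemma germ_of_mem:
  assumes A: "subsemiring A" and p: "p \<in> Spec A" and "a \<in> A"
  shows "(a, 1) \<in> germ A p a" "fraction A (A - p) a 1 = germ A p a" "germ A p a \<noteq> {}"
proof -
  show *: "(a, 1) \<in> germ A p a"
    using germ_memI[OF A p, of 1 a] subsemiringD[OF A] Spec_one[OF A p] \<open>a \<in> A\<close> by simp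
  show "fraction A (A - p) a 1 = germ A p a" using fraction_eq_germ[OF A p *] .
  show "germ A p a \<noteq> {}" using * by blast
qed

lemma loc_rel_equiv:
  assumes A: "subsemiring A" and p: "p \<in> Spec A"
  shows "equiv (A \<times> (A - p)) (loc_rel A (A - p))"
proof (rule equivI)
  note m = Spec_mult_notin[OF p A]
  have one: "1 \<in> A - p" using subsemiringD[OF A] Spec_one[OF A p] by auto
  show "loc_rel A (A - p) \<subseteq> (A \<times> (A - p)) \<times> (A \<times> (A - p))" by (auto simp: loc_rel_def)
  show "refl_on (A \<times> (A - p)) (loc_rel A (A - p))"
    using one by (auto simp: refl_on_def loc_rel_def)
  show "sym (loc_rel A (A - p))"
  proof (rule symI)
    fix x y assume xy: "(x, y) \<in> loc_rel A (A - p)"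
    obtain a s b t where ab: "x = (a, s)" "y = (b, t)" by (metis surj_pair)
    obtain h where "h \<in> A - p" "h * a * t = h * b * s" using xy ab by (auto simp: loc_rel_def)
    then have "\<exists>h\<in>A - p. h * b * s = h * a * t" by metis
    then show "(y, x) \<in> loc_rel A (A - p)" using xy unfolding ab loc_rel_def by simp
  qed
  show "trans (loc_rel A (A - p))"
  proof (rule transI)
    fix x y z assume xy: "(x, y) \<in> loc_rel A (A - p)" and yz: "(y, z) \<in> loc_rel A (A - p)"
    obtain a s b t c u where abc: "x = (a, s)" "y = (b, t)" "z = (c, u)" by (metis surj_pair)
    obtain h where h: "h \<in> A - p" "h * a * t = h * b * s" using xy abc by (auto simp: loc_rel_def)
    obtain k where k: "k \<in> A - p" "k * b * u = k * c * t" using yz abc by (auto simp: loc_rel_def)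
    have "(h * k * t) * a * u = (h * a * t) * (k * u)" by (simp add: algebra_simps)
    also have "\<dots> = (k * b * u) * (h * s)" unfolding h(2) by (simp add: algebra_simps)
    also have "\<dots> = (h * k * t) * c * s" unfolding k(2) by (simp add: algebra_simps)
    finally show "(x, z) \<in> loc_rel A (A - p)"
      using xy yz abc m[OF m[OF h(1) k(1)], of t] by (auto simp: loc_rel_def)
  qed
qed

lemma localization_cases:
  assumes "x \<in> localization A S"
  obtains a s where "a \<in> A" "s \<in> S" "x = fraction A S a s"
  using assms by (auto simp: localization_def quotient_def fraction_def)

lemma fraction_self_mem:
  assumes A: "subsemiring A" and p: "p \<in> Spec A" and "a \<in> A" "s \<in> A - p"
  shows "(a, s) \<in> fraction A (A - p) a s"
  using equiv_class_self[OF loc_rel_equiv[OF A p]] assms by (simp add: fraction_def)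

text \<open>\<open>sm_sum_list\<close> of a one-element list still adds the zero section. Comparing
  0-cocycles of an arbitrary covering needs this law for stalk elements that are not yet known to be
  germs of a polynomial.\<close>

lemma loc_add_zero:
  assumes A: "subsemiring A" and p: "p \<in> Spec A" and x: "x \<in> localization A (A - p)"
  shows "loc_add A (A - p) x (fraction A (A - p) 0 1) = x"
proof -
  note m = Spec_mult_notin[OF p A] and A' = subsemiringD[OF A]
  obtain c u where cu: "c \<in> A" "u \<in> A - p" "x = fraction A (A - p) c u"
    using x by (rule localization_cases)
  have "fraction A (A - p) (a * t + b * s) (s * t) = x"
    if as: "(a, s) \<in> x" and bt: "(b, t) \<in> fraction A (A - p) 0 1" for a s b t
  proof -
    have r: "((c, u), (a, s)) \<in> loc_rel A (A - p)" using as cu by (simp add: fraction_def)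
    obtain h where h: "h \<in> A - p" "h * b = 0" "t \<in> A - p" "b \<in> A"
      using bt by (auto simp: fraction_def loc_rel_def)
    have as': "a \<in> A" "s \<in> A - p" using r by (auto simp: loc_rel_def)
    have "h * a * (s * t) = (h * a * t) * s + (h * b) * s * s"
      unfolding h(2) by (simp add: algebra_simps)
    also have "\<dots> = h * (a * t + b * s) * s" by (simp add: algebra_simps)
    finally have "((a, s), (a * t + b * s, s * t)) \<in> loc_rel A (A - p)"
      unfolding loc_rel_def using h as' A' m[OF as'(2) h(3)] by auto
    then have "((c, u), (a * t + b * s, s * t)) \<in> loc_rel A (A - p)"
      using r loc_rel_equiv[OF A p] by (meson equivE transE)
    then show ?thesis
      unfolding cu(3) fraction_def using equiv_class_eq[OF loc_rel_equiv[OF A p]] by metis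
  qed
  moreover have "(c, u) \<in> x" using fraction_self_mem[OF A p] cu by blast
  moreover have "(0, 1) \<in> fraction A (A - p) 0 1"
    using fraction_self_mem[OF A p, of 0 1] A' Spec_one[OF A p] by blast
  ultimately show ?thesis unfolding loc_add_def by fastforce
qed

text \<open>Pullback to the overlap keeps the ambient element. For this reason the germs of one
  polynomial, taken in different charts, satisfy the gluing condition.\<close>

lemma loc_rel_image_germ:
  assumes A: "subsemiring A" and B: "subsemiring B" and AB: "A \<subseteq> B" and P: "P \<in> Spec B"
    and ne: "germ A (P \<inter> A) g \<noteq> {}"
  shows "loc_rel B (B - P) `` germ A (P \<inter> A) g = germ B P g"
proof -
  have sub: "germ A (P \<inter> A) g \<subseteq> germ B P g" using AB by (auto simp: germ_def)
  have "loc_rel B (B - P) `` {x} = germ B P g" if "x \<in> germ A (P \<inter> A) g" for x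
    using fraction_eq_germ[OF B P, of "fst x" "snd x" g] that sub by (auto simp: fraction_def)
  then show ?thesis using ne by blast
qed

text \<open>The injective half of the isomorphism between the stalks of a chart and of an overlap: a
  multiplier \<open>h\<close> that witnesses equality over \<open>B\<close> is moved into
  \<open>A\<close> by a denominator \<open>t\<close>.\<close>

lemma fraction_eq_germ_of_extension:
  assumes A: "subsemiring A" and B: "subsemiring B" and AB: "A \<subseteq> B" and P: "P \<in> Spec B"
    and den: "\<And>b. b \<in> B \<Longrightarrow> \<exists>t\<in>A - P. t * b \<in> A"
    and as: "a \<in> A" "s \<in> A - P"
    and eq: "loc_rel B (B - P) `` fraction A (A - P \<inter> A) a s = germ B P g"
  shows "fraction A (A - P \<inter> A) a s = germ A (P \<inter> A) g"
proof -
  have p: "P \<inter> A \<in> Spec A" using Spec_contract[OF A B AB P] .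
  have "(a, s) \<in> fraction A (A - P \<inter> A) a s" using fraction_self_mem[OF A p] as by blast
  moreover have "((a, s), (a, s)) \<in> loc_rel B (B - P)"
    using equivE[OF loc_rel_equiv[OF B P]] as AB by (auto simp: refl_on_def)
  ultimately have "(a, s) \<in> germ B P g" unfolding eq[symmetric] by blast
  then obtain h where h: "h \<in> B - P" "h * a = h * (s * g)" by (auto simp: germ_def)
  obtain t where t: "t \<in> A - P" "t * h \<in> A" using den h by blast
  have "t * h \<in> B - P" using Spec_mult_notin[OF P B, of t h] t h AB by blast
  then have "t * h \<in> A - P \<inter> A" using t by blast
  moreover have "(t * h) * a = (t * h) * (s * g)" using h(2) by (simp add: mult.assoc)
  ultimately have "(a, s) \<in> germ A (P \<inter> A) g" using as by (auto simp: germ_def)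
  then show ?thesis by (rule fraction_eq_germ[OF A p])
qed

section \<open>Laurent polynomials over an idempotent semifield\<close>

text \<open>Adding the vanishing sum to \<open>x\<close> changes nothing, while idempotence absorbs
  the second \<open>x\<close>; hence \<open>x\<close> equals the sum.\<close>

lemma add_eq_0_idem:
  fixes x y :: "'k::idempotent_semifield"
  shows "x + y = 0 \<longleftrightarrow> x = 0 \<and> y = 0"
proof
  have *: "x = 0" if "x + y = 0" for x y :: 'k
  proof -
    have "x = x + (x + y)" using that by simp
    also have "\<dots> = x + y" by (simp add: add.assoc[symmetric] add_idem)
    finally show ?thesis using that by simp
  qed
  assume "x + y = 0"
  then show "x = 0 \<and> y = 0" using *[of x y] *[of y x] by (simp add: add.commute)
qed simp

lemma mult_eq_0_semifield:
  fixes x y :: "'k::idempotent_semifield"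
  shows "x * y = 0 \<longleftrightarrow> x = 0 \<or> y = 0"
proof
  assume xy: "x * y = 0"
  show "x = 0 \<or> y = 0"
  proof (rule disjCI)
    assume "y \<noteq> 0"
    then obtain z where z: "y * z = 1" using ex_inverse by blast
    have "x = (x * y) * z" using z by (simp add: mult.assoc)
    then show "x = 0" using xy by simp
  qed
qed auto

lemma keys_add_idem:
  fixes f g :: "'a \<Rightarrow>\<^sub>0 'k::idempotent_semifield"
  shows "Poly_Mapping.keys (f + g) = Poly_Mapping.keys f \<union> Poly_Mapping.keys g"
  by (auto simp: in_keys_iff lookup_add add_eq_0_idem)

lemma single_eq_0 [simp]: "Poly_Mapping.single e c = 0 \<longleftrightarrow> c = 0"
  by (metis lookup_single_eq lookup_zero single_zero)

lemma poly_mapping_sum_single: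
  fixes f :: "'a \<Rightarrow>\<^sub>0 'k::comm_monoid_add"
  shows "(\<Sum>e\<in>Poly_Mapping.keys f. Poly_Mapping.single e (Poly_Mapping.lookup f e)) = f"
proof (rule poly_mapping_eqI)
  fix k
  have "(\<Sum>e\<in>Poly_Mapping.keys f. Poly_Mapping.lookup (Poly_Mapping.single e (Poly_Mapping.lookup f e)) k) =
    (\<Sum>e\<in>Poly_Mapping.keys f. if e = k then Poly_Mapping.lookup f e else 0)"
    by (rule sum.cong) (auto simp: lookup_single when_def)
  then show "Poly_Mapping.lookup (\<Sum>e\<in>Poly_Mapping.keys f. Poly_Mapping.single e (Poly_Mapping.lookup f e)) k
      = Poly_Mapping.lookup f k"
    by (auto simp: lookup_sum in_keys_iff)
qed

text \<open>Splitting one monomial off each factor writes the product as a nonzero monomial plus a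
  remainder, and no remainder can cancel it.\<close>

lemma keys_mult_idem:
  fixes f g :: "'a::comm_monoid_add \<Rightarrow>\<^sub>0 'k::idempotent_semifield"
  assumes a: "a \<in> Poly_Mapping.keys f" and b: "b \<in> Poly_Mapping.keys g"
  shows "a + b \<in> Poly_Mapping.keys (f * g)"
proof -
  have split: "\<exists>h'. h = Poly_Mapping.single c (Poly_Mapping.lookup h c) + h'"
    if "c \<in> Poly_Mapping.keys h" for c and h :: "'a \<Rightarrow>\<^sub>0 'k"
    using sum.remove[OF finite_keys that, of "\<lambda>e. Poly_Mapping.single e (Poly_Mapping.lookup h e)"]
    by (auto simp: poly_mapping_sum_single)
  obtain f' where f: "f = Poly_Mapping.single a (Poly_Mapping.lookup f a) + f'" using split[OF a] by blast
  obtain g' where g: "g = Poly_Mapping.single b (Poly_Mapping.lookup g b) + g'" using split[OF b] by blast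
  have "f * g = Poly_Mapping.single a (Poly_Mapping.lookup f a) * Poly_Mapping.single b (Poly_Mapping.lookup g b)
      + (Poly_Mapping.single a (Poly_Mapping.lookup f a) * g' + f' * g)"
    using f g by (metis add.assoc distrib_left distrib_right)
  then have "Poly_Mapping.keys (Poly_Mapping.single a (Poly_Mapping.lookup f a) * Poly_Mapping.single b (Poly_Mapping.lookup g b)) \<subseteq> Poly_Mapping.keys (f * g)"
    by (metis keys_add_idem Un_upper1)
  then show ?thesis using a b by (auto simp: mult_single in_keys_iff mult_eq_0_semifield)
qed

section \<open>Charts and overlaps described by exponents\<close>

definition lexps :: "nat \<Rightarrow> nat set \<Rightarrow> (nat \<Rightarrow>\<^sub>0 int) set" where
  "lexps n S = {e. (\<forall>k>n. Poly_Mapping.lookup e k = 0) \<and> (\<Sum>k\<le>n. Poly_Mapping.lookup e k) = 0 \<and>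
     (\<forall>k. k \<notin> S \<longrightarrow> 0 \<le> Poly_Mapping.lookup e k)}"

text \<open>For \<open>S\<close> inside \<open>{..n}\<close> this is the degree zero part of the
  localization of \<open>M[x_0, ..., x_n]\<close> at the product of the \<open>x_j\<close> with
  \<open>j\<close> in \<open>S\<close>. Inclusions and intersections can be read off from exponents,
  which generators would not allow.\<close>

definition laur :: "nat \<Rightarrow> nat set \<Rightarrow> 'k::comm_semiring_1 laurent set" where
  "laur n S = {f. Poly_Mapping.keys f \<subseteq> lexps n S}"

lemma lexps_zero [simp]: "0 \<in> lexps n S" by (simp add: lexps_def)

lemma lexps_add: "d \<in> lexps n S \<Longrightarrow> e \<in> lexps n S \<Longrightarrow> d + e \<in> lexps n S"
  by (auto simp: lexps_def lookup_add sum.distrib)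

lemma lexps_mono: "S \<subseteq> T \<Longrightarrow> lexps n S \<subseteq> lexps n T"
  by (auto simp: lexps_def)

lemma laur_mono: "S \<subseteq> T \<Longrightarrow> laur n S \<subseteq> laur n T"
  using lexps_mono[of S T n] by (auto simp: laur_def)

lemma subsemiring_laur: "subsemiring (laur n S :: 'k::comm_semiring_1 laurent set)"
  unfolding subsemiring_def
proof (intro conjI ballI)
  fix f g :: "'k laurent" assume fg: "f \<in> laur n S" "g \<in> laur n S"
  then show "f + g \<in> laur n S" using keys_add[of f g] by (auto simp: laur_def)
  show "f * g \<in> laur n S"
    using fg keys_mult[of f g] lexps_add[of _ n S] unfolding laur_def by blast
qed (auto simp: laur_def)

lemmas laur_zero = subsemiringD(1)[OF subsemiring_laur]
lemmas laur_one = subsemiringD(2)[OF subsemiring_laur]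
lemmas laur_add = subsemiringD(3)[OF subsemiring_laur]
lemmas laur_mult = subsemiringD(4)[OF subsemiring_laur]

lemma laur_power: "f \<in> laur n S \<Longrightarrow> f ^ k \<in> laur n S"
  by (induction k) (auto simp: laur_one laur_mult)

lemma const_laur: "const c \<in> laur n S"
  by (auto simp: laur_def const_def)

definition qexp :: "nat \<Rightarrow> nat \<Rightarrow> nat \<Rightarrow>\<^sub>0 int" where
  "qexp j i = Poly_Mapping.single j 1 - Poly_Mapping.single i 1"

lemma lookup_qexp: "Poly_Mapping.lookup (qexp j i) k = (if k = j then 1 else 0) - (if k = i then 1 else 0)"
  by (simp add: qexp_def lookup_minus lookup_single when_def)

lemma xquot_eq: "xquot j i = Poly_Mapping.single (qexp j i) 1"
  by (simp add: xquot_def qexp_def)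

lemma qexp_lexps: "i \<in> S \<Longrightarrow> i \<le> n \<Longrightarrow> j \<le> n \<Longrightarrow> qexp j i \<in> lexps n S"
  by (auto simp: lexps_def lookup_qexp sum_subtractf)

lemma xquot_laur: "i \<in> S \<Longrightarrow> i \<le> n \<Longrightarrow> j \<le> n \<Longrightarrow> xquot j i \<in> laur n S"
  using qexp_lexps[of i S n j] by (auto simp: laur_def xquot_eq)

lemma xquot_mult: "xquot j i * xquot k j = xquot k i"
  by (simp add: xquot_def mult_single)

lemma xquot_self [simp]: "xquot i i = 1"
  by (simp add: xquot_def)

lemma xquot_inverse: "xquot j i ^ N * xquot i j ^ N = 1"
  by (simp add: power_mult_distrib[symmetric] xquot_mult)

text \<open>Induction on the pole order along \<open>x_i\<close>. A negative exponent at
  \<open>i\<close> forces, by degree zero, a positive one at some \<open>j\<close>, and dividing by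
  \<open>x_j/x_i\<close> lowers the pole order. Without a pole all exponents are nonnegative with
  sum zero, so they vanish.\<close>

lemma lexps_singleton_induct [consumes 2, case_names zero step]:
  assumes "e \<in> lexps n {i}" "i \<le> n" "P 0"
    and step: "\<And>e j. e \<in> lexps n {i} \<Longrightarrow> j \<le> n \<Longrightarrow> P e \<Longrightarrow> P (e + qexp j i)"
  shows "P e"
  using assms(1)
proof (induction "nat (- Poly_Mapping.lookup e i)" arbitrary: e)
  case 0
  then have "0 \<le> Poly_Mapping.lookup e k" for k
    by (cases "k = i") (auto simp: lexps_def)
  then have "\<forall>k\<le>n. Poly_Mapping.lookup e k = 0"
    using "0.prems" sum_nonneg_eq_0_iff[of "{..n}" "Poly_Mapping.lookup e"] by (auto simp: lexps_def)
  then have "e = 0" using "0.prems" by (intro poly_mapping_eqI) (metis (mono_tags, lifting) lexps_def lookup_zero mem_Collect_eq not_le)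
  then show ?case using assms(3) by simp
next
  case (Suc m)
  then have neg: "Poly_Mapping.lookup e i < 0" by simp
  have "\<exists>j\<in>{..n} - {i}. 0 < Poly_Mapping.lookup e j"
  proof (rule ccontr)
    assume "\<not> ?thesis"
    then have "(\<Sum>k\<in>{..n}-{i}. Poly_Mapping.lookup e k) \<le> 0"
      by (intro sum_nonpos) (meson not_less)
    moreover have "(\<Sum>k\<le>n. Poly_Mapping.lookup e k) = Poly_Mapping.lookup e i + (\<Sum>k\<in>{..n}-{i}. Poly_Mapping.lookup e k)"
      using assms(2) by (intro sum.remove) auto
    ultimately show False using Suc.prems neg by (auto simp: lexps_def)
  qed
  then obtain j where j: "j \<le> n" "j \<noteq> i" "0 < Poly_Mapping.lookup e j" by auto
  define d where "d = e - qexp j i"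
  have d: "Poly_Mapping.lookup d k = Poly_Mapping.lookup e k - Poly_Mapping.lookup (qexp j i) k" for k
    by (simp add: d_def lookup_minus)
  have "d \<in> lexps n {i}"
    using Suc.prems j assms(2) by (auto simp: lexps_def d lookup_qexp sum_subtractf)
  moreover have "m = nat (- Poly_Mapping.lookup d i)"
    using Suc.hyps(2) j by (simp add: d lookup_qexp)
  ultimately have "P d" using Suc.hyps(1) by blast
  then show ?case using step[of d j] \<open>d \<in> lexps n {i}\<close> j by (simp add: d_def)
qed

lemma generated_sum_single:
  assumes "range const \<subseteq> generated_subsemiring G"
    and "\<And>e. e \<in> Poly_Mapping.keys f \<Longrightarrow> Poly_Mapping.single e 1 \<in> generated_subsemiring G"
  shows "f \<in> generated_subsemiring G"
proof -
  have "Poly_Mapping.single e (Poly_Mapping.lookup f e) \<in> generated_subsemiring G"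
    if "e \<in> Poly_Mapping.keys f" for e
  proof -
    have "const (Poly_Mapping.lookup f e) * Poly_Mapping.single e 1 \<in> generated_subsemiring G"
      using assms that by (intro generated_subsemiring.mult) auto
    then show ?thesis by (simp add: const_def mult_single)
  qed
  note * = this
  have "(\<Sum>e\<in>E. Poly_Mapping.single e (Poly_Mapping.lookup f e)) \<in> generated_subsemiring G"
    if "E \<subseteq> Poly_Mapping.keys f" "finite E" for E
    using that(2,1) by (induction E rule: finite_induct) (auto intro: generated_subsemiring.intros *)
  from this[of "Poly_Mapping.keys f"] show ?thesis by (simp add: poly_mapping_sum_single)
qed

lemma generated_subset_laur:
  assumes "G \<subseteq> laur n S" shows "generated_subsemiring G \<subseteq> laur n S"
proof
  fix x assume "x \<in> generated_subsemiring G"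
  then show "x \<in> laur n S"
    using assms by induction (auto simp: laur_zero laur_one laur_add laur_mult)
qed

lemma proj_chart_eq:
  fixes M :: "'k::comm_semiring_1 itself"
  assumes i: "i \<le> n"
  shows "proj_chart M n i = laur n {i}"
proof
  show "proj_chart M n i \<subseteq> laur n {i}"
    unfolding proj_chart_def using i
    by (intro generated_subset_laur) (auto simp: const_laur xquot_laur)
  show "laur n {i} \<subseteq> proj_chart M n i"
  proof
    fix f :: "'k laurent" assume f: "f \<in> laur n {i}"
    let ?G = "range const \<union> {xquot j i | j. j \<le> n} :: 'k laurent set"
    have "Poly_Mapping.single e 1 \<in> generated_subsemiring ?G" if "e \<in> lexps n {i}" for e
      using that i
    proof (induction rule: lexps_singleton_induct)
      case zero
      show ?case by (simp add: generated_subsemiring.one)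
    next
      case (step e j)
      have "xquot j i \<in> generated_subsemiring ?G"
        using step(2) by (intro generated_subsemiring.gen) blast
      with step(3) have "Poly_Mapping.single e 1 * xquot j i \<in> generated_subsemiring ?G"
        by (rule generated_subsemiring.mult)
      then show ?case by (simp add: xquot_eq mult_single)
    qed
    moreover have "range const \<subseteq> generated_subsemiring ?G"
      using generated_subsemiring.gen[of _ ?G] by blast
    moreover have "Poly_Mapping.keys f \<subseteq> lexps n {i}" using f by (simp add: laur_def)
    ultimately have "f \<in> generated_subsemiring ?G"
      using generated_sum_single[of ?G f] by blast
    then show "f \<in> proj_chart M n i" by (simp add: proj_chart_def)
  qed
qed

lemma xquot_power:
  obtains e where "(xquot j i :: 'k::comm_semiring_1 laurent) ^ N = Poly_Mapping.single e 1"
    "\<And>k. Poly_Mapping.lookup e k = int N * Poly_Mapping.lookup (qexp j i) k"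
proof -
  have "\<exists>e. (xquot j i :: 'k laurent) ^ N = Poly_Mapping.single e 1 \<and>
    (\<forall>k. Poly_Mapping.lookup e k = int N * Poly_Mapping.lookup (qexp j i) k)"
  proof (induction N)
    case 0
    show ?case by (auto intro!: exI[of _ 0])
  next
    case (Suc N)
    then obtain e where "(xquot j i :: 'k laurent) ^ N = Poly_Mapping.single e 1"
      "\<forall>k. Poly_Mapping.lookup e k = int N * Poly_Mapping.lookup (qexp j i) k" by blast
    then show ?case
      by (auto simp: xquot_eq mult_single lookup_add algebra_simps intro!: exI[of _ "qexp j i + e"])
  qed
  then show ?thesis using that by blast
qed

text \<open>A power of \<open>x_j/x_i\<close> trades poles along \<open>x_j\<close> for poles along
  \<open>x_i\<close>, which are permitted because \<open>i\<close> lies in \<open>S\<close>.\<close>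

lemma laur_clear:
  fixes f :: "'k::comm_semiring_1 laurent"
  assumes f: "f \<in> laur n (insert j S)" and i: "i \<in> S" "i \<le> n" and j: "j \<le> n"
  obtains N where "xquot j i ^ N * f \<in> laur n S"
proof (cases "j = i")
  case True
  then have "xquot j i ^ 0 * f \<in> laur n S" using f i by (simp add: insert_absorb)
  then show ?thesis by (rule that)
next
  case False
  \<comment> \<open>The sum of the pole orders of all monomials is a crude common bound for each of
    them.\<close>
  define N where "N = (\<Sum>e\<in>Poly_Mapping.keys f. nat (- Poly_Mapping.lookup e j))"
  have "xquot j i ^ N * f \<in> laur n S"
  proof -
    have "d + e \<in> lexps n S" if "d \<in> Poly_Mapping.keys (xquot j i ^ N :: 'k laurent)" "e \<in> Poly_Mapping.keys f" for d e
    proof -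
      obtain d' where d': "xquot j i ^ N = (Poly_Mapping.single d' 1 :: 'k laurent)"
        "\<And>k. Poly_Mapping.lookup d' k = int N * Poly_Mapping.lookup (qexp j i) k"
        using xquot_power[of j i N] by blast
      then have d: "Poly_Mapping.lookup d k = int N * Poly_Mapping.lookup (qexp j i) k" for k
        using that(1) by simp
      have "nat (- Poly_Mapping.lookup e j) \<le> N"
        unfolding N_def using that(2) by (intro member_le_sum) auto
      moreover have "e \<in> lexps n (insert j S)" using f that(2) by (auto simp: laur_def)
      ultimately show ?thesis
        using i j False by (auto simp: lexps_def lookup_add d lookup_qexp sum.distrib sum_distrib_left[symmetric] sum_subtractf)
    qed
    then show ?thesis using keys_mult[of "xquot j i ^ N" f] unfolding laur_def by blast
  qed
  then show ?thesis by (rule that)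
qed

text \<open>A power of \<open>x_j/x_i\<close> clears an overlap element into the chart; the same
  power of the adjoined generator \<open>x_i/x_j\<close> brings it back.\<close>

lemma proj_overlap_eq:
  fixes M :: "'k::comm_semiring_1 itself"
  assumes i: "i \<le> n" and j: "j \<le> n"
  shows "proj_overlap M n i j = laur n {i, j}"
proof
  show "proj_overlap M n i j \<subseteq> laur n {i, j}"
    unfolding proj_overlap_def using i j
    by (intro generated_subset_laur)
      (use laur_mono[of "{i}" "{i, j}" n] in \<open>auto simp: xquot_laur proj_chart_eq\<close>)
  show "laur n {i, j} \<subseteq> proj_overlap M n i j"
  proof
    fix f :: "'k laurent" assume "f \<in> laur n {i, j}"
    then have "f \<in> laur n (insert j {i})" by (simp add: insert_commute)
    then obtain N where N: "xquot j i ^ N * f \<in> laur n {i}"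
      using laur_clear[of f n j "{i}" i] i j by blast
    let ?G = "proj_chart M n i \<union> {xquot i j}"
    have "xquot i j ^ N \<in> generated_subsemiring ?G"
      by (induction N) (auto intro: generated_subsemiring.intros)
    moreover have "xquot j i ^ N * f \<in> generated_subsemiring ?G"
      using N i by (auto simp: proj_chart_eq intro: generated_subsemiring.gen)
    ultimately have "xquot i j ^ N * (xquot j i ^ N * f) \<in> generated_subsemiring ?G"
      by (rule generated_subsemiring.mult)
    then show "f \<in> proj_overlap M n i j"
      unfolding proj_overlap_def by (simp add: mult.assoc[symmetric] xquot_inverse)
  qed
qed

text \<open>The denominator is a product of powers of the \<open>x_j/x_i\<close> with
  \<open>j\<close> in \<open>S\<close>, collected by clearing one variable at a time. Hence a single
  \<open>t\<close> avoids all primes that avoid these quotients, and this uniformity is what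
  \<open>regular_on\<close> asks for. The index \<open>i\<close> may lie outside
  \<open>S\<close>.\<close>

lemma laur_Spec_denominator:
  fixes f :: "'k::comm_semiring_1 laurent"
  assumes i: "i \<le> n" and S: "S \<subseteq> {..n}" and f: "f \<in> laur n (insert i S)"
  obtains t where "t \<in> laur n {i}" "t * f \<in> laur n {i}"
    "\<And>p. p \<in> Spec (laur n {i}) \<Longrightarrow> (\<And>j. j \<in> S \<Longrightarrow> xquot j i \<notin> p) \<Longrightarrow> t \<notin> p"
proof -
  have "finite S" using finite_subset[OF S] by simp
  then have "\<exists>t. t \<in> laur n {i} \<and> t * f \<in> laur n {i} \<and>
    (\<forall>p. p \<in> Spec (laur n {i}) \<longrightarrow> (\<forall>j\<in>S. xquot j i \<notin> p) \<longrightarrow> t \<notin> p)"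
    using S f
  proof (induction S arbitrary: f)
    case empty
    then show ?case
      using Spec_one[OF subsemiring_laur, of _ n "{i}"] by (auto intro!: exI[of _ 1] simp: laur_one)
  next
    case (insert j S)
    have "f \<in> laur n (insert j (insert i S))" using insert.prems by (simp add: insert_commute)
    then obtain N where N: "xquot j i ^ N * f \<in> laur n (insert i S)"
      using laur_clear[of f n j "insert i S" i] insert.prems(1) i by blast
    then obtain t where t: "t \<in> laur n {i}" "t * (xquot j i ^ N * f) \<in> laur n {i}"
      "\<forall>p. p \<in> Spec (laur n {i}) \<longrightarrow> (\<forall>j\<in>S. xquot j i \<notin> p) \<longrightarrow> t \<notin> p"
      using insert.IH[OF _ N] insert.prems(1) by blast
    have x: "xquot j i \<in> laur n {i}" using insert.prems i by (auto intro: xquot_laur)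
    have "t * xquot j i ^ N \<notin> p"
      if p: "p \<in> Spec (laur n {i})" and np: "\<forall>j\<in>insert j S. xquot j i \<notin> p" for p
    proof -
      have pow: "xquot j i ^ N \<in> laur n {i} - p"
      proof (induction N)
        case 0
        show ?case using Spec_one[OF subsemiring_laur p] by (simp add: laur_one)
      next
        case (Suc N)
        show ?case
          unfolding power_Suc using Spec_mult_notin[OF p subsemiring_laur _ Suc.IH] x np by blast
      qed
      show ?thesis using Spec_mult_notin[OF p subsemiring_laur _ pow, of t] t p np by blast
    qed
    then show ?case
      using t x by (intro exI[of _ "t * xquot j i ^ N"]) (auto intro!: laur_mult laur_power simp: mult.assoc)
  qed
  then show ?thesis using that by blast
qed

text \<open>Over an idempotent semifield these are all the units of \<open>laur n S\<close>, because a product contains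
  the sum of any two exponents of its factors with nonzero coefficient.\<close>

definition laur_units :: "nat \<Rightarrow> nat set \<Rightarrow> 'k::comm_semiring_1 laurent set" where
  "laur_units n S = {Poly_Mapping.single e c | e c.
     e \<in> lexps n S \<and> (\<forall>k. k \<notin> S \<longrightarrow> Poly_Mapping.lookup e k = 0) \<and> c \<noteq> 0}"

lemma laur_units_subset: "laur_units n S \<subseteq> laur n S"
  by (auto simp: laur_units_def laur_def)

lemma laur_unitsE:
  fixes f :: "'k::idempotent_semifield laurent"
  assumes "f \<in> laur_units n S"
  obtains g where "g \<in> laur_units n S" "f * g = 1"
proof -
  obtain e c where ec: "e \<in> lexps n S" "\<forall>k. k \<notin> S \<longrightarrow> Poly_Mapping.lookup e k = 0" "c \<noteq> 0"
    "f = Poly_Mapping.single e c" using assms by (auto simp: laur_units_def)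
  obtain d where d: "c * d = 1" using ec(3) ex_inverse by blast
  then have "d \<noteq> 0" by auto
  moreover have "- e \<in> lexps n S" using ec by (auto simp: lexps_def sum_negf)
  ultimately have "Poly_Mapping.single (- e) d \<in> laur_units n S"
    using ec unfolding laur_units_def by (intro CollectI exI[of _ "- e"] exI[of _ d]) auto
  moreover have "f * Poly_Mapping.single (- e) d = 1" by (simp add: ec mult_single d)
  ultimately show ?thesis by (rule that)
qed

text \<open>The keys of a sum are the union of the keys, so if the sum is a monomial, a nonzero
  summand is a multiple of the same monomial. Contrapositively, non-units are closed under
  addition.\<close>

lemma laur_units_add:
  fixes f g :: "'k::idempotent_semifield laurent"
  assumes "f + g \<in> laur_units n S"
  shows "f \<in> laur_units n S \<or> g \<in> laur_units n S"
proof -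
  obtain e c where ec: "e \<in> lexps n S" "\<forall>k. k \<notin> S \<longrightarrow> Poly_Mapping.lookup e k = 0" "c \<noteq> 0"
    "f + g = Poly_Mapping.single e c" using assms by (auto simp: laur_units_def)
  have keys: "Poly_Mapping.keys f \<union> Poly_Mapping.keys g = {e}"
    using ec keys_add_idem[of f g] by simp
  have *: "h \<in> laur_units n S" if "Poly_Mapping.keys h = {e}" for h :: "'k laurent"
    using poly_mapping_sum_single[of h] that ec(1,2) unfolding laur_units_def
    by (auto intro!: exI[of _ e] exI[of _ "Poly_Mapping.lookup h e"])
  have "Poly_Mapping.keys f = {e} \<or> Poly_Mapping.keys g = {e}" using keys by blast
  then show ?thesis using * by blast
qed

text \<open>With one key \<open>a\<close> of \<open>f\<close> fixed, every key \<open>b\<close> of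
  \<open>g\<close> satisfies \<open>a + b = e\<close>, so \<open>g\<close> is a monomial. Outside
  \<open>S\<close> the exponents of \<open>a\<close> and \<open>b\<close> are nonnegative with sum
  zero, hence both vanish.\<close>

lemma laur_units_multD:
  fixes f g :: "'k::idempotent_semifield laurent"
  assumes f: "f \<in> laur n S" and g: "g \<in> laur n S" and fg: "f * g \<in> laur_units n S"
  shows "g \<in> laur_units n S"
proof -
  obtain e c where ec: "e \<in> lexps n S" "\<forall>k. k \<notin> S \<longrightarrow> Poly_Mapping.lookup e k = 0" "c \<noteq> 0"
    "f * g = Poly_Mapping.single e c" using fg by (auto simp: laur_units_def)
  have nz: "f \<noteq> 0" "g \<noteq> 0" using ec by auto
  obtain a where a: "a \<in> Poly_Mapping.keys f" using nz by (metis keys_eq_empty ex_in_conv)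
  obtain b where b: "b \<in> Poly_Mapping.keys g" using nz by (metis keys_eq_empty ex_in_conv)
  have sum: "a + b' = e" if "b' \<in> Poly_Mapping.keys g" for b'
    using keys_mult_idem[OF a that] ec by auto
  then have "b' = b" if "b' \<in> Poly_Mapping.keys g" for b'
    using b that by (metis add_left_cancel)
  then have "Poly_Mapping.keys g = {b}" using b by blast
  then have g_eq: "g = Poly_Mapping.single b (Poly_Mapping.lookup g b)"
    using poly_mapping_sum_single[of g] by simp
  have ab: "a \<in> lexps n S" "b \<in> lexps n S" using a b f g by (auto simp: laur_def)
  have "Poly_Mapping.lookup b k = 0" if "k \<notin> S" for k
  proof -
    have "Poly_Mapping.lookup a k + Poly_Mapping.lookup b k = 0"
      using sum[OF b] ec(2) that by (metis lookup_add)
    moreover have "0 \<le> Poly_Mapping.lookup a k" "0 \<le> Poly_Mapping.lookup b k"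
      using ab that by (auto simp: lexps_def)
    ultimately show ?thesis by linarith
  qed
  then show ?thesis
    using ab b unfolding laur_units_def
    by (intro CollectI exI[of _ b] exI[of _ "Poly_Mapping.lookup g b"]) (auto simp: g_eq[symmetric] in_keys_iff)
qed

lemma laur_units_mult:
  fixes f g :: "'k::idempotent_semifield laurent"
  assumes "f \<in> laur_units n S" "g \<in> laur_units n S"
  shows "f * g \<in> laur_units n S"
  using assms by (fastforce simp: laur_units_def mult_single lookup_add mult_eq_0_semifield intro: lexps_add)

lemma laur_units_one: "(1 :: 'k::comm_semiring_1 laurent) \<in> laur_units n S"
  by (auto simp: laur_units_def intro!: exI[of _ "0 :: nat \<Rightarrow>\<^sub>0 int"] exI[of _ "1 :: 'k"])

lemma xquot_laur_units:
  assumes "i \<in> S" "i \<le> n" "j \<in> S" "j \<le> n"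
  shows "(xquot j i :: 'k::comm_semiring_1 laurent) \<in> laur_units n S"
  unfolding laur_units_def xquot_eq
  by (intro CollectI exI[of _ "qexp j i"] exI[of _ "1 :: 'k"])
    (use assms in \<open>auto simp: lookup_qexp qexp_lexps\<close>)

text \<open>Non-units of \<open>laur n S\<close> are closed under addition, as sums do not cancel. Their trace on the chart
  \<open>i \<in> S\<close> is therefore the unique closed point of \<open>D(\<Prod>\<^sub>j\<^sub>\<in>\<^sub>S x\<^sub>j)\<close>, and every open set that contains this
  point contains all of \<open>D(\<Prod>\<^sub>j\<^sub>\<in>\<^sub>S x\<^sub>j)\<close>.\<close>

definition closed_pt :: "nat \<Rightarrow> nat set \<Rightarrow> nat \<Rightarrow> 'k::comm_semiring_1 laurent set" where
  "closed_pt n S i = laur n {i} - laur_units n S"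

text \<open>Sums rest on \<open>laur_units_add\<close>, multiples on
  \<open>laur_units_multD\<close>, which applies because \<open>i\<close> in \<open>S\<close> puts
  the chart inside \<open>laur n S\<close>, and primality on the closure of units under
  products.\<close>

lemma closed_pt_Spec:
  fixes i n :: nat
  assumes i: "i \<in> S"
  shows "closed_pt n S i \<in> Spec (laur n {i} :: 'k::idempotent_semifield laurent set)"
proof -
  have sub: "laur n {i} \<subseteq> (laur n S :: 'k laurent set)" using laur_mono[of "{i}" S n] i by simp
  have "0 \<notin> (laur_units n S :: 'k laurent set)"
    by (auto simp: laur_units_def)
  have "sr_ideal (laur n {i}) (closed_pt n S i :: 'k laurent set)"
    unfolding sr_ideal_def
  proof (intro conjI ballI)
    show "closed_pt n S i \<subseteq> (laur n {i} :: 'k laurent set)" by (auto simp: closed_pt_def)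
    show "(0 :: 'k laurent) \<in> closed_pt n S i"
      using \<open>0 \<notin> laur_units n S\<close> laur_zero by (simp add: closed_pt_def)
    show "x + y \<in> closed_pt n S i" if "x \<in> closed_pt n S i" "y \<in> closed_pt n S i" for x y :: "'k laurent"
      using that laur_units_add[of x y n S] by (auto simp: closed_pt_def laur_add)
    show "a * x \<in> closed_pt n S i" if "a \<in> laur n {i}" "x \<in> closed_pt n S i" for a x :: "'k laurent"
      using that laur_units_multD[of a n S x] sub by (auto simp: closed_pt_def laur_mult)
  qed
  moreover have "1 \<notin> (closed_pt n S i :: 'k laurent set)"
    by (simp add: closed_pt_def laur_units_one)
  then have "closed_pt n S i \<noteq> (laur n {i} :: 'k laurent set)"
    using laur_one by metis
  moreover have "x \<in> closed_pt n S i \<or> y \<in> closed_pt n S i"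
    if "x \<in> laur n {i}" "y \<in> laur n {i}" "x * y \<in> closed_pt n S i" for x y :: "'k laurent"
    using that laur_units_mult[of x n S y] by (auto simp: closed_pt_def)
  ultimately show ?thesis by (simp add: Spec_def)
qed

lemma closed_pt_open:
  fixes V :: "'k::idempotent_semifield laurent set set"
  assumes S: "S \<subseteq> {..n}" and i: "i \<in> S"
    and V: "openin (zariski (laur n {i})) V" and m: "closed_pt n S i \<in> V"
    and p: "p \<in> Spec (laur n {i})" and np: "\<And>j. j \<in> S \<Longrightarrow> xquot j i \<notin> p"
  shows "p \<in> V"
proof -
  obtain E where E: "E \<subseteq> laur n {i}" "V = {p \<in> Spec (laur n {i}). \<not> E \<subseteq> p}"
    using V[unfolded openin_zariski[OF subsemiring_laur]] by auto
  then obtain f where f: "f \<in> E" "f \<in> laur_units n S" using m by (auto simp: closed_pt_def)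
  obtain g where g: "g \<in> laur_units n S" "f * g = 1" using laur_unitsE[OF f(2)] .
  have "g \<in> laur n (insert i S)" using g(1) laur_units_subset[of n S] i by (auto simp: insert_absorb)
  moreover have "i \<le> n" using S i by auto
  ultimately obtain t where t: "t \<in> laur n {i}" "t * g \<in> laur n {i}"
    and t': "\<And>p. p \<in> Spec (laur n {i}) \<Longrightarrow> (\<And>j. j \<in> S \<Longrightarrow> xquot j i \<notin> p) \<Longrightarrow> t \<notin> p"
    using laur_Spec_denominator[OF _ S] by blast
  have "t \<notin> p" using t'[OF p np] by blast
  \<comment> \<open>The inverse \<open>g\<close> of \<open>f\<close> need not lie in the chart, but
    \<open>t * g\<close> does, and \<open>(t * g) * f = t\<close> would put \<open>t\<close> into
    \<open>p\<close>.\<close>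
  have "f \<notin> p"
  proof
    assume "f \<in> p"
    then have "(t * g) * f \<in> p" using SpecD(4)[OF p t(2)] by blast
    moreover have "(t * g) * f = t" using g(2) by (simp add: mult.assoc mult.commute[of g])
    ultimately show False using \<open>t \<notin> p\<close> by simp
  qed
  then show ?thesis using E f p by blast
qed

lemma closed_pt_xquot:
  assumes "i \<in> S" "j \<in> S" "S \<subseteq> {..n}"
  shows "xquot j i \<notin> closed_pt n S i"
  using assms xquot_laur_units[of i S n j] by (auto simp: closed_pt_def)

lemma germ_closed_pt_nonempty:
  fixes g :: "'k::idempotent_semifield laurent"
  assumes "i \<in> S" "S \<subseteq> {..n}" "g \<in> laur n S"
  shows "germ (laur n {i}) (closed_pt n S i) g \<noteq> {}"
proof -
  have "i \<le> n" "g \<in> laur n (insert i S)" using assms by (auto simp: insert_absorb)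
  then obtain t where t: "t \<in> laur n {i}" "t * g \<in> laur n {i}"
    and t': "\<And>p. p \<in> Spec (laur n {i}) \<Longrightarrow> (\<And>j. j \<in> S \<Longrightarrow> xquot j i \<notin> p) \<Longrightarrow> t \<notin> p"
    using laur_Spec_denominator[OF _ assms(2)] by blast
  moreover have "t \<notin> closed_pt n S i"
    using t'[OF closed_pt_Spec[OF assms(1)]] closed_pt_xquot[OF assms(1)] assms(2) by blast
  ultimately show ?thesis
    using germ_memI[OF subsemiring_laur closed_pt_Spec[OF assms(1)], of t n g] by blast
qed

lemma laur_units_cancel:
  fixes u :: "'k::idempotent_semifield laurent"
  assumes "u \<in> laur_units n S" "u * x = u * y"
  shows "x = y"
proof -
  obtain v where "u * v = 1" using laur_unitsE[OF assms(1)] .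
  then have "v * (u * z) = z" for z by (metis mult.assoc mult.commute mult_1)
  then show ?thesis using assms(2) by metis
qed

text \<open>Chart elements outside the closed point are units of \<open>laur n S\<close>, so the
  multipliers of both germs and their common denominator \<open>t\<close> cancel.\<close>

lemma germ_closed_pt_inj:
  fixes f g :: "'k::idempotent_semifield laurent"
  assumes S: "i \<in> S" "S \<subseteq> {..n}" and f: "f \<in> laur n S"
    and eq: "germ (laur n {i}) (closed_pt n S i) f = germ (laur n {i}) (closed_pt n S i) g"
  shows "f = g"
proof -
  obtain b t where bt: "(b, t) \<in> germ (laur n {i}) (closed_pt n S i) f"
    using germ_closed_pt_nonempty[OF S f] by auto
  then have "(b, t) \<in> germ (laur n {i}) (closed_pt n S i) g" using eq by simp
  then obtain h where h: "h \<in> laur_units n S" "t \<in> laur_units n S" "h * b = h * (t * g)"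
    by (auto simp: germ_def closed_pt_def)
  obtain k where k: "k \<in> laur_units n S" "k * b = k * (t * f)"
    using bt by (auto simp: germ_def closed_pt_def)
  have "t * f = t * g"
    using laur_units_cancel[OF h(1,3)] laur_units_cancel[OF k] by simp
  then show ?thesis by (rule laur_units_cancel[OF h(2)])
qed

section \<open>Points and sections of projective space\<close>

lemma laur_denominator:
  fixes b :: "'k::comm_semiring_1 laurent"
  assumes T: "T \<subseteq> {..n}" and i: "i \<in> T" and p: "p \<in> Spec (laur n {i})"
    and np: "\<And>j. j \<in> T \<Longrightarrow> xquot j i \<notin> p" and b: "b \<in> laur n T"
  shows "\<exists>t\<in>laur n {i} - p. t * b \<in> laur n {i}"
proof -
  have "i \<le> n" "b \<in> laur n (insert i T)" using T i b by (auto simp: insert_absorb)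
  then obtain t where t: "t \<in> laur n {i}" "t * b \<in> laur n {i}"
    and t': "\<And>p. p \<in> Spec (laur n {i}) \<Longrightarrow> (\<And>j. j \<in> T \<Longrightarrow> xquot j i \<notin> p) \<Longrightarrow> t \<notin> p"
    using laur_Spec_denominator[OF _ T] by blast
  have "t \<notin> p" using t'[OF p np] by blast
  with t show ?thesis by blast
qed

lemma xquot_notin_Spec:
  fixes P :: "'k::comm_semiring_1 laurent set"
  assumes T: "T \<subseteq> {..n}" and i: "i \<in> T" and P: "P \<in> Spec (laur n T)" and j: "j \<in> T"
  shows "xquot j i \<notin> P"
proof
  assume "xquot j i \<in> P"
  moreover have "xquot i j \<in> (laur n T :: 'k laurent set)" using T i j by (auto intro: xquot_laur)
  ultimately have "xquot i j * xquot j i \<in> P" using SpecD(4)[OF P] by blast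
  then show False using Spec_one[OF subsemiring_laur P] by (simp add: xquot_mult)
qed

lemma laur_denominator_contract:
  fixes b :: "'k::comm_semiring_1 laurent"
  assumes T: "T \<subseteq> {..n}" and i: "i \<in> T" and P: "P \<in> Spec (laur n T)" and b: "b \<in> laur n T"
  shows "\<exists>t\<in>laur n {i} - P. t * b \<in> laur n {i}"
proof -
  have "laur n {i} \<subseteq> (laur n T :: 'k laurent set)" using i by (intro laur_mono) auto
  then have "P \<inter> laur n {i} \<in> Spec (laur n {i})"
    using Spec_contract[OF subsemiring_laur subsemiring_laur _ P] by blast
  from laur_denominator[OF T i this _ b] xquot_notin_Spec[OF T i P] show ?thesis by blast
qed

lemma laur_Spec_contract:
  "P \<in> Spec (laur n T) \<Longrightarrow> S \<subseteq> T \<Longrightarrow> P \<inter> laur n S \<in> Spec (laur n S)"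
  using Spec_contract[OF subsemiring_laur subsemiring_laur laur_mono] by blast

lemma laur_Spec_extend:
  fixes p :: "'k::comm_semiring_1 laurent set"
  assumes T: "T \<subseteq> {..n}" and i: "i \<in> T" and p: "p \<in> Spec (laur n {i})"
    and np: "\<And>j. j \<in> T \<Longrightarrow> xquot j i \<notin> p"
  obtains P where "P \<in> Spec (laur n T)" "P \<inter> laur n {i} = p"
proof (rule Spec_extend[OF subsemiring_laur subsemiring_laur _ p])
  show "laur n {i} \<subseteq> (laur n T :: 'k laurent set)" using i by (intro laur_mono) auto
  show "\<exists>t\<in>laur n {i} - p. t * b \<in> laur n {i}" if "b \<in> laur n T" for b
    using laur_denominator[OF T i p np that] .
qed

lemma laur_Spec_eqI:
  fixes P :: "'k::comm_semiring_1 laurent set"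
  assumes T: "T \<subseteq> {..n}" and i: "i \<in> T" and P: "P \<in> Spec (laur n T)" and Q: "Q \<in> Spec (laur n T)"
    and eq: "P \<inter> laur n {i} = Q \<inter> laur n {i}"
  shows "P = Q"
proof (rule Spec_extend_unique[OF subsemiring_laur subsemiring_laur _ P Q eq])
  show "laur n {i} \<subseteq> (laur n T :: 'k laurent set)" using i by (intro laur_mono) auto
qed (rule laur_denominator_contract[OF T i P])

section \<open>Points and open sets of the glued space\<close>

abbreviation "proj_rel M n \<equiv> glue_rel {..n} (proj_chart M n) (proj_overlap M n)"
abbreviation "proj_point M n \<equiv> glue_point {..n} (proj_chart M n) (proj_overlap M n)"
abbreviation "proj_points M n \<equiv> glue_points {..n} (proj_chart M n) (proj_overlap M n)"
abbreviation "proj_part M n \<equiv> chart_part {..n} (proj_chart M n) (proj_overlap M n)"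
abbreviation "proj_dom M n \<equiv> glue_dom {..n} (proj_chart M n) (proj_overlap M n)"
abbreviation "proj_sections M n \<equiv> glue_sections {..n} (proj_chart M n) (proj_overlap M n)"

lemma proj_rel_iff:
  "((i, p), (j, q)) \<in> proj_rel M n \<longleftrightarrow> i \<le> n \<and> j \<le> n \<and>
     (\<exists>P\<in>Spec (laur n {i, j}). p = P \<inter> laur n {i} \<and> q = P \<inter> laur n {j})"
  by (auto simp: glue_rel_def proj_chart_eq proj_overlap_eq)

text \<open>The cocycle condition for gluing: the middle point \<open>q\<close> extends to a prime
  \<open>R\<close> of the triple overlap. The traces of \<open>R\<close> on the two double overlaps
  lie over \<open>q\<close>, so by uniqueness they are \<open>P\<close> and \<open>Q\<close>, and
  the trace on \<open>{i, k}\<close> relates the outer points.\<close>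

lemma proj_rel_trans:
  assumes ij: "((i, p), (j, q)) \<in> proj_rel M n" and jk: "((j, q), (k, r)) \<in> proj_rel M n"
  shows "((i, p), (k, r)) \<in> proj_rel M n"
proof -
  obtain P where P: "P \<in> Spec (laur n {i, j})" "p = P \<inter> laur n {i}" "q = P \<inter> laur n {j}"
    and n: "i \<le> n" "j \<le> n" using ij unfolding proj_rel_iff by blast
  obtain Q where Q: "Q \<in> Spec (laur n {j, k})" "q = Q \<inter> laur n {j}" "r = Q \<inter> laur n {k}"
    and n': "k \<le> n" using jk unfolding proj_rel_iff by blast
  have q: "q \<in> Spec (laur n {j})" unfolding P(3) by (rule laur_Spec_contract[OF P(1)]) auto
  have "xquot l j \<notin> q" if "l \<in> {i, j, k}" for l
    using that xquot_notin_Spec[OF _ _ P(1), of j l] xquot_notin_Spec[OF _ _ Q(1), of j l] P(3) Q(2) n n'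
    by auto
  then obtain R where R: "R \<in> Spec (laur n {i, j, k})" "R \<inter> laur n {j} = q"
    using laur_Spec_extend[OF _ _ q, of "{i, j, k}"] n n' by auto
  have m: "laur n {l} \<subseteq> (laur n {l, l'} :: 'a laurent set)" "laur n {l} \<subseteq> (laur n {l', l} :: 'a laurent set)" for l l'
    by (auto intro!: laur_mono)
  have c: "R \<inter> laur n {l, l'} \<inter> laur n {l} = R \<inter> laur n {l}" "R \<inter> laur n {l', l} \<inter> laur n {l} = R \<inter> laur n {l}" for l l'
    using m by blast+
  have "R \<inter> laur n {i, j} = P"
    by (rule laur_Spec_eqI[where i = j, OF _ _ laur_Spec_contract[OF R(1)] P(1)])
      (use n R(2) P(3) c in auto)
  then have p: "p = R \<inter> laur n {i}" unfolding P(2) using c by metis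
  have "R \<inter> laur n {j, k} = Q"
    by (rule laur_Spec_eqI[where i = j, OF _ _ laur_Spec_contract[OF R(1)] Q(1)])
      (use n n' R(2) Q(2) c in auto)
  then have r: "r = R \<inter> laur n {k}" unfolding Q(3) using c by metis
  have "R \<inter> laur n {i, k} \<in> Spec (laur n {i, k})" by (rule laur_Spec_contract[OF R(1)]) auto
  then show ?thesis unfolding proj_rel_iff using n n' p r c by metis
qed

lemma proj_rel_equiv: "equiv (SIGMA i:{..n}. Spec (proj_chart M n i)) (proj_rel M n)"
proof (rule equivI)
  show "proj_rel M n \<subseteq> (SIGMA i:{..n}. Spec (proj_chart M n i)) \<times> (SIGMA i:{..n}. Spec (proj_chart M n i))"
  proof (intro subrelI)
    fix x y assume "(x, y) \<in> proj_rel M n"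
    moreover obtain i p j q where "x = (i, p)" "y = (j, q)" by (metis surj_pair)
    ultimately show "(x, y) \<in> (SIGMA i:{..n}. Spec (proj_chart M n i)) \<times> (SIGMA i:{..n}. Spec (proj_chart M n i))"
      using laur_Spec_contract[of _ n "{i, j}" "{i}"] laur_Spec_contract[of _ n "{i, j}" "{j}"]
      by (auto simp: proj_rel_iff proj_chart_eq)
  qed
  show "refl_on (SIGMA i:{..n}. Spec (proj_chart M n i)) (proj_rel M n)"
    by (rule refl_onI) (use SpecD(1) in \<open>fastforce simp: proj_rel_iff proj_chart_eq intro!: bexI\<close>)
  show "sym (proj_rel M n)"
    by (rule symI) (auto simp: proj_rel_iff insert_commute)
  show "trans (proj_rel M n)"
  proof (rule transI)
    fix x y z assume "(x, y) \<in> proj_rel M n" "(y, z) \<in> proj_rel M n"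
    then show "(x, z) \<in> proj_rel M n" by (cases x; cases y; cases z) (auto intro: proj_rel_trans)
  qed
qed

lemma proj_point_eq_iff:
  assumes "i \<le> n" "p \<in> Spec (laur n {i})" "j \<le> n" "q \<in> Spec (laur n {j})"
  shows "proj_point M n i p = proj_point M n j q \<longleftrightarrow> ((i, p), (j, q)) \<in> proj_rel M n"
  unfolding glue_point_def using assms
  by (intro eq_equiv_class_iff[OF proj_rel_equiv]) (auto simp: proj_chart_eq)

lemma proj_point_contract_eq:
  assumes "i \<le> n" "j \<le> n" "P \<in> Spec (laur n {i, j})"
  shows "proj_point M n i (P \<inter> laur n {i}) = proj_point M n j (P \<inter> laur n {j})"
  using assms laur_Spec_contract[OF assms(3)] by (subst proj_point_eq_iff) (auto simp: proj_rel_iff)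

lemma proj_part_eq: "i \<le> n \<Longrightarrow> proj_part M n U i = {p \<in> Spec (laur n {i}). proj_point M n i p \<in> U}"
  by (simp add: chart_part_def proj_chart_eq)

text \<open>The quotient \<open>x_j/x_i\<close> is a unit of the overlap, so no prime coming from
  there contains it; conversely, avoiding it is exactly what extending \<open>p\<close> to the
  overlap requires.\<close>

lemma proj_point_in_D_iff:
  assumes i: "i \<le> n" and j: "j \<le> n" and p: "p \<in> Spec (laur n {i})"
  shows "proj_point M n i p \<in> proj_D M n j \<longleftrightarrow> xquot j i \<notin> p"
proof
  assume "proj_point M n i p \<in> proj_D M n j"
  then obtain q where "q \<in> Spec (laur n {j})" "proj_point M n i p = proj_point M n j q"
    using j by (auto simp: proj_D_def proj_chart_eq)
  then obtain P where P: "P \<in> Spec (laur n {i, j})" "p = P \<inter> laur n {i}"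
    using i j p by (auto simp: proj_point_eq_iff proj_rel_iff)
  then show "xquot j i \<notin> p" using xquot_notin_Spec[OF _ _ P(1), of i j] i j by auto
next
  assume "xquot j i \<notin> p"
  moreover have "xquot i i \<notin> p" using Spec_one[OF subsemiring_laur p] by simp
  ultimately have np: "xquot l i \<notin> p" if "l \<in> {i, j}" for l using that by blast
  obtain P where P: "P \<in> Spec (laur n {i, j})" "P \<inter> laur n {i} = p"
    using laur_Spec_extend[where T = "{i, j}", OF _ _ p np] i j by auto
  then have "proj_point M n i p = proj_point M n j (P \<inter> laur n {j})"
    using proj_point_contract_eq[OF i j P(1)] by simp
  then show "proj_point M n i p \<in> proj_D M n j"
    using laur_Spec_contract[OF P(1), of "{j}"] j by (auto simp: proj_D_def proj_chart_eq)
qed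

text \<open>For \<open>S = {}\<close> this is the whole type of points rather than projective space,
  so openness is claimed only for nonempty \<open>S\<close>.\<close>

definition proj_DS :: "'k::comm_semiring_1 itself \<Rightarrow> nat \<Rightarrow> nat set \<Rightarrow> 'k proj_point set" where
  "proj_DS M n S = (\<Inter>j\<in>S. proj_D M n j)"

lemma proj_part_DS:
  assumes "i \<le> n" "S \<subseteq> {..n}"
  shows "proj_part M n (proj_DS M n S) i = {p \<in> Spec (laur n {i}). \<forall>j\<in>S. xquot j i \<notin> p}"
  using assms proj_point_in_D_iff[of i n _ _ M] by (auto simp: proj_part_eq proj_DS_def)

lemma openin_proj:
  "openin (proj_space M n) U \<longleftrightarrow> U \<subseteq> proj_points M n \<and>
     (\<forall>i\<le>n. openin (zariski (laur n {i})) (proj_part M n U i))"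
  unfolding proj_space_def glue_top_def
  by (subst topology_inverse'[OF istopology_glue]) (auto simp: proj_chart_eq)

lemma proj_points_cases:
  assumes "x \<in> proj_points M n"
  obtains i p where "i \<le> n" "p \<in> Spec (laur n {i})" "x = proj_point M n i p"
  using assms by (auto simp: glue_points_def quotient_def glue_point_def proj_chart_eq)

lemma proj_point_mem: "i \<le> n \<Longrightarrow> p \<in> Spec (laur n {i}) \<Longrightarrow> proj_point M n i p \<in> proj_points M n"
  by (auto simp: glue_points_def quotient_def glue_point_def proj_chart_eq)

lemma topspace_proj: "topspace (proj_space M n) = proj_points M n"
proof -
  have "proj_part M n (proj_points M n) i = Spec (laur n {i})" if "i \<le> n" for i
    using that proj_point_mem[of i n] by (auto simp: proj_part_eq)
  then have "openin (proj_space M n) (proj_points M n)"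
    by (simp add: openin_proj openin_zariski_Spec subsemiring_laur)
  then show ?thesis
    by (metis openin_proj openin_subset openin_topspace subset_antisym)
qed

lemma openin_proj_DS:
  assumes S: "S \<subseteq> {..n}" "S \<noteq> {}"
  shows "openin (proj_space M n) (proj_DS M n S)"
proof -
  have "proj_D M n j \<subseteq> proj_points M n" if "j \<le> n" for j
    using that proj_point_mem[of j n] by (auto simp: proj_D_def proj_chart_eq)
  moreover have "openin (zariski (laur n {i})) (proj_part M n (proj_DS M n {j}) i)"
    if ij: "j \<le> n" "i \<le> n" for i j
    using ij openin_zariski_basic[OF subsemiring_laur, of "xquot j i" n "{i}"]
    by (subst proj_part_DS) (auto simp: xquot_laur)
  ultimately have "openin (proj_space M n) (proj_DS M n {j})" if "j \<le> n" for j
    using that by (auto simp: openin_proj proj_DS_def)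
  then have "openin (proj_space M n) (\<Inter>j\<in>S. proj_DS M n {j})"
    using S finite_subset[OF S(1)] by (intro openin_INT2) auto
  then show ?thesis by (simp add: proj_DS_def)
qed

text \<open>For \<open>S = {i}\<close> the only quotient to avoid is \<open>xquot i i = 1\<close>,
  which lies in no prime, so \<open>closed_pt_open\<close> reaches every point of the chart.\<close>

lemma proj_D_subset_open:
  fixes M :: "'k::idempotent_semifield itself"
  assumes i: "i \<le> n" and U: "openin (proj_space M n) U"
    and m: "proj_point M n i (closed_pt n {i} i) \<in> U"
  shows "proj_D M n i \<subseteq> U"
proof
  fix x assume "x \<in> proj_D M n i"
  then obtain p where p: "p \<in> Spec (laur n {i})" "x = proj_point M n i p"
    using i by (auto simp: proj_D_def proj_chart_eq)
  have "p \<in> proj_part M n U i"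
  proof (rule closed_pt_open[of "{i}" n i])
    show "openin (zariski (laur n {i})) (proj_part M n U i)" using U i by (simp add: openin_proj)
    show "closed_pt n {i} i \<in> proj_part M n U i"
      using m i closed_pt_Spec[of i "{i}" n] by (simp add: proj_part_eq)
    show "xquot j i \<notin> p" if "j \<in> {i}" for j
      using that Spec_one[OF subsemiring_laur p(1)] by simp
  qed (use i p in auto)
  then show "x \<in> U" using p i by (simp add: proj_part_eq)
qed

section \<open>Sections given by a single Laurent polynomial\<close>

definition germ_section ::
  "'k::comm_semiring_1 itself \<Rightarrow> nat \<Rightarrow> 'k proj_point set \<Rightarrow> 'k laurent \<Rightarrow> 'k proj_section" where
  "germ_section M n U g = (\<lambda>(i, p)\<in>proj_dom M n U. germ (proj_chart M n i) p g)"

text \<open>It asks for one denominator per chart, valid on the whole chart part, instead of one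
  near each point. Constants on any set and \<open>laur n S\<close> on \<open>proj_DS M n S\<close>
  have this form, sums preserve it, and the chart part itself serves as the neighbourhood required
  of a section.\<close>

definition regular_on ::
  "'k::comm_semiring_1 itself \<Rightarrow> nat \<Rightarrow> 'k proj_point set \<Rightarrow> 'k laurent \<Rightarrow> bool" where
  "regular_on M n U g \<longleftrightarrow> (\<forall>i\<le>n. \<exists>t\<in>laur n {i}. t * g \<in> laur n {i} \<and> (\<forall>p\<in>proj_part M n U i. t \<notin> p))"

lemma proj_dom_iff: "(i, p) \<in> proj_dom M n U \<longleftrightarrow> i \<le> n \<and> p \<in> proj_part M n U i"
  by (auto simp: glue_dom_def)

lemma germ_section_apply:
  "i \<le> n \<Longrightarrow> p \<in> proj_part M n U i \<Longrightarrow> germ_section M n U g (i, p) = germ (laur n {i}) p g"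
  by (simp add: germ_section_def proj_dom_iff proj_chart_eq)

lemma germ_section_extensional: "germ_section M n U g \<in> extensional (proj_dom M n U)"
  by (simp add: germ_section_def)

lemma proj_part_Spec: "i \<le> n \<Longrightarrow> p \<in> proj_part M n U i \<Longrightarrow> p \<in> Spec (laur n {i})"
  by (simp add: proj_part_eq)

lemma germ_regular_nonempty:
  assumes "regular_on M n U g" "i \<le> n" "p \<in> proj_part M n U i"
  shows "germ (laur n {i}) p g \<noteq> {}"
proof -
  obtain t where "t \<in> laur n {i}" "t * g \<in> laur n {i}" "t \<notin> p"
    using assms unfolding regular_on_def by blast
  then show ?thesis
    using germ_memI[OF subsemiring_laur proj_part_Spec[OF assms(2,3)], of t g] by blast
qed

lemma regular_on_const: "regular_on M n U (const c)"
  unfolding regular_on_def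
proof (intro allI impI)
  fix i assume i: "i \<le> n"
  show "\<exists>t\<in>laur n {i}. t * const c \<in> laur n {i} \<and> (\<forall>p\<in>proj_part M n U i. t \<notin> p)"
    using proj_part_Spec[OF i, of _ M U] Spec_one[OF subsemiring_laur, of _ n "{i}"]
    by (intro bexI[of _ 1]) (auto simp: laur_one const_laur)
qed

lemma regular_on_DS:
  assumes S: "S \<subseteq> {..n}" and g: "g \<in> laur n S"
  shows "regular_on M n (proj_DS M n S) g"
  unfolding regular_on_def
proof (intro allI impI)
  fix i assume i: "i \<le> n"
  have "g \<in> laur n (insert i S)" using g laur_mono[of S "insert i S" n] by blast
  then obtain t where t: "t \<in> laur n {i}" "t * g \<in> laur n {i}"
    and t': "\<And>p. p \<in> Spec (laur n {i}) \<Longrightarrow> (\<And>j. j \<in> S \<Longrightarrow> xquot j i \<notin> p) \<Longrightarrow> t \<notin> p"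
    using laur_Spec_denominator[OF i S] by blast
  have "t \<notin> p" if "p \<in> proj_part M n (proj_DS M n S) i" for p
    using that t' by (simp add: proj_part_DS[OF i S])
  with t show "\<exists>t\<in>laur n {i}. t * g \<in> laur n {i} \<and> (\<forall>p\<in>proj_part M n (proj_DS M n S) i. t \<notin> p)"
    by blast
qed

lemma germ_section_mem:
  fixes M :: "'k::comm_semiring_1 itself"
  assumes U: "openin (proj_space M n) U" and g: "regular_on M n U g"
  shows "germ_section M n U g \<in> proj_sections M n U"
  unfolding glue_sections_def
proof (intro CollectI conjI ballI impI)
  show "germ_section M n U g \<in> extensional (proj_dom M n U)" by (rule germ_section_extensional)
next
  fix i assume "i \<in> {..n}"
  then have i: "i \<le> n" by simp
  let ?V = "proj_part M n U i"
  have sec: "(\<lambda>p\<in>?V. germ_section M n U g (i, p)) = (\<lambda>p\<in>?V. germ (laur n {i}) p g)"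
    using i by (intro restrict_ext) (simp add: germ_section_apply)
  obtain t where t: "t \<in> laur n {i}" "t * g \<in> laur n {i}" "\<forall>p\<in>?V. t \<notin> p"
    using g i unfolding regular_on_def by blast
  have "fraction (laur n {i}) (laur n {i} - q) (t * g) t = germ (laur n {i}) q g" if "q \<in> ?V" for q
    using that t fraction_eq_germ[OF subsemiring_laur _ germ_memI[OF subsemiring_laur]]
      proj_part_Spec[OF i that] by blast
  moreover have "openin (zariski (laur n {i})) ?V" using U i by (simp add: openin_proj)
  ultimately have "\<exists>V a f. openin (zariski (laur n {i})) V \<and> p \<in> V \<and> V \<subseteq> ?V \<and> a \<in> laur n {i} \<and> f \<in> laur n {i} \<and>
      (\<forall>q\<in>V. f \<notin> q \<and> (\<lambda>p\<in>?V. germ (laur n {i}) p g) q = fraction (laur n {i}) (laur n {i} - q) a f)"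
    if "p \<in> ?V" for p
    using that t by (intro exI[of _ ?V] exI[of _ "t * g"] exI[of _ t]) auto
  moreover have "germ (laur n {i}) p g \<in> localization (laur n {i}) (laur n {i} - p)" if "p \<in> ?V" for p
    using germ_in_localization[OF subsemiring_laur proj_part_Spec[OF i that] germ_regular_nonempty[OF g i that]] .
  ultimately show "(\<lambda>p\<in>?V. germ_section M n U g (i, p)) \<in> affine_sections (proj_chart M n i) ?V"
    unfolding sec affine_sections_def proj_chart_eq[OF i] by auto
next
  fix i j P assume "i \<in> {..n}" "j \<in> {..n}" "P \<in> Spec (proj_overlap M n i j)"
    and U': "proj_point M n i (P \<inter> proj_chart M n i) \<in> U"
  then have i: "i \<le> n" and j: "j \<le> n" and P: "P \<in> Spec (laur n {i, j})" by (auto simp: proj_overlap_eq)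
  have pi: "P \<inter> laur n {i} \<in> proj_part M n U i"
    using U' i laur_Spec_contract[OF P, of "{i}"] by (simp add: proj_part_eq proj_chart_eq)
  have pj: "P \<inter> laur n {j} \<in> proj_part M n U j"
    using U' i j laur_Spec_contract[OF P, of "{j}"] proj_point_contract_eq[OF i j P, of M]
    by (simp add: proj_part_eq proj_chart_eq)
  have "loc_rel (laur n {i, j}) (laur n {i, j} - P) `` germ (laur n {k}) (P \<inter> laur n {k}) g = germ (laur n {i, j}) P g"
    if "k \<in> {i, j}" "P \<inter> laur n {k} \<in> proj_part M n U k" for k
  proof (rule loc_rel_image_germ[OF subsemiring_laur subsemiring_laur _ P])
    show "laur n {k} \<subseteq> (laur n {i, j} :: 'k laurent set)" using that by (intro laur_mono) auto
    show "germ (laur n {k}) (P \<inter> laur n {k}) g \<noteq> {}"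
      using germ_regular_nonempty[OF g _ that(2)] that(1) i j by auto
  qed
  then show "loc_rel (proj_overlap M n i j) (proj_overlap M n i j - P) `` germ_section M n U g (i, P \<inter> proj_chart M n i) =
    loc_rel (proj_overlap M n i j) (proj_overlap M n i j - P) `` germ_section M n U g (j, P \<inter> proj_chart M n j)"
    using i j pi pj by (simp add: proj_overlap_eq proj_chart_eq germ_section_apply)
qed

lemma sections_localization:
  assumes s: "s \<in> proj_sections M n U" and i: "i \<le> n" and p: "p \<in> proj_part M n U i"
  shows "s (i, p) \<in> localization (laur n {i}) (laur n {i} - p)"
proof -
  have "(\<lambda>p\<in>proj_part M n U i. s (i, p)) \<in> affine_sections (proj_chart M n i) (proj_part M n U i)"
    using s i by (auto simp: glue_sections_def)
  then show ?thesis using p i by (auto simp: affine_sections_def proj_chart_eq PiE_iff)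
qed

lemma sections_compatible:
  assumes s: "s \<in> proj_sections M n U" and i: "i \<le> n" and j: "j \<le> n"
    and P: "P \<in> Spec (laur n {i, j})" and U: "proj_point M n i (P \<inter> laur n {i}) \<in> U"
  shows "loc_rel (laur n {i, j}) (laur n {i, j} - P) `` s (i, P \<inter> laur n {i}) =
    loc_rel (laur n {i, j}) (laur n {i, j} - P) `` s (j, P \<inter> laur n {j})"
proof -
  have "\<forall>i\<in>{..n}. \<forall>j\<in>{..n}. \<forall>P\<in>Spec (proj_overlap M n i j).
      proj_point M n i (P \<inter> proj_chart M n i) \<in> U \<longrightarrow>
      loc_rel (proj_overlap M n i j) (proj_overlap M n i j - P) `` s (i, P \<inter> proj_chart M n i) =
      loc_rel (proj_overlap M n i j) (proj_overlap M n i j - P) `` s (j, P \<inter> proj_chart M n j)"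
    using s unfolding glue_sections_def mem_Collect_eq by (elim conjE)
  from this[rule_format, of i j P] show ?thesis
    using i j P U by (simp add: proj_chart_eq proj_overlap_eq)
qed

text \<open>Near the closed point of \<open>D(\<Prod>\<^sub>j\<^sub>\<in>\<^sub>S x\<^sub>j)\<close> a section is a single fraction, whose denominator is
  invertible on all of that set.\<close>

lemma section_eq_germ:
  fixes M :: "'k::idempotent_semifield itself"
  assumes s: "s \<in> proj_sections M n U" and S: "S \<subseteq> {..n}" "S \<noteq> {}" and SU: "proj_DS M n S \<subseteq> U"
  obtains g where "g \<in> laur n S"
    "\<And>i p. i \<le> n \<Longrightarrow> p \<in> proj_part M n (proj_DS M n S) i \<Longrightarrow> s (i, p) = germ (laur n {i}) p g"
proof -
  obtain i where iS: "i \<in> S" using S by blast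
  have i: "i \<le> n" using S iS by auto
  let ?A = "laur n {i} :: 'k laurent set" and ?m = "closed_pt n S i :: 'k laurent set"
  have sub: "proj_part M n (proj_DS M n S) k \<subseteq> proj_part M n U k" for k
    using SU by (auto simp: chart_part_def)
  have m: "?m \<in> proj_part M n (proj_DS M n S) i"
    unfolding proj_part_DS[OF i S(1)] using closed_pt_Spec[OF iS] closed_pt_xquot[OF iS _ S(1)] by blast
  have "(\<lambda>p\<in>proj_part M n U i. s (i, p)) \<in> affine_sections ?A (proj_part M n U i)"
    using s i unfolding glue_sections_def by (auto simp: proj_chart_eq)
  then obtain V a f where V: "openin (zariski ?A) V" "?m \<in> V" "V \<subseteq> proj_part M n U i" and af: "a \<in> ?A" "f \<in> ?A"
    and loc: "\<forall>q\<in>V. f \<notin> q \<and> (\<lambda>p\<in>proj_part M n U i. s (i, p)) q = fraction ?A (?A - q) a f"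
    using m sub[of i] unfolding affine_sections_def by blast
  have V': "p \<in> V" if "p \<in> proj_part M n (proj_DS M n S) i" for p
    using that closed_pt_open[OF S(1) iS V(1,2), of p] unfolding proj_part_DS[OF i S(1)] by blast
  \<comment> \<open>A chart element that does not vanish at the closed point is a unit over the
    whole intersection, so the quotient of \<open>a\<close> by \<open>f\<close> exists as a Laurent
    polynomial \<open>g\<close>.\<close>
  have "f \<in> laur_units n S" using loc V(2) af by (auto simp: closed_pt_def)
  then obtain f' where f': "f' \<in> laur_units n S" "f * f' = 1" by (rule laur_unitsE)
  define g where "g = a * f'"
  have sub_i: "?A \<subseteq> laur n S" using laur_mono[of "{i}" S n] iS by simp
  have g: "g \<in> laur n S"
    unfolding g_def using af(1) f'(1) laur_units_subset[of n S] sub_i by (blast intro: laur_mult)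
  have fg: "f * g = a" unfolding g_def using f'(2) by (metis mult.left_commute mult.right_neutral)
  have si: "s (i, p) = germ ?A p g" if "p \<in> proj_part M n (proj_DS M n S) i" for p
  proof -
    have p: "p \<in> Spec ?A" using proj_part_Spec[OF i that] .
    have "p \<in> proj_part M n U i" using sub[of i] that by (rule subsetD)
    then have "s (i, p) = fraction ?A (?A - p) a f" using bspec[OF loc V'[OF that]] by simp
    moreover have "f \<in> ?A - p" using bspec[OF loc V'[OF that]] af(2) by simp
    then have "(f * g, f) \<in> germ ?A p g"
      using germ_memI[OF subsemiring_laur p, of f g] af(1) fg by simp
    ultimately show ?thesis using fraction_eq_germ[OF subsemiring_laur p] fg by simp
  qed
  \<comment> \<open>A point seen in another chart \<open>j\<close> also lies in chart
    \<open>i\<close>, where \<open>s\<close> is known. Compatibility carries the germ of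
    \<open>g\<close> to the stalk of the overlap at \<open>P\<close>, and injectivity of the stalk
    map brings it down to chart \<open>j\<close>.\<close>
  have "s (j, q) = germ (laur n {j}) q g" if j: "j \<le> n" and q: "q \<in> proj_part M n (proj_DS M n S) j" for j q
  proof -
    have qS: "q \<in> Spec (laur n {j})" using proj_part_Spec[OF j q] .
    have "xquot i j \<notin> q" using q iS by (simp add: proj_part_DS[OF j S(1)])
    moreover have "xquot j j \<notin> q" using Spec_one[OF subsemiring_laur qS] by simp
    ultimately have nq: "xquot l j \<notin> q" if "l \<in> {i, j}" for l using that by blast
    obtain P where P: "P \<in> Spec (laur n {i, j})" "P \<inter> laur n {j} = q"
      using laur_Spec_extend[where T = "{i, j}", OF _ _ qS nq] i j by auto
    let ?B = "laur n {i, j} :: 'k laurent set" and ?p = "P \<inter> ?A"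
    have pt: "proj_point M n i ?p = proj_point M n j q"
      using proj_point_contract_eq[OF i j P(1), of M] P(2) by simp
    have p: "?p \<in> proj_part M n (proj_DS M n S) i"
      using q pt laur_Spec_contract[OF P(1), of "{i}"] by (simp add: proj_part_eq[OF i] proj_part_eq[OF j])
    with sub[of i] have "?p \<in> proj_part M n U i" by (rule subsetD)
    then have "proj_point M n i ?p \<in> U" by (simp add: proj_part_eq[OF i])
    then have "loc_rel ?B (?B - P) `` s (i, ?p) = loc_rel ?B (?B - P) `` s (j, q)"
      using sections_compatible[OF s i j P(1)] P(2) by simp
    moreover have "loc_rel ?B (?B - P) `` s (i, ?p) = germ ?B P g"
      unfolding si[OF p]
    proof (rule loc_rel_image_germ[OF subsemiring_laur subsemiring_laur _ P(1)])
      show "?A \<subseteq> ?B" by (intro laur_mono) auto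
      show "germ ?A ?p g \<noteq> {}"
        using germ_regular_nonempty[OF regular_on_DS[OF S(1) g] i p] .
    qed
    ultimately have eq: "loc_rel ?B (?B - P) `` s (j, q) = germ ?B P g" by simp
    obtain b t where bt: "b \<in> laur n {j}" "t \<in> laur n {j} - q" "s (j, q) = fraction (laur n {j}) (laur n {j} - q) b t"
      by (rule localization_cases[OF sections_localization[OF s j subsetD[OF sub q]]])
    have dj: "laur n {j} - P = laur n {j} - q" "laur n {j} - P \<inter> laur n {j} = laur n {j} - q"
      using P(2) by blast+
    have "fraction (laur n {j}) (laur n {j} - P \<inter> laur n {j}) b t = germ (laur n {j}) (P \<inter> laur n {j}) g"
    proof (rule fraction_eq_germ_of_extension[OF subsemiring_laur subsemiring_laur _ P(1)])
      show "laur n {j} \<subseteq> ?B" by (intro laur_mono) auto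
      show "\<exists>t\<in>laur n {j} - P. t * b \<in> laur n {j}" if "b \<in> ?B" for b
        using laur_denominator_contract[OF _ _ P(1) that, of j] i j by auto
      show "t \<in> laur n {j} - P" using bt dj by simp
      show "loc_rel ?B (?B - P) `` fraction (laur n {j}) (laur n {j} - P \<inter> laur n {j}) b t = germ ?B P g"
        using eq bt(3) P(2) by simp
    qed (use bt in auto)
    then show ?thesis using bt(3) P(2) by simp
  qed
  with g show ?thesis by (rule that)
qed

section \<open>Sheaf operations on germs of polynomials\<close>

lemma proj_sheaf_sections:
  "smcarrier (sections (proj_structure_sheaf M n) U) = proj_sections M n U"
  by (simp add: proj_structure_sheaf_def glue_sheaf_def)

lemma regular_on_add:
  assumes f: "regular_on M n U f" and g: "regular_on M n U g"
  shows "regular_on M n U (f + g)"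
  unfolding regular_on_def
proof (intro allI impI)
  fix i assume i: "i \<le> n"
  obtain s where s: "s \<in> laur n {i}" "s * f \<in> laur n {i}" "\<forall>p\<in>proj_part M n U i. s \<notin> p"
    using f i unfolding regular_on_def by blast
  obtain t where t: "t \<in> laur n {i}" "t * g \<in> laur n {i}" "\<forall>p\<in>proj_part M n U i. t \<notin> p"
    using g i unfolding regular_on_def by blast
  have "s * t * (f + g) = t * (s * f) + s * (t * g)" by (simp add: algebra_simps)
  also have "\<dots> \<in> laur n {i}" by (rule laur_add[OF laur_mult[OF t(1) s(2)] laur_mult[OF s(1) t(2)]])
  finally have "s * t * (f + g) \<in> laur n {i}" .
  moreover have "s * t \<notin> p" if "p \<in> proj_part M n U i" for p
    using Spec_mult_notin[OF proj_part_Spec[OF i that] subsemiring_laur, of s t] s t that by simp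
  moreover have "s * t \<in> laur n {i}" using s t by (intro laur_mult)
  ultimately show "\<exists>t\<in>laur n {i}. t * (f + g) \<in> laur n {i} \<and> (\<forall>p\<in>proj_part M n U i. t \<notin> p)"
    by blast
qed

lemma regular_on_zero: "regular_on M n U 0"
  using regular_on_const[of M n U 0] by (simp add: const_def)

lemma regular_on_sum_list:
  "(\<And>x. x \<in> set xs \<Longrightarrow> regular_on M n U x) \<Longrightarrow> regular_on M n U (sum_list xs)"
  by (induction xs) (auto intro: regular_on_add regular_on_zero)

lemma germ_section_eqI:
  assumes "s \<in> extensional (proj_dom M n U)"
    and "\<And>i p. i \<le> n \<Longrightarrow> p \<in> proj_part M n U i \<Longrightarrow> s (i, p) = germ (laur n {i}) p g"
  shows "s = germ_section M n U g"
  by (rule extensionalityI[OF assms(1) germ_section_extensional])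
    (auto simp: glue_dom_def germ_section_apply assms(2))

lemma smadd_germ_section:
  assumes "regular_on M n U f" "regular_on M n U g"
  shows "smadd (sections (proj_structure_sheaf M n) U) (germ_section M n U f) (germ_section M n U g)
    = germ_section M n U (f + g)"
proof (rule germ_section_eqI)
  fix i p assume i: "i \<le> n" "p \<in> proj_part M n U i"
  then show "smadd (sections (proj_structure_sheaf M n) U) (germ_section M n U f) (germ_section M n U g) (i, p)
      = germ (laur n {i}) p (f + g)"
    using loc_add_germ[OF subsemiring_laur proj_part_Spec[OF i]
        germ_regular_nonempty[OF assms(1) i] germ_regular_nonempty[OF assms(2) i]]
    by (simp add: proj_structure_sheaf_def glue_sheaf_def proj_dom_iff germ_section_apply proj_chart_eq)
qed (simp add: proj_structure_sheaf_def glue_sheaf_def)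

lemma smzero_proj_sheaf: "smzero (sections (proj_structure_sheaf M n) U) = germ_section M n U 0"
proof (rule germ_section_eqI)
  fix i p assume i: "i \<le> n" "p \<in> proj_part M n U i"
  then show "smzero (sections (proj_structure_sheaf M n) U) (i, p) = germ (laur n {i}) p 0"
    using germ_of_mem(2)[OF subsemiring_laur proj_part_Spec[OF i] laur_zero]
    by (simp add: proj_structure_sheaf_def glue_sheaf_def proj_dom_iff proj_chart_eq)
qed (simp add: proj_structure_sheaf_def glue_sheaf_def)

lemma restr_germ_section:
  assumes "V \<subseteq> U"
  shows "restr (proj_structure_sheaf M n) U V (germ_section M n U g) = germ_section M n V g"
proof (rule germ_section_eqI)
  have "proj_part M n V i \<subseteq> proj_part M n U i" for i
    using assms by (auto simp: chart_part_def)
  then show "restr (proj_structure_sheaf M n) U V (germ_section M n U g) (i, p) = germ (laur n {i}) p g"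
    if "i \<le> n" "p \<in> proj_part M n V i" for i p
    using that by (auto simp: proj_structure_sheaf_def glue_sheaf_def proj_dom_iff germ_section_apply subset_iff)
qed (simp add: proj_structure_sheaf_def glue_sheaf_def)

lemma sm_sum_list_germ_section:
  assumes "\<And>k. k \<in> set ks \<Longrightarrow> regular_on M n U (g k)"
  shows "sm_sum_list (sections (proj_structure_sheaf M n) U) (map (\<lambda>k. germ_section M n U (g k)) ks)
    = germ_section M n U (\<Sum>k\<leftarrow>ks. g k)"
  using assms
proof (induction ks)
  case Nil
  show ?case by (simp add: sm_sum_list_def smzero_proj_sheaf)
next
  case (Cons k ks)
  have "regular_on M n U (\<Sum>k\<leftarrow>ks. g k)"
    using Cons.prems by (intro regular_on_sum_list) auto
  then show ?case
    using Cons by (simp add: sm_sum_list_def smadd_germ_section)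
qed

section \<open>Cohomology of the standard covering\<close>

abbreviation "std_simplices M n \<equiv> cech_simplices (proj_standard_covering M n)"

lemma std_simplices_iff:
  "\<sigma> \<in> std_simplices M n p \<longleftrightarrow> length \<sigma> = p + 1 \<and> set \<sigma> \<subseteq> {..n} \<and> sorted_wrt (<) \<sigma>"
proof -
  have "sorted_wrt (\<lambda>i j. (i, j) \<in> {(i, j). i \<le> j \<and> j \<le> n} \<and> i \<noteq> j) \<sigma> \<longleftrightarrow> sorted_wrt (<) \<sigma>"
    if "set \<sigma> \<subseteq> {..n}"
    using that by (intro iffI) (auto elim!: sorted_wrt_mono_rel[rotated])
  then show ?thesis by (auto simp: cech_simplices_def proj_standard_covering_def)
qed

lemma finite_std_simplices: "finite (std_simplices M n p)"
  by (rule finite_subset[OF _ finite_lists_length_eq[of "{..n}" "p + 1"]]) (auto simp: std_simplices_iff)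

lemma std_cov_inter: "cov_inter (proj_standard_covering M n) \<sigma> = proj_DS M n (set \<sigma>)"
  by (simp add: cov_inter_def proj_DS_def proj_standard_covering_def)

lemma std_simplex_set:
  assumes "\<sigma> \<in> std_simplices M n p"
  shows "set \<sigma> \<subseteq> {..n}" "set \<sigma> \<noteq> {}" "length \<sigma> = p + 1" "distinct \<sigma>"
  using assms by (auto simp: std_simplices_iff strict_sorted_iff)

lemma set_drop_at:
  assumes "distinct \<sigma>" "k < length \<sigma>"
  shows "set (drop_at k \<sigma>) = set \<sigma> - {\<sigma> ! k}"
proof -
  have "\<sigma> = take k \<sigma> @ \<sigma> ! k # drop (Suc k) \<sigma>" by (rule id_take_nth_drop[OF assms(2)])
  with assms(1) show ?thesis unfolding drop_at_def
    by (metis (no_types, lifting) Diff_insert_absorb Un_insert_right distinct.simps(2) distinct_append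
        disjoint_insert(1) list.simps(15) set_append Un_iff)
qed

lemma drop_at_std_simplex:
  assumes "\<sigma> \<in> std_simplices M n (Suc p)" "k < p + 2"
  shows "drop_at k \<sigma> \<in> std_simplices M n p"
proof -
  have "\<sigma> = take k \<sigma> @ \<sigma> ! k # drop (Suc k) \<sigma>"
    using assms by (intro id_take_nth_drop) (simp add: std_simplices_iff)
  then have "sorted_wrt (<) (take k \<sigma> @ \<sigma> ! k # drop (Suc k) \<sigma>)" using assms by (simp add: std_simplices_iff)
  then have "sorted_wrt (<) (drop_at k \<sigma>)" by (simp add: drop_at_def sorted_wrt_append)
  then show ?thesis
    using assms set_take_subset[of k \<sigma>] set_drop_subset[of "Suc k" \<sigma>]
    by (auto simp: std_simplices_iff drop_at_def)
qed

section \<open>Cochains as families of Laurent polynomials\<close>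

definition laur_cochain ::
  "'k::comm_semiring_1 itself \<Rightarrow> nat \<Rightarrow> nat \<Rightarrow> (nat list \<Rightarrow> 'k laurent) \<Rightarrow> nat list \<Rightarrow> 'k proj_section" where
  "laur_cochain M n p g = (\<lambda>\<sigma>\<in>std_simplices M n p. germ_section M n (proj_DS M n (set \<sigma>)) (g \<sigma>))"

abbreviation "std_cochains M n \<equiv> cech_cochains (proj_structure_sheaf M n) (proj_standard_covering M n)"
abbreviation "std_cocycles M n \<equiv> cech_cocycles (proj_structure_sheaf M n) (proj_standard_covering M n)"
abbreviation "std_rho M n \<equiv> cech_rho (proj_structure_sheaf M n) (proj_standard_covering M n)"
abbreviation "std_partial Q M n \<equiv> cech_partial Q (proj_structure_sheaf M n) (proj_standard_covering M n)"

definition laur_family :: "'k::comm_semiring_1 itself \<Rightarrow> nat \<Rightarrow> nat \<Rightarrow> (nat list \<Rightarrow> 'k laurent) \<Rightarrow> bool" where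
  "laur_family M n p g \<longleftrightarrow> (\<forall>\<sigma>\<in>std_simplices M n p. g \<sigma> \<in> laur n (set \<sigma>))"

lemma laur_family_regular:
  "laur_family M n p g \<Longrightarrow> \<sigma> \<in> std_simplices M n p \<Longrightarrow> regular_on M n (proj_DS M n (set \<sigma>)) (g \<sigma>)"
  unfolding laur_family_def using regular_on_DS[OF std_simplex_set(1)] by blast

lemma laur_cochain_mem:
  assumes "laur_family M n p g"
  shows "laur_cochain M n p g \<in> smcarrier (std_cochains M n p)"
proof -
  have "germ_section M n (proj_DS M n (set \<sigma>)) (g \<sigma>) \<in> proj_sections M n (proj_DS M n (set \<sigma>))"
    if "\<sigma> \<in> std_simplices M n p" for \<sigma>
    using germ_section_mem[OF openin_proj_DS[OF std_simplex_set(1,2)[OF that]] laur_family_regular[OF assms that]] .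
  then show ?thesis
    by (simp add: cech_cochains_def laur_cochain_def proj_sheaf_sections std_cov_inter)
qed

lemma std_cochain_cases:
  fixes M :: "'k::idempotent_semifield itself"
  assumes x: "x \<in> smcarrier (std_cochains M n p)"
  obtains g where "laur_family M n p g" "x = laur_cochain M n p g"
proof -
  have "\<exists>g. g \<in> laur n (set \<sigma>) \<and> x \<sigma> = germ_section M n (proj_DS M n (set \<sigma>)) g"
    if \<sigma>: "\<sigma> \<in> std_simplices M n p" for \<sigma>
  proof -
    have s: "x \<sigma> \<in> proj_sections M n (proj_DS M n (set \<sigma>))"
      using x \<sigma> by (auto simp: cech_cochains_def proj_sheaf_sections std_cov_inter)
    obtain g where "g \<in> laur n (set \<sigma>)" and
      g: "\<And>i p. i \<le> n \<Longrightarrow> p \<in> proj_part M n (proj_DS M n (set \<sigma>)) i \<Longrightarrow> x \<sigma> (i, p) = germ (laur n {i}) p g"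
      using section_eq_germ[OF s std_simplex_set(1,2)[OF \<sigma>] order_refl] by metis
    moreover have "x \<sigma> \<in> extensional (proj_dom M n (proj_DS M n (set \<sigma>)))"
      using s by (simp add: glue_sections_def)
    ultimately show ?thesis using germ_section_eqI by blast
  qed
  then obtain g where g: "\<And>\<sigma>. \<sigma> \<in> std_simplices M n p \<Longrightarrow>
      g \<sigma> \<in> laur n (set \<sigma>) \<and> x \<sigma> = germ_section M n (proj_DS M n (set \<sigma>)) (g \<sigma>)" by metis
  have "x \<in> extensional (std_simplices M n p)" using x by (simp add: cech_cochains_def PiE_def)
  then have "x = laur_cochain M n p g"
    using g by (auto simp: laur_cochain_def intro: extensionalityI)
  then show ?thesis using g by (intro that[of g]) (simp_all add: laur_family_def)
qed

text \<open>Evaluation at the closed point of each intersection already determines the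
  polynomial.\<close>

lemma laur_cochain_inj:
  fixes M :: "'k::idempotent_semifield itself"
  assumes f: "laur_family M n p f" and eq: "laur_cochain M n p f = laur_cochain M n p g"
    and \<sigma>: "\<sigma> \<in> std_simplices M n p"
  shows "f \<sigma> = g \<sigma>"
proof -
  let ?S = "set \<sigma>"
  note S = std_simplex_set(1,2)[OF \<sigma>]
  obtain i where i: "i \<in> ?S" using S(2) by (metis ex_in_conv)
  then have n: "i \<le> n" using S by auto
  have m: "closed_pt n ?S i \<in> proj_part M n (proj_DS M n ?S) i"
    unfolding proj_part_DS[OF n S(1)] using closed_pt_Spec[OF i] closed_pt_xquot[OF i _ S(1)] by blast
  have "germ_section M n (proj_DS M n ?S) (f \<sigma>) = germ_section M n (proj_DS M n ?S) (g \<sigma>)"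
    using fun_cong[OF eq, of \<sigma>] \<sigma> by (simp add: laur_cochain_def)
  from fun_cong[OF this, of "(i, closed_pt n ?S i)"]
  have "germ (laur n {i}) (closed_pt n ?S i) (f \<sigma>) = germ (laur n {i}) (closed_pt n ?S i) (g \<sigma>)"
    by (simp add: germ_section_apply n m)
  then show ?thesis
    using germ_closed_pt_inj[OF i S(1)] f \<sigma> by (auto simp: laur_family_def)
qed

lemma laur_cochain_add:
  assumes "laur_family M n p f" "laur_family M n p g"
  shows "smadd (std_cochains M n p) (laur_cochain M n p f) (laur_cochain M n p g)
    = laur_cochain M n p (\<lambda>\<sigma>. f \<sigma> + g \<sigma>)"
  using assms by (auto simp: cech_cochains_def laur_cochain_def std_cov_inter laur_family_regular
      intro!: restrict_ext smadd_germ_section)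

lemma laur_cochain_zero: "smzero (std_cochains M n p) = laur_cochain M n p (\<lambda>_. 0)"
  by (simp add: cech_cochains_def laur_cochain_def std_cov_inter smzero_proj_sheaf)

text \<open>The partial coboundary in terms of polynomials: restriction maps become inclusions
  between the sets \<open>laur n S\<close> and leave no trace.\<close>

definition face_sum :: "(nat \<Rightarrow> bool) \<Rightarrow> nat \<Rightarrow> (nat list \<Rightarrow> 'k::comm_semiring_1 laurent) \<Rightarrow> nat list \<Rightarrow> 'k laurent" where
  "face_sum Q p g \<tau> = (\<Sum>k\<leftarrow>filter Q [0..<p + 2]. g (drop_at k \<tau>))"

lemma laur_family_add: "laur_family M n p f \<Longrightarrow> laur_family M n p g \<Longrightarrow> laur_family M n p (\<lambda>\<sigma>. f \<sigma> + g \<sigma>)"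
  by (simp add: laur_family_def laur_add)

lemma laur_family_face_sum:
  assumes g: "laur_family M n p g"
  shows "laur_family M n (Suc p) (face_sum Q p g)"
  unfolding laur_family_def
proof
  fix \<tau> assume \<tau>: "\<tau> \<in> std_simplices M n (Suc p)"
  have "g (drop_at k \<tau>) \<in> laur n (set \<tau>)" if "k < p + 2" for k
  proof -
    have "set (drop_at k \<tau>) \<subseteq> set \<tau>"
      using set_take_subset[of k \<tau>] set_drop_subset[of "Suc k" \<tau>] by (auto simp: drop_at_def)
    then show ?thesis
      using g drop_at_std_simplex[OF \<tau> that] laur_mono[of "set (drop_at k \<tau>)" "set \<tau>" n]
      unfolding laur_family_def by blast
  qed
  then have "(\<Sum>k\<leftarrow>ks. g (drop_at k \<tau>)) \<in> laur n (set \<tau>)" if "set ks \<subseteq> {..<p + 2}" for ks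
    using that by (induction ks) (auto simp: laur_zero laur_add)
  then show "face_sum Q p g \<tau> \<in> laur n (set \<tau>)" unfolding face_sum_def by (rule meta_mp) auto
qed

lemma std_partial_laur_cochain:
  assumes g: "laur_family M n p g"
  shows "std_partial Q M n p (laur_cochain M n p g) = laur_cochain M n (Suc p) (face_sum Q p g)"
  unfolding cech_partial_def laur_cochain_def Suc_eq_plus1
proof (rule restrict_ext)
  fix \<tau> assume "\<tau> \<in> std_simplices M n (p + 1)"
  then have \<tau>: "\<tau> \<in> std_simplices M n (Suc p)" by simp
  let ?F = "proj_structure_sheaf M n" and ?U = "proj_DS M n (set \<tau>)"
  let ?x = "\<lambda>\<sigma>\<in>std_simplices M n p. germ_section M n (proj_DS M n (set \<sigma>)) (g \<sigma>)"
  have face: "restr ?F (proj_DS M n (set (drop_at k \<tau>))) ?U (?x (drop_at k \<tau>)) = germ_section M n ?U (g (drop_at k \<tau>))"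
    and reg: "regular_on M n ?U (g (drop_at k \<tau>))" if "k < p + 2" for k
  proof -
    note d = drop_at_std_simplex[OF \<tau> that]
    have sub: "set (drop_at k \<tau>) \<subseteq> set \<tau>"
      using set_take_subset[of k \<tau>] set_drop_subset[of "Suc k" \<tau>] by (auto simp: drop_at_def)
    then have "?U \<subseteq> proj_DS M n (set (drop_at k \<tau>))" by (auto simp: proj_DS_def)
    then show "restr ?F (proj_DS M n (set (drop_at k \<tau>))) ?U (?x (drop_at k \<tau>)) = germ_section M n ?U (g (drop_at k \<tau>))"
      using d by (simp add: restr_germ_section)
    have "g (drop_at k \<tau>) \<in> laur n (set \<tau>)"
      using g d laur_mono[OF sub, of n] unfolding laur_family_def by blast
    then show "regular_on M n ?U (g (drop_at k \<tau>))" using regular_on_DS std_simplex_set(1)[OF \<tau>] by blast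
  qed
  have "map (\<lambda>k. restr ?F (proj_DS M n (set (drop_at k \<tau>))) ?U (?x (drop_at k \<tau>))) (filter Q [0..<p + 2])
    = map (\<lambda>k. germ_section M n ?U (g (drop_at k \<tau>))) (filter Q [0..<p + 2])"
    by (rule map_cong[OF refl], rule face) (auto simp del: upt_Suc)
  moreover have "sm_sum_list (sections ?F ?U) (map (\<lambda>k. germ_section M n ?U (g (drop_at k \<tau>))) (filter Q [0..<p + 2]))
    = germ_section M n ?U (\<Sum>k\<leftarrow>filter Q [0..<p + 2]. g (drop_at k \<tau>))"
    by (rule sm_sum_list_germ_section, rule reg) (auto simp del: upt_Suc)
  ultimately show "sm_sum_list (sections ?F (cov_inter (proj_standard_covering M n) \<tau>))
      (map (\<lambda>k. restr ?F (cov_inter (proj_standard_covering M n) (drop_at k \<tau>))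
        (cov_inter (proj_standard_covering M n) \<tau>) (?x (drop_at k \<tau>))) (filter Q [0..<p + 2]))
    = germ_section M n ?U (face_sum Q p g \<tau>)"
    by (simp only: std_cov_inter face_sum_def)
qed

section \<open>Absorption and the vanishing of higher cohomology\<close>

lemma lookup_sum_list_map:
  "Poly_Mapping.lookup (\<Sum>k\<leftarrow>ks. f k) e = (\<Sum>k\<leftarrow>ks. Poly_Mapping.lookup (f k) e)"
  by (induction ks) (auto simp: lookup_add)

lemma sum_list_eq_0_idem:
  fixes xs :: "'k::idempotent_semifield list"
  shows "sum_list xs = 0 \<longleftrightarrow> (\<forall>x\<in>set xs. x = 0)"
  by (induction xs) (auto simp: add_eq_0_idem)

text \<open>The equation \<open>a + x = x\<close> is the natural order \<open>a \<le> x\<close> of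
  an idempotent semiring, in which a sum dominates whatever one of its terms dominates.\<close>

lemma absorb_sum_list:
  fixes xs :: "'k::idempotent_semifield list"
  assumes "x \<in> set xs" "a + x = x"
  shows "a + sum_list xs = sum_list xs"
  using assms(1)
proof (induction xs)
  case (Cons y ys)
  show ?case
  proof (cases "x = y")
    case True
    then show ?thesis using assms(2) by (simp add: add.assoc[symmetric])
  next
    case False
    then have "a + sum_list ys = sum_list ys" using Cons by simp
    then show ?thesis by (simp add: add.left_commute[of a])
  qed
qed simp

lemma absorb_sum:
  fixes f :: "'a \<Rightarrow> 'k::idempotent_semifield"
  assumes "finite A" "x \<in> A" "a + f x = f x"
  shows "a + sum f A = sum f A"
  using assms by (simp add: sum.remove[of A x] add.assoc[symmetric])

lemma lookup_laur: "f \<in> laur n S \<Longrightarrow> Poly_Mapping.lookup f e \<noteq> 0 \<Longrightarrow> e \<in> lexps n S"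
  by (auto simp: laur_def in_keys_iff)

text \<open>A monomial with nonzero coefficient in a cocycle is already regular on some face: otherwise its
  exponents are negative exactly on \<open>\<sigma>\<close>, and adding a vertex to \<open>\<sigma>\<close> gives a simplex
  of which \<open>\<sigma>\<close> is the only face to contribute this monomial.\<close>

lemma cocycle_key_in_face:
  fixes M :: "'k::idempotent_semifield itself"
  assumes g: "laur_family M n p g"
    and cocycle: "\<And>\<tau>. \<tau> \<in> std_simplices M n (Suc p) \<Longrightarrow> face_sum even p g \<tau> = face_sum odd p g \<tau>"
    and \<sigma>: "\<sigma> \<in> std_simplices M n p" and e: "Poly_Mapping.lookup (g \<sigma>) e \<noteq> 0"
  obtains k where "k < p + 1" "e \<in> lexps n (set (drop_at k \<sigma>))"
proof (rule ccontr)
  assume "\<not> thesis"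
  with that have no: "e \<notin> lexps n (set (drop_at k \<sigma>))" if "k < p + 1" for k using that by blast
  note S = std_simplex_set[OF \<sigma>]
  have e\<sigma>: "e \<in> lexps n (set \<sigma>)" using g \<sigma> lookup_laur[OF _ e] by (simp add: laur_family_def)
  \<comment> \<open>A nonnegative exponent at a vertex \<open>j\<close> would make the monomial
    regular on the face that omits \<open>j\<close>.\<close>
  have neg: "Poly_Mapping.lookup e j < 0" if j: "j \<in> set \<sigma>" for j
  proof -
    obtain k where k: "k < p + 1" "\<sigma> ! k = j" using j S(3) by (auto simp: in_set_conv_nth)
    have "set (drop_at k \<sigma>) = set \<sigma> - {j}" using set_drop_at[OF S(4)] k S(3) by simp
    then show ?thesis using no[OF k(1)] e\<sigma> by (force simp: lexps_def not_le)
  qed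
  \<comment> \<open>If \<open>\<sigma>\<close> were all of \<open>{..n}\<close>, every exponent
    would be negative, against degree zero; so there is room for one more vertex.\<close>
  have "\<exists>j\<le>n. j \<notin> set \<sigma>"
  proof (rule ccontr)
    assume "\<not> ?thesis"
    then have "(\<Sum>k\<le>n. Poly_Mapping.lookup e k) < (\<Sum>k\<le>n. 0)"
      using neg by (intro sum_strict_mono) auto
    then show False using e\<sigma> by (simp add: lexps_def)
  qed
  then obtain j where j: "j \<le> n" "j \<notin> set \<sigma>" by blast
  define \<tau> where "\<tau> = insort j \<sigma>"
  have sorted: "sorted \<sigma>" using \<sigma> by (simp add: std_simplices_iff strict_sorted_iff)
  have \<tau>: "\<tau> \<in> std_simplices M n (Suc p)"
    using \<sigma> j sorted by (auto simp: \<tau>_def std_simplices_iff strict_sorted_iff set_insort_key sorted_insort distinct_insort)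
  have set\<tau>: "set \<tau> = insert j (set \<sigma>)" by (simp add: \<tau>_def set_insort_key)
  note T = std_simplex_set[OF \<tau>]
  obtain k0 where k0: "k0 < p + 2" "\<tau> ! k0 = j"
    using set\<tau> T(3) in_set_conv_nth[of j \<tau>] by auto
  have "drop_at k0 \<tau> = \<sigma>"
  proof (rule strict_sorted_equal)
    show "sorted_wrt (<) (drop_at k0 \<tau>)" using drop_at_std_simplex[OF \<tau> k0(1)] by (simp add: std_simplices_iff)
    show "sorted_wrt (<) \<sigma>" using \<sigma> by (simp add: std_simplices_iff)
    show "set (drop_at k0 \<tau>) = set \<sigma>" using set_drop_at[OF T(4), of k0] k0 T(3) set\<tau> j by auto
  qed
  \<comment> \<open>Any other face of \<open>\<tau>\<close> omits a vertex of
    \<open>\<sigma>\<close>, where the monomial has a pole that this face does not permit.\<close>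
  have zero: "Poly_Mapping.lookup (g (drop_at k \<tau>)) e = 0" if k: "k < p + 2" "k \<noteq> k0" for k
  proof (rule ccontr)
    assume "\<not> ?thesis"
    then have "e \<in> lexps n (set (drop_at k \<tau>))"
      using g drop_at_std_simplex[OF \<tau> k(1)] lookup_laur[of "g (drop_at k \<tau>)"]
      by (simp add: laur_family_def)
    moreover have "\<tau> ! k \<noteq> j" using k k0 T(3,4) by (auto simp: nth_eq_iff_index_eq)
    then have "\<tau> ! k \<in> set \<sigma>" using set\<tau> k T(3) nth_mem[of k \<tau>] by auto
    moreover have "\<tau> ! k \<notin> set (drop_at k \<tau>)" using set_drop_at[OF T(4), of k] k T(3) by simp
    ultimately show False using neg[of "\<tau> ! k"] by (auto simp: lexps_def)
  qed
  \<comment> \<open>The position \<open>k0\<close> has one parity, so the sum over the opposite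
    parity has coefficient zero at \<open>e\<close>. The cocycle equation carries this to the sum
    that contains \<open>g \<sigma>\<close>, and a vanishing sum has only vanishing terms.\<close>
  have z: "Poly_Mapping.lookup (face_sum Q p g \<tau>) e = 0" if "\<not> Q k0" for Q
    unfolding face_sum_def lookup_sum_list_map sum_list_eq_0_idem using that by (auto intro!: zero)
  have "Poly_Mapping.lookup (face_sum even p g \<tau>) e = 0 \<or> Poly_Mapping.lookup (face_sum odd p g \<tau>) e = 0"
    using z[of even] z[of odd] by argo
  then have "Poly_Mapping.lookup (face_sum (if even k0 then even else odd) p g \<tau>) e = 0"
    using cocycle[OF \<tau>] by auto
  then have "Poly_Mapping.lookup (g (drop_at k0 \<tau>)) e = 0"
    unfolding face_sum_def lookup_sum_list_map sum_list_eq_0_idem using k0(1) by (auto split: if_splits simp del: upt_Suc)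
  with e show False using \<open>drop_at k0 \<tau> = \<sigma>\<close> by simp
qed

text \<open>A projection onto \<open>laur n S\<close>, which turns one polynomial common to all
  simplices into a cochain.\<close>

definition laur_trunc :: "nat \<Rightarrow> nat set \<Rightarrow> 'k::comm_semiring_1 laurent \<Rightarrow> 'k laurent" where
  "laur_trunc n S f = (\<Sum>e\<in>Poly_Mapping.keys f \<inter> lexps n S. Poly_Mapping.single e (Poly_Mapping.lookup f e))"

lemma lookup_laur_trunc:
  "Poly_Mapping.lookup (laur_trunc n S f) e = (if e \<in> lexps n S then Poly_Mapping.lookup f e else 0)"
proof -
  have "Poly_Mapping.lookup (laur_trunc n S f) e
    = (\<Sum>d\<in>Poly_Mapping.keys f \<inter> lexps n S. if d = e then Poly_Mapping.lookup f d else 0)"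
    unfolding laur_trunc_def lookup_sum by (rule sum.cong) (auto simp: lookup_single when_def)
  then show ?thesis by (auto simp: in_keys_iff)
qed

lemma laur_trunc_mem: "laur_trunc n S f \<in> laur n S"
  by (auto simp: laur_def in_keys_iff lookup_laur_trunc split: if_splits)

lemma std_cocycleE:
  fixes M :: "'k::idempotent_semifield itself"
  assumes "x \<in> std_cocycles M n p"
  obtains g where "laur_family M n p g" "x = laur_cochain M n p g"
    "\<And>\<tau>. \<tau> \<in> std_simplices M n (Suc p) \<Longrightarrow> face_sum even p g \<tau> = face_sum odd p g \<tau>"
proof -
  have x: "x \<in> smcarrier (std_cochains M n p)" "std_partial even M n p x = std_partial odd M n p x"
    using assms by (auto simp: cech_cocycles_def)
  obtain g where g: "laur_family M n p g" "x = laur_cochain M n p g" using std_cochain_cases[OF x(1)] .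
  have eq: "laur_cochain M n (Suc p) (face_sum even p g) = laur_cochain M n (Suc p) (face_sum odd p g)"
    using x(2) g by (simp add: std_partial_laur_cochain)
  show ?thesis
    by (rule that[OF g]) (rule laur_cochain_inj[OF laur_family_face_sum[OF g(1)] eq])
qed

text \<open>Every two cocycles are identified by a cochain \<open>u = v\<close> that contains all their monomials:
  both are then absorbed by \<open>d\<^sup>+ u + d\<^sup>- u\<close>.\<close>

lemma std_rho_total:
  fixes M :: "'k::idempotent_semifield itself"
  assumes x: "x \<in> std_cocycles M n (Suc q)" and y: "y \<in> std_cocycles M n (Suc q)"
  shows "(x, y) \<in> std_rho M n (Suc q)"
proof -
  obtain f where f: "laur_family M n (Suc q) f" "x = laur_cochain M n (Suc q) f"
    "\<And>\<tau>. \<tau> \<in> std_simplices M n (Suc (Suc q)) \<Longrightarrow> face_sum even (Suc q) f \<tau> = face_sum odd (Suc q) f \<tau>"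
    by (rule std_cocycleE[OF x], rule that)
  obtain g where g: "laur_family M n (Suc q) g" "y = laur_cochain M n (Suc q) g"
    "\<And>\<tau>. \<tau> \<in> std_simplices M n (Suc (Suc q)) \<Longrightarrow> face_sum even (Suc q) g \<tau> = face_sum odd (Suc q) g \<tau>"
    by (rule std_cocycleE[OF y], rule that)
  \<comment> \<open>The sum over all simplices dominates every coefficient of both cocycles, and
    each face keeps the monomials that it permits. No face has to be chosen for an individual
    monomial.\<close>
  define w where "w = (\<lambda>\<rho>. laur_trunc n (set \<rho>) (\<Sum>\<sigma>\<in>std_simplices M n (Suc q). f \<sigma> + g \<sigma>))"
  have w: "laur_family M n q w" by (simp add: laur_family_def w_def laur_trunc_mem)
  \<comment> \<open>Stated for any cocycle \<open>h\<close> that is dominated coefficientwise by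
    \<open>f + g\<close>, so that it serves both \<open>f\<close> and \<open>g\<close>.\<close>
  have absorb: "h \<sigma> + face_sum even q w \<sigma> + face_sum odd q w \<sigma> = face_sum even q w \<sigma> + face_sum odd q w \<sigma>"
    if h: "laur_family M n (Suc q) h"
      "\<And>\<tau>. \<tau> \<in> std_simplices M n (Suc (Suc q)) \<Longrightarrow> face_sum even (Suc q) h \<tau> = face_sum odd (Suc q) h \<tau>"
      "\<And>\<sigma> e. Poly_Mapping.lookup (h \<sigma>) e + Poly_Mapping.lookup (f \<sigma> + g \<sigma>) e = Poly_Mapping.lookup (f \<sigma> + g \<sigma>) e"
    and \<sigma>: "\<sigma> \<in> std_simplices M n (Suc q)" for h \<sigma>
  proof (rule poly_mapping_eqI)
    fix e
    let ?a = "Poly_Mapping.lookup (h \<sigma>) e"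
    let ?d = "\<lambda>Q. Poly_Mapping.lookup (face_sum Q q w \<sigma>) e"
    have "?a + (?d even + ?d odd) = ?d even + ?d odd"
    proof (cases "?a = 0")
      case False
      \<comment> \<open>The monomial survives truncation on the face at position \<open>k\<close>;
        the parity of \<open>k\<close> decides which of the two partial coboundaries absorbs
        it.\<close>
      obtain k where k: "k < Suc q + 1" "e \<in> lexps n (set (drop_at k \<sigma>))"
        using cocycle_key_in_face[OF h(1,2) \<sigma> False] .
      have "Poly_Mapping.lookup (w (drop_at k \<sigma>)) e
        = (\<Sum>\<sigma>\<in>std_simplices M n (Suc q). Poly_Mapping.lookup (f \<sigma> + g \<sigma>) e)"
        using k(2) by (simp add: w_def lookup_laur_trunc lookup_sum)
      then have ak: "?a + Poly_Mapping.lookup (w (drop_at k \<sigma>)) e = Poly_Mapping.lookup (w (drop_at k \<sigma>)) e"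
        using absorb_sum[where f = "\<lambda>\<sigma>. Poly_Mapping.lookup (f \<sigma> + g \<sigma>) e",
            OF finite_std_simplices \<sigma> h(3)] by simp
      have absorb_d: "?a + ?d Q = ?d Q" if "Q k" for Q
        unfolding face_sum_def lookup_sum_list_map using k(1) that
        by (intro absorb_sum_list[OF _ ak]) (auto simp del: upt_Suc)
      show ?thesis
      proof (cases "even k")
        case True
        then show ?thesis using absorb_d[of even] by (simp add: add.assoc[symmetric])
      next
        case False
        then show ?thesis using absorb_d[of odd] by (simp add: add.left_commute[of ?a])
      qed
    qed simp
    then show "Poly_Mapping.lookup (h \<sigma> + face_sum even q w \<sigma> + face_sum odd q w \<sigma>) e
      = Poly_Mapping.lookup (face_sum even q w \<sigma> + face_sum odd q w \<sigma>) e"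
      by (simp add: lookup_add add.assoc)
  qed
  let ?C = "std_cochains M n (Suc q)" and ?u = "laur_cochain M n q w"
  have eq: "smadd ?C (smadd ?C (laur_cochain M n (Suc q) h) (std_partial even M n q ?u)) (std_partial odd M n q ?u)
    = laur_cochain M n (Suc q) (\<lambda>\<sigma>. h \<sigma> + face_sum even q w \<sigma> + face_sum odd q w \<sigma>)"
    if "laur_family M n (Suc q) h" for h
    using that w by (simp add: std_partial_laur_cochain laur_cochain_add laur_family_add laur_family_face_sum)
  have "laur_cochain M n (Suc q) (\<lambda>\<sigma>. f \<sigma> + face_sum even q w \<sigma> + face_sum odd q w \<sigma>)
    = laur_cochain M n (Suc q) (\<lambda>\<sigma>. g \<sigma> + face_sum even q w \<sigma> + face_sum odd q w \<sigma>)"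
    unfolding laur_cochain_def
  proof (rule restrict_ext)
    fix \<sigma> assume \<sigma>: "\<sigma> \<in> std_simplices M n (Suc q)"
    have ff: "Poly_Mapping.lookup (f \<sigma>) e + Poly_Mapping.lookup (f \<sigma> + g \<sigma>) e = Poly_Mapping.lookup (f \<sigma> + g \<sigma>) e" for \<sigma> e
      by (simp add: lookup_add add.assoc[symmetric] add_idem)
    have gg: "Poly_Mapping.lookup (g \<sigma>) e + Poly_Mapping.lookup (f \<sigma> + g \<sigma>) e = Poly_Mapping.lookup (f \<sigma> + g \<sigma>) e" for \<sigma> e
      by (simp add: lookup_add add.left_commute add_idem)
    show "germ_section M n (proj_DS M n (set \<sigma>)) (f \<sigma> + face_sum even q w \<sigma> + face_sum odd q w \<sigma>)
      = germ_section M n (proj_DS M n (set \<sigma>)) (g \<sigma> + face_sum even q w \<sigma> + face_sum odd q w \<sigma>)"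
      using absorb[OF f(1,3) ff \<sigma>] absorb[OF g(1,3) gg \<sigma>] by (simp only:)
  qed
  then have "smadd ?C (smadd ?C x (std_partial even M n q ?u)) (std_partial odd M n q ?u)
    = smadd ?C (smadd ?C y (std_partial even M n q ?u)) (std_partial odd M n q ?u)"
    unfolding f(2) g(2) eq[OF f(1)] eq[OF g(1)] .
  then have "\<exists>u\<in>smcarrier (std_cochains M n q). \<exists>v\<in>smcarrier (std_cochains M n q).
      smadd ?C (smadd ?C x (std_partial even M n q u)) (std_partial odd M n q v) =
      smadd ?C (smadd ?C y (std_partial even M n q v)) (std_partial odd M n q u)"
    by (intro bexI[of _ ?u] laur_cochain_mem[OF w])
  then show ?thesis using x y by (simp add: cech_rho_def)
qed

lemma std_cocycle_zero: "smzero (std_cochains M n p) \<in> std_cocycles M n p"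
proof -
  have z: "laur_family M n p (\<lambda>_. 0)" by (simp add: laur_family_def laur_zero)
  have "face_sum Q p (\<lambda>_. 0) = (\<lambda>_. 0 :: 'a laurent)" for Q
    by (rule ext) (simp add: face_sum_def)
  then have "std_partial even M n p (laur_cochain M n p (\<lambda>_. 0)) = std_partial odd M n p (laur_cochain M n p (\<lambda>_. 0))"
    by (simp add: std_partial_laur_cochain[OF z])
  then show ?thesis
    using laur_cochain_mem[OF z] by (simp add: laur_cochain_zero cech_cocycles_def)
qed

text \<open>Any two cocycles are related, so every class is the full set of cocycles, and the zero
  cochain belongs to it.\<close>

lemma std_cohomology_trivial:
  fixes M :: "'k::idempotent_semifield itself"
  assumes "m \<ge> 1"
  shows "semimodule_trivial (cech_cohomology (proj_structure_sheaf M n) (proj_standard_covering M n) m)"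
proof -
  obtain q where m: "m = Suc q" using assms by (cases m) auto
  have "std_rho M n m `` {x} = std_cocycles M n m" if "x \<in> std_cocycles M n m" for x
    using that std_rho_total[of _ M n q] unfolding m by (auto simp: cech_rho_def)
  then show ?thesis
    using std_cocycle_zero[of M n m] by (auto simp: semimodule_trivial_def cech_cohomology_def quotient_def)
qed

section \<open>Degree zero over arbitrary coverings\<close>

lemma cech_simplices_0: "cech_simplices \<U> 0 = {[i] | i. i \<in> cov_index \<U>}"
  by (auto simp: cech_simplices_def length_Suc_conv)

lemma cov_inter_singleton [simp]: "cov_inter \<U> [i] = cov_set \<U> i"
  by (simp add: cov_inter_def)

text \<open>Position 0 is even and omits \<open>i\<close>, so the even part sees the entry at
  \<open>j\<close> and the odd part the entry at \<open>i\<close>.\<close>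

lemma cech_partial_0:
  assumes "[i, j] \<in> cech_simplices \<U> 1"
  shows "cech_dplus F \<U> 0 x [i, j] =
      sm_sum_list (sections F (cov_inter \<U> [i, j])) [restr F (cov_set \<U> j) (cov_inter \<U> [i, j]) (x [j])]"
    "cech_dminus F \<U> 0 x [i, j] =
      sm_sum_list (sections F (cov_inter \<U> [i, j])) [restr F (cov_set \<U> i) (cov_inter \<U> [i, j]) (x [i])]"
  using assms by (simp_all add: cech_partial_def drop_at_def numeral_2_eq_2)

lemma cech_rho_0: "x \<in> cech_cocycles F \<U> 0 \<Longrightarrow> cech_rho F \<U> 0 `` {x} = {x}"
  by (auto simp: cech_rho_def)

lemma cech_cohomology_0: "smcarrier (cech_cohomology F \<U> 0) = {{x} | x. x \<in> cech_cocycles F \<U> 0}"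
  by (auto simp: cech_cohomology_def quotient_def cech_rho_0)

definition const_cochain ::
  "'k::comm_semiring_1 itself \<Rightarrow> nat \<Rightarrow> ('i, 'k proj_point) covering \<Rightarrow> 'k \<Rightarrow> 'i list \<Rightarrow> 'k proj_section" where
  "const_cochain M n \<U> c = (\<lambda>\<sigma>\<in>cech_simplices \<U> 0. germ_section M n (cov_inter \<U> \<sigma>) (const c))"

lemma const_cochain_cocycle:
  assumes \<U>: "open_covering (proj_space M n) \<U>"
  shows "const_cochain M n \<U> c \<in> cech_cocycles (proj_structure_sheaf M n) \<U> 0"
proof -
  let ?F = "proj_structure_sheaf M n" and ?x = "const_cochain M n \<U> c"
  have "?x \<in> smcarrier (cech_cochains ?F \<U> 0)"
    using \<U> by (auto simp: cech_cochains_def const_cochain_def cech_simplices_0 proj_sheaf_sections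
        open_covering_def intro!: germ_section_mem regular_on_const)
  moreover have "cech_dplus ?F \<U> 0 ?x = cech_dminus ?F \<U> 0 ?x"
  proof (rule extensionalityI[where A = "cech_simplices \<U> 1"])
    fix \<tau> assume \<tau>: "\<tau> \<in> cech_simplices \<U> 1"
    then obtain i j where ij: "\<tau> = [i, j]" by (auto simp: cech_simplices_def length_Suc_conv)
    have "i \<in> cov_index \<U>" "j \<in> cov_index \<U>" using \<tau> ij by (auto simp: cech_simplices_def)
    then have x: "?x [i] = germ_section M n (cov_set \<U> i) (const c)" "?x [j] = germ_section M n (cov_set \<U> j) (const c)"
      by (simp_all add: const_cochain_def cech_simplices_0)
    have "cov_inter \<U> [i, j] \<subseteq> cov_set \<U> i" "cov_inter \<U> [i, j] \<subseteq> cov_set \<U> j"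
      by (auto simp: cov_inter_def)
    with \<tau> show "cech_dplus ?F \<U> 0 ?x \<tau> = cech_dminus ?F \<U> 0 ?x \<tau>"
      unfolding ij by (simp add: cech_partial_0 x restr_germ_section)
  qed (simp_all add: cech_partial_def)
  ultimately show ?thesis by (simp add: cech_cocycles_def)
qed

lemma sm_sum_list_restr:
  assumes s: "s \<in> proj_sections M n U" and VU: "V \<subseteq> U" and k: "k \<le> n" and p: "p \<in> proj_part M n V k"
  shows "sm_sum_list (sections (proj_structure_sheaf M n) V) [restr (proj_structure_sheaf M n) U V s] (k, p) = s (k, p)"
proof -
  have "p \<in> proj_part M n U k" using p VU by (auto simp: chart_part_def)
  from loc_add_zero[OF subsemiring_laur proj_part_Spec[OF k p] sections_localization[OF s k this]]
  show ?thesis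
    using k p by (simp add: sm_sum_list_def proj_structure_sheaf_def glue_sheaf_def proj_dom_iff proj_chart_eq)
qed

text \<open>The cocycle equation is available only on increasing pairs; totality of the order on the
  index set makes it cover \<open>a\<close> and \<open>b\<close> in one order or the other.\<close>

lemma cocycle_0_agree:
  assumes \<U>: "open_covering (proj_space M n) \<U>" and x: "x \<in> cech_cocycles (proj_structure_sheaf M n) \<U> 0"
    and ab: "a \<in> cov_index \<U>" "b \<in> cov_index \<U>" and k: "k \<le> n"
    and p: "p \<in> proj_part M n (cov_set \<U> a) k" "p \<in> proj_part M n (cov_set \<U> b) k"
  shows "x [a] (k, p) = x [b] (k, p)"
proof -
  let ?F = "proj_structure_sheaf M n"
  have sec: "x [i] \<in> proj_sections M n (cov_set \<U> i)" if "i \<in> cov_index \<U>" for i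
    using x that by (auto simp: cech_cocycles_def cech_cochains_def cech_simplices_0 proj_sheaf_sections PiE_iff)
  have *: "x [a] (k, p) = x [b] (k, p)"
    if ab: "a \<in> cov_index \<U>" "b \<in> cov_index \<U>" "(a, b) \<in> cov_order \<U>" "a \<noteq> b"
      and p: "p \<in> proj_part M n (cov_set \<U> a) k" "p \<in> proj_part M n (cov_set \<U> b) k" for a b
  proof -
    have ab1: "[a, b] \<in> cech_simplices \<U> 1" using ab by (simp add: cech_simplices_def)
    have sub: "cov_inter \<U> [a, b] \<subseteq> cov_set \<U> a" "cov_inter \<U> [a, b] \<subseteq> cov_set \<U> b"
      by (auto simp: cov_inter_def)
    have pab: "p \<in> proj_part M n (cov_inter \<U> [a, b]) k" using p by (auto simp: chart_part_def cov_inter_def)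
    have "cech_dplus ?F \<U> 0 x [a, b] (k, p) = cech_dminus ?F \<U> 0 x [a, b] (k, p)"
      using x by (simp add: cech_cocycles_def)
    then show ?thesis
      unfolding cech_partial_0[OF ab1]
      using sm_sum_list_restr[OF sec[OF ab(1)] sub(1) k pab] sm_sum_list_restr[OF sec[OF ab(2)] sub(2) k pab]
      by simp
  qed
  have "linear_order_on (cov_index \<U>) (cov_order \<U>)" using \<U> by (simp add: open_covering_def)
  then have "a = b \<or> (a, b) \<in> cov_order \<U> \<or> (b, a) \<in> cov_order \<U>"
    using ab by (auto simp: linear_order_on_def total_on_def)
  then show ?thesis using *[of a b] *[of b a] ab p by metis
qed

text \<open>For \<open>n > 0\<close> some chart \<open>i \<noteq> k\<close> forces a nonnegative
  exponent at \<open>k\<close>; for \<open>n = 0\<close> degree zero does it. Nonnegative exponents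
  with sum zero vanish.\<close>

lemma laur_Inter_const:
  assumes "\<And>i. i \<le> n \<Longrightarrow> g \<in> laur n {i}"
  shows "g = const (Poly_Mapping.lookup g 0)"
proof -
  have "e = 0" if e: "Poly_Mapping.lookup g e \<noteq> 0" for e
  proof -
    have ei: "e \<in> lexps n {i}" if "i \<le> n" for i using lookup_laur[OF assms[OF that] e] .
    have sum: "(\<Sum>k\<le>n. Poly_Mapping.lookup e k) = 0" and out: "\<forall>k>n. Poly_Mapping.lookup e k = 0"
      using ei[of 0] by (auto simp: lexps_def)
    have nonneg: "0 \<le> Poly_Mapping.lookup e k" if k: "k \<le> n" for k
    proof (cases "n = 0")
      case True
      then show ?thesis using sum k by simp
    next
      case False
      then obtain i where "i \<le> n" "i \<noteq> k" by (metis le0 le_refl)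
      then show ?thesis using ei[of i] by (auto simp: lexps_def)
    qed
    have "\<forall>k\<in>{..n}. Poly_Mapping.lookup e k = 0"
      using sum nonneg sum_nonneg_eq_0_iff[of "{..n}" "Poly_Mapping.lookup e"] by simp
    then have "Poly_Mapping.lookup e k = 0" for k using out by (cases "k \<le> n") auto
    then show "e = 0" by (intro poly_mapping_eqI) simp
  qed
  then show ?thesis
    by (intro poly_mapping_eqI) (auto simp: const_def lookup_single when_def)
qed

lemma open_covering_chart:
  fixes M :: "'k::idempotent_semifield itself"
  assumes \<U>: "open_covering (proj_space M n) \<U>" and i: "i \<le> n"
  obtains a where "a \<in> cov_index \<U>" "proj_D M n i \<subseteq> cov_set \<U> a"
proof -
  have "proj_point M n i (closed_pt n {i} i) \<in> (\<Union>a\<in>cov_index \<U>. cov_set \<U> a)"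
    using \<U> proj_point_mem[OF i closed_pt_Spec[of i "{i}"], of M] by (simp add: open_covering_def topspace_proj)
  then obtain a where a: "a \<in> cov_index \<U>" "proj_point M n i (closed_pt n {i} i) \<in> cov_set \<U> a" by blast
  then have "proj_D M n i \<subseteq> cov_set \<U> a"
    using \<U> by (intro proj_D_subset_open[OF i]) (auto simp: open_covering_def)
  then show ?thesis using a(1) by (intro that)
qed

lemma cocycle_0_const:
  fixes M :: "'k::idempotent_semifield itself"
  assumes \<U>: "open_covering (proj_space M n) \<U>" and x: "x \<in> cech_cocycles (proj_structure_sheaf M n) \<U> 0"
  obtains c where "x = const_cochain M n \<U> c"
proof -
  have sec: "x [i] \<in> proj_sections M n (cov_set \<U> i)" if "i \<in> cov_index \<U>" for i
    using x that by (auto simp: cech_cocycles_def cech_cochains_def cech_simplices_0 proj_sheaf_sections PiE_iff)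
  have "\<forall>i\<in>{..n}. \<exists>a. a \<in> cov_index \<U> \<and> proj_D M n i \<subseteq> cov_set \<U> a"
    using open_covering_chart[OF \<U>] by (metis atMost_iff)
  then obtain a where a: "\<And>i. i \<le> n \<Longrightarrow> a i \<in> cov_index \<U>" "\<And>i. i \<le> n \<Longrightarrow> proj_D M n i \<subseteq> cov_set \<U> (a i)"
    by (metis atMost_iff)
  have "\<exists>g. g \<in> laur n {i} \<and> (\<forall>k p. k \<le> n \<longrightarrow> p \<in> proj_part M n (proj_D M n i) k \<longrightarrow>
      x [a i] (k, p) = germ (laur n {k}) p g)" if i: "i \<le> n" for i
    by (rule section_eq_germ[OF sec[OF a(1)[OF i]], of "{i}"]) (use i a(2) in \<open>auto simp: proj_DS_def\<close>)
  then obtain g where g: "\<And>i. i \<le> n \<Longrightarrow> g i \<in> laur n {i}"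
    and xg: "\<And>i k p. i \<le> n \<Longrightarrow> k \<le> n \<Longrightarrow> p \<in> proj_part M n (proj_D M n i) k \<Longrightarrow>
      x [a i] (k, p) = germ (laur n {k}) p (g i)" by metis
  have part: "proj_part M n (proj_D M n i) k \<subseteq> proj_part M n (cov_set \<U> (a i)) k" if "i \<le> n" for i k
    using a(2)[OF that] by (auto simp: chart_part_def)
  \<comment> \<open>The comparison takes place at the closed point of \<open>D(x_i x_k)\<close>,
    seen in chart \<open>i\<close>: both \<open>a i\<close> and \<open>a k\<close> contain it, and
    germs there determine the polynomial.\<close>
  have gg: "g i = g k" if i: "i \<le> n" and k: "k \<le> n" for i k
  proof -
    let ?m = "closed_pt n {i, k} i :: 'k laurent set"
    have m: "?m \<in> Spec (laur n {i})" by (rule closed_pt_Spec) simp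
    have "?m \<in> proj_part M n (proj_DS M n {j}) i" if "j \<in> {i, k}" for j
      using m closed_pt_xquot[of i "{i, k}" j n] that i k by (subst proj_part_DS) auto
    then have mp: "?m \<in> proj_part M n (proj_D M n i) i" "?m \<in> proj_part M n (proj_D M n k) i"
      by (simp_all add: proj_DS_def)
    have "x [a i] (i, ?m) = x [a k] (i, ?m)"
      by (rule cocycle_0_agree[OF \<U> x a(1)[OF i] a(1)[OF k] i])
        (use mp part[OF i] part[OF k] in blast)+
    then have "germ (laur n {i}) ?m (g i) = germ (laur n {i}) ?m (g k)"
      using xg[OF i i mp(1)] xg[OF k i mp(2)] by simp
    moreover have "g i \<in> laur n {i, k}" using g[OF i] laur_mono[of "{i}" "{i, k}" n] by blast
    ultimately show ?thesis using germ_closed_pt_inj[of i "{i, k}" n "g i" "g k"] i k by simp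
  qed
  have "g 0 \<in> laur n {i}" if "i \<le> n" for i using g[OF that] gg[OF that, of 0] by simp
  then obtain c where c: "g 0 = const c" using laur_Inter_const by blast
  \<comment> \<open>An arbitrary member need not contain a chart, but each of its points lies in
    some \<open>D(x_k)\<close>, where \<open>x [b]\<close> agrees with the known section over
    \<open>a k\<close>.\<close>
  have "x [b] = germ_section M n (cov_set \<U> b) (const c)" if b: "b \<in> cov_index \<U>" for b
  proof (rule germ_section_eqI)
    show "x [b] \<in> extensional (proj_dom M n (cov_set \<U> b))" using sec[OF b] by (simp add: glue_sections_def)
    fix k p assume k: "k \<le> n" and p: "p \<in> proj_part M n (cov_set \<U> b) k"
    have pS: "p \<in> Spec (laur n {k})" using proj_part_Spec[OF k p] .
    have pk: "p \<in> proj_part M n (proj_D M n k) k"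
      using proj_point_in_D_iff[OF k k pS, of M] Spec_one[OF subsemiring_laur pS] pS k
      by (simp add: proj_part_eq)
    have "x [b] (k, p) = x [a k] (k, p)"
      using cocycle_0_agree[OF \<U> x b a(1)[OF k] k p] part[OF k] pk by blast
    also have "\<dots> = germ (laur n {k}) p (const c)" using xg[OF k k pk] gg[OF k, of 0] c by simp
    finally show "x [b] (k, p) = germ (laur n {k}) p (const c)" .
  qed
  moreover have "x \<in> extensional (cech_simplices \<U> 0)"
    using x by (simp add: cech_cocycles_def cech_cochains_def PiE_def)
  ultimately have "x = const_cochain M n \<U> c"
    by (intro extensionalityI[of x "cech_simplices \<U> 0"]) (auto simp: const_cochain_def cech_simplices_0)
  then show ?thesis by (rule that)
qed

lemma const_cochain_inj:
  fixes M :: "'k::idempotent_semifield itself"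
  assumes \<U>: "open_covering (proj_space M n) \<U>" and eq: "const_cochain M n \<U> c = const_cochain M n \<U> d"
  shows "c = d"
proof -
  obtain a where a: "a \<in> cov_index \<U>" "proj_D M n 0 \<subseteq> cov_set \<U> a" using open_covering_chart[OF \<U>, of 0] by auto
  let ?m = "closed_pt n {0} 0 :: 'k laurent set"
  have m: "?m \<in> Spec (laur n {0})" by (rule closed_pt_Spec) simp
  then have "?m \<in> proj_part M n (proj_D M n 0) 0"
    using proj_point_in_D_iff[of 0 n 0 ?m M] Spec_one[OF subsemiring_laur m] by (simp add: proj_part_eq)
  then have p: "?m \<in> proj_part M n (cov_set \<U> a) 0" using a(2) by (auto simp: chart_part_def)
  have "germ_section M n (cov_set \<U> a) (const c) = germ_section M n (cov_set \<U> a) (const d)"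
    using fun_cong[OF eq, of "[a]"] a(1) by (simp add: const_cochain_def cech_simplices_0)
  from fun_cong[OF this, of "(0, ?m)"]
  have "germ (laur n {0}) ?m (const c) = germ (laur n {0}) ?m (const d)"
    using p by (simp add: germ_section_apply)
  then have "const c = const d"
    using germ_closed_pt_inj[of 0 "{0}" n "const c" "const d"] by (simp add: const_laur)
  then show ?thesis unfolding const_def by (metis lookup_single_eq)
qed

lemma cohomology_0_const:
  fixes M :: "'k::idempotent_semifield itself"
  assumes \<U>: "open_covering (proj_space M n) \<U>"
  shows "smcarrier (cech_cohomology (proj_structure_sheaf M n) \<U> 0) = {{const_cochain M n \<U> c} | c. True}"
  unfolding cech_cohomology_0
  using const_cochain_cocycle[OF \<U>] cocycle_0_const[OF \<U>] by blast

lemma smadd_const_cochain: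
  fixes M :: "'k::comm_semiring_1 itself"
  shows "smadd (cech_cochains (proj_structure_sheaf M n) \<U> 0) (const_cochain M n \<U> c) (const_cochain M n \<U> d)
    = const_cochain M n \<U> (c + d)"
proof -
  have "const c + const d = (const (c + d) :: 'k laurent)" by (simp add: const_def single_add)
  then show ?thesis
    by (auto simp: cech_cochains_def const_cochain_def smadd_germ_section regular_on_const intro!: restrict_ext)
qed

lemma smscale_const_cochain:
  fixes M :: "'k::comm_semiring_1 itself"
  shows "smscale (cech_cochains (proj_structure_sheaf M n) \<U> 0) k (const_cochain M n \<U> c) = const_cochain M n \<U> (k * c)"
proof -
  have kc: "const k * const c = (const (k * c) :: 'k laurent)" by (simp add: const_def mult_single)
  have "smscale (sections (proj_structure_sheaf M n) U) k (germ_section M n U (const c)) = germ_section M n U (const (k * c))" for U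
  proof (rule germ_section_eqI)
    fix i p assume i: "i \<le> n" "p \<in> proj_part M n U i"
    note p = proj_part_Spec[OF i]
    have "loc_mult (laur n {i}) (laur n {i} - p) (germ (laur n {i}) p (const k)) (germ (laur n {i}) p (const c))
      = germ (laur n {i}) p (const (k * c))"
      using loc_mult_germ[OF subsemiring_laur p germ_of_mem(3)[OF subsemiring_laur p const_laur]
          germ_of_mem(3)[OF subsemiring_laur p const_laur]] by (simp add: kc)
    then show "smscale (sections (proj_structure_sheaf M n) U) k (germ_section M n U (const c)) (i, p)
        = germ (laur n {i}) p (const (k * c))"
      using i germ_of_mem(2)[OF subsemiring_laur p const_laur, of k]
      by (simp add: proj_structure_sheaf_def glue_sheaf_def proj_dom_iff proj_chart_eq germ_section_apply)
  qed (simp add: proj_structure_sheaf_def glue_sheaf_def)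
  then show ?thesis
    by (auto simp: cech_cochains_def const_cochain_def intro!: restrict_ext)
qed

lemma smzero_const_cochain: "smzero (cech_cochains (proj_structure_sheaf M n) \<U> 0) = const_cochain M n \<U> 0"
  by (simp add: cech_cochains_def const_cochain_def smzero_proj_sheaf const_def)

lemma cohomology_0_ops:
  fixes M :: "'k::comm_semiring_1 itself" and n :: nat
  assumes "open_covering (proj_space M n) \<U>"
  defines "H \<equiv> cech_cohomology (proj_structure_sheaf M n) \<U> 0"
  shows "smadd H {const_cochain M n \<U> c} {const_cochain M n \<U> d} = {const_cochain M n \<U> (c + d)}"
    "smscale H k {const_cochain M n \<U> c} = {const_cochain M n \<U> (k * c)}"
    "smzero H = {const_cochain M n \<U> 0}"
  by (simp_all add: H_def cech_cohomology_def smadd_const_cochain smscale_const_cochain smzero_const_cochain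
      cech_rho_0 const_cochain_cocycle[OF assms(1)])

lemma transition_const_cochain:
  assumes \<W>: "open_covering (proj_space M n) \<W>" and r: "refines_by \<W> \<U> r"
  shows "cech_transition0 (proj_structure_sheaf M n) \<U> \<W> r {const_cochain M n \<U> c} = {const_cochain M n \<W> c}"
proof -
  have "cech_refine0 (proj_structure_sheaf M n) \<U> \<W> r (const_cochain M n \<U> c) = const_cochain M n \<W> c"
    unfolding cech_refine0_def const_cochain_def[of M n \<W>]
  proof (rule restrict_ext)
    fix \<sigma> assume "\<sigma> \<in> cech_simplices \<W> 0"
    then obtain j where j: "j \<in> cov_index \<W>" "\<sigma> = [j]" by (auto simp: cech_simplices_0)
    then have "r j \<in> cov_index \<U>" "cov_set \<W> j \<subseteq> cov_set \<U> (r j)" using r by (auto simp: refines_by_def)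
    then show "restr (proj_structure_sheaf M n) (cov_inter \<U> (map r \<sigma>)) (cov_inter \<W> \<sigma>) (const_cochain M n \<U> c (map r \<sigma>))
      = germ_section M n (cov_inter \<W> \<sigma>) (const c)"
      by (simp add: j const_cochain_def cech_simplices_0 restr_germ_section)
  qed
  then show ?thesis by (simp add: cech_transition0_def cech_rho_0[OF const_cochain_cocycle[OF \<W>]])
qed

text \<open>The colimit ranges over coverings indexed by sets of points, so the standard covering is
  reindexed by its own members, with an arbitrary well-order supplying the linear order.\<close>

lemma finest_covering:
  fixes M :: "'k::idempotent_semifield itself"
  obtains \<D> :: "('k proj_point set, 'k proj_point) covering"
  where "open_covering (proj_space M n) \<D>"
    "\<And>\<U> :: ('k proj_point set, 'k proj_point) covering.
      open_covering (proj_space M n) \<U> \<Longrightarrow> \<exists>r. refines_by \<D> \<U> r"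
proof -
  let ?I = "proj_D M n ` {..n}"
  obtain R where R: "well_order_on ?I R" using well_order_on by blast
  define \<D> where "\<D> = \<lparr>cov_index = ?I, cov_order = R, cov_set = (\<lambda>U. U)\<rparr>"
  have op: "openin (proj_space M n) (proj_D M n i)" if "i \<le> n" for i
    using openin_proj_DS[of "{i}" n M] that by (simp add: proj_DS_def)
  have "x \<in> (\<Union>i\<le>n. proj_D M n i)" if "x \<in> proj_points M n" for x
    using that by (rule proj_points_cases) (auto simp: proj_D_def proj_chart_eq)
  moreover have "(\<Union>i\<le>n. proj_D M n i) \<subseteq> topspace (proj_space M n)"
    using op by (auto dest: openin_subset)
  ultimately have "(\<Union>i\<le>n. proj_D M n i) = topspace (proj_space M n)"
    unfolding topspace_proj by blast
  then have "open_covering (proj_space M n) \<D>"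
    using R op by (auto simp: open_covering_def \<D>_def well_order_on_def)
  moreover have "\<exists>r. refines_by \<D> \<U> r" if \<U>: "open_covering (proj_space M n) \<U>"
    for \<U> :: "('k proj_point set, 'k proj_point) covering"
  proof -
    have "\<forall>V\<in>?I. \<exists>a. a \<in> cov_index \<U> \<and> V \<subseteq> cov_set \<U> a"
      using open_covering_chart[OF \<U>] by (metis atMost_iff imageE)
    then show ?thesis unfolding refines_by_def \<D>_def by (simp only: covering.simps) (rule bchoice)
  qed
  ultimately show ?thesis by (rule that)
qed

section \<open>The colimit as the set of constants\<close>

definition const_class ::
  "'k::comm_semiring_1 itself \<Rightarrow> nat \<Rightarrow> 'k
    \<Rightarrow> (('k proj_point set, 'k proj_point) covering \<times> ('k proj_point set list \<Rightarrow> 'k proj_section) set) set" where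
  "const_class M n c = {(\<U>, {const_cochain M n \<U> c}) | \<U>. open_covering (proj_space M n) \<U>}"

lemma colim_pairs_const:
  fixes M :: "'k::idempotent_semifield itself"
  shows "colim_pairs (proj_space M n) (proj_structure_sheaf M n) = (\<Union>c. const_class M n c)"
  by (auto simp: colim_pairs_def const_class_def cohomology_0_const)

text \<open>If two pairs are related, their constants agree because \<open>const_cochain\<close> is
  injective on the common refinement; conversely, the finest covering refines both and carries the
  same constant from either side.\<close>

lemma colim_class_const:
  fixes M :: "'k::idempotent_semifield itself"
  assumes \<U>: "open_covering (proj_space M n) \<U>"
  shows "colim_rel (proj_space M n) (proj_structure_sheaf M n) `` {(\<U>, {const_cochain M n \<U> c})} = const_class M n c"
proof (rule set_eqI)
  let ?X = "proj_space M n" and ?F = "proj_structure_sheaf M n"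
  fix z :: "('k proj_point set, 'k proj_point) covering \<times> ('k proj_point set list \<Rightarrow> 'k proj_section) set"
  obtain \<V> \<eta> where z: "z = (\<V>, \<eta>)" by (metis surj_pair)
  have "((\<U>, {const_cochain M n \<U> c}), (\<V>, \<eta>)) \<in> colim_rel ?X ?F \<longleftrightarrow> (\<V>, \<eta>) \<in> const_class M n c"
  proof
    assume "((\<U>, {const_cochain M n \<U> c}), (\<V>, \<eta>)) \<in> colim_rel ?X ?F"
    then obtain \<W> :: "('k proj_point set, 'k proj_point) covering" and r s where
      \<W>: "open_covering ?X \<W>" "refines_by \<W> \<U> r" "refines_by \<W> \<V> s" and V: "(\<V>, \<eta>) \<in> colim_pairs ?X ?F"
      and eq: "cech_transition0 ?F \<U> \<W> r {const_cochain M n \<U> c} = cech_transition0 ?F \<V> \<W> s \<eta>"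
      by (auto simp: colim_rel_def)
    obtain d where d: "(\<V>, \<eta>) \<in> const_class M n d" using V by (auto simp: colim_pairs_const)
    then have "\<eta> = {const_cochain M n \<V> d}" by (auto simp: const_class_def)
    then have "const_cochain M n \<W> c = const_cochain M n \<W> d"
      using eq by (simp add: transition_const_cochain[OF \<W>(1,2)] transition_const_cochain[OF \<W>(1,3)])
    then have "c = d" by (rule const_cochain_inj[OF \<W>(1)])
    then show "(\<V>, \<eta>) \<in> const_class M n c" using d by simp
  next
    assume V: "(\<V>, \<eta>) \<in> const_class M n c"
    then have \<V>: "open_covering ?X \<V>" "\<eta> = {const_cochain M n \<V> c}" by (auto simp: const_class_def)
    obtain \<D> :: "('k proj_point set, 'k proj_point) covering" where \<D>: "open_covering ?X \<D>"
      and ref: "\<And>\<U> :: ('k proj_point set, 'k proj_point) covering. open_covering ?X \<U> \<Longrightarrow> \<exists>r. refines_by \<D> \<U> r"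
      by (rule finest_covering[of M n], rule that)
    obtain r where r: "refines_by \<D> \<U> r" using ref[OF \<U>] by blast
    obtain s where s: "refines_by \<D> \<V> s" using ref[OF \<V>(1)] by blast
    have "cech_transition0 ?F \<U> \<D> r {const_cochain M n \<U> c} = cech_transition0 ?F \<V> \<D> s \<eta>"
      by (simp add: \<V>(2) transition_const_cochain[OF \<D> r] transition_const_cochain[OF \<D> s])
    moreover have "(\<U>, {const_cochain M n \<U> c}) \<in> colim_pairs ?X ?F" "(\<V>, \<eta>) \<in> colim_pairs ?X ?F"
      using \<U> V by (auto simp: colim_pairs_const const_class_def)
    ultimately show "((\<U>, {const_cochain M n \<U> c}), (\<V>, \<eta>)) \<in> colim_rel ?X ?F"
      using \<D> r s unfolding colim_rel_def by blast
  qed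
  then show "z \<in> colim_rel ?X ?F `` {(\<U>, {const_cochain M n \<U> c})} \<longleftrightarrow> z \<in> const_class M n c"
    by (simp add: z)
qed

lemma const_class_inj:
  fixes M :: "'k::idempotent_semifield itself"
  shows "inj (const_class M n)"
proof (rule injI)
  fix c d assume eq: "const_class M n c = const_class M n d"
  obtain \<D> :: "('k proj_point set, 'k proj_point) covering" where \<D>: "open_covering (proj_space M n) \<D>"
    by (rule finest_covering[of M n])
  then have "(\<D>, {const_cochain M n \<D> c}) \<in> const_class M n d"
    unfolding eq[symmetric] by (auto simp: const_class_def)
  then have "const_cochain M n \<D> c = const_cochain M n \<D> d" by (auto simp: const_class_def)
  then show "c = d" by (rule const_cochain_inj[OF \<D>])
qed

lemma cech_H0_carrier:
  fixes M :: "'k::idempotent_semifield itself"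
  shows "smcarrier (cech_H0 (proj_space M n) (proj_structure_sheaf M n)) = range (const_class M n)"
proof -
  let ?X = "proj_space M n" and ?F = "proj_structure_sheaf M n"
  obtain \<D> :: "('k proj_point set, 'k proj_point) covering" where \<D>: "open_covering ?X \<D>"
    by (rule finest_covering[of M n])
  have "colim_pairs ?X ?F // colim_rel ?X ?F = range (const_class M n)"
  proof (rule equalityI; rule subsetI)
    fix z assume "z \<in> colim_pairs ?X ?F // colim_rel ?X ?F"
    then obtain y where y: "y \<in> colim_pairs ?X ?F" "z = colim_rel ?X ?F `` {y}" by (rule quotientE)
    obtain \<U> c where \<U>: "open_covering ?X \<U>" and "y = (\<U>, {const_cochain M n \<U> c})"
      using y(1) by (auto simp: colim_pairs_const const_class_def)
    then show "z \<in> range (const_class M n)" using y(2) colim_class_const[OF \<U>] by simp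
  next
    fix z assume "z \<in> range (const_class M n)"
    then obtain c where "z = const_class M n c" by blast
    then have "z = colim_rel ?X ?F `` {(\<D>, {const_cochain M n \<D> c})}" using colim_class_const[OF \<D>] by simp
    moreover have "(\<D>, {const_cochain M n \<D> c}) \<in> colim_pairs ?X ?F"
      using \<D> by (auto simp: colim_pairs_const const_class_def)
    ultimately show "z \<in> colim_pairs ?X ?F // colim_rel ?X ?F" by (simp add: quotientI)
  qed
  then show ?thesis by (simp add: cech_H0_def)
qed

text \<open>Operations in the colimit are unions over all choices of representatives and
  refinements. Their well-definedness is the coincidence of all members of such a union.\<close>

lemma Union_const_eq: "\<lbrakk>\<And>B. B \<in> K \<Longrightarrow> B = A; K \<noteq> {}\<rbrakk> \<Longrightarrow> \<Union>K = A"
  by blast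

lemma cech_H0_ops:
  fixes M :: "'k::idempotent_semifield itself" and n :: nat
  defines "H \<equiv> cech_H0 (proj_space M n) (proj_structure_sheaf M n)"
  shows "smadd H (const_class M n c) (const_class M n d) = const_class M n (c + d)"
    "smzero H = const_class M n 0"
    "smscale H k (const_class M n c) = const_class M n (k * c)"
proof -
  let ?X = "proj_space M n" and ?F = "proj_structure_sheaf M n"
  obtain \<D> :: "('k proj_point set, 'k proj_point) covering" where \<D>: "open_covering ?X \<D>"
    by (rule finest_covering[of M n])
  have mem: "(\<D>, {const_cochain M n \<D> c}) \<in> const_class M n c" for c
    using \<D> by (auto simp: const_class_def)
  have id: "refines_by \<D> \<D> id" by (simp add: refines_by_def)
  have "smadd H (const_class M n c) (const_class M n d) =
    \<Union>{colim_rel ?X ?F `` {(\<W>, smadd (cech_cohomology ?F \<W> 0)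
         (cech_transition0 ?F \<U> \<W> r \<xi>) (cech_transition0 ?F \<V> \<W> s \<eta>))} | \<U> \<xi> \<V> \<eta> \<W> r s.
       (\<U>, \<xi>) \<in> const_class M n c \<and> (\<V>, \<eta>) \<in> const_class M n d \<and> open_covering ?X \<W> \<and>
       refines_by \<W> \<U> r \<and> refines_by \<W> \<V> s}"
    by (simp add: H_def cech_H0_def)
  also have "\<dots> = const_class M n (c + d)"
  proof (rule Union_const_eq)
    fix B assume "B \<in> {colim_rel ?X ?F `` {(\<W>, smadd (cech_cohomology ?F \<W> 0)
         (cech_transition0 ?F \<U> \<W> r \<xi>) (cech_transition0 ?F \<V> \<W> s \<eta>))} | \<U> \<xi> \<V> \<eta> \<W> r s.
       (\<U>, \<xi>) \<in> const_class M n c \<and> (\<V>, \<eta>) \<in> const_class M n d \<and> open_covering ?X \<W> \<and>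
       refines_by \<W> \<U> r \<and> refines_by \<W> \<V> s}"
    then obtain \<U> \<xi> \<V> \<eta> \<W> r s where B: "B = colim_rel ?X ?F `` {(\<W>, smadd (cech_cohomology ?F \<W> 0)
         (cech_transition0 ?F \<U> \<W> r \<xi>) (cech_transition0 ?F \<V> \<W> s \<eta>))}"
      and h: "(\<U>, \<xi>) \<in> const_class M n c" "(\<V>, \<eta>) \<in> const_class M n d" "open_covering ?X \<W>"
        "refines_by \<W> \<U> r" "refines_by \<W> \<V> s" by blast
    have "\<xi> = {const_cochain M n \<U> c}" "\<eta> = {const_cochain M n \<V> d}" using h by (auto simp: const_class_def)
    then show "B = const_class M n (c + d)"
      unfolding B using h(3-5) by (simp add: transition_const_cochain cohomology_0_ops colim_class_const)
  next
    show "{colim_rel ?X ?F `` {(\<W>, smadd (cech_cohomology ?F \<W> 0)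
         (cech_transition0 ?F \<U> \<W> r \<xi>) (cech_transition0 ?F \<V> \<W> s \<eta>))} | \<U> \<xi> \<V> \<eta> \<W> r s.
       (\<U>, \<xi>) \<in> const_class M n c \<and> (\<V>, \<eta>) \<in> const_class M n d \<and> open_covering ?X \<W> \<and>
       refines_by \<W> \<U> r \<and> refines_by \<W> \<V> s} \<noteq> {}"
      using mem \<D> id by blast
  qed
  finally show "smadd H (const_class M n c) (const_class M n d) = const_class M n (c + d)" .
  have "smzero H = \<Union>{colim_rel ?X ?F `` {(\<U>, smzero (cech_cohomology ?F \<U> 0))} | \<U>. open_covering ?X \<U>}"
    by (simp add: H_def cech_H0_def)
  also have "\<dots> = const_class M n 0"
  proof (rule Union_const_eq)
    fix B assume "B \<in> {colim_rel ?X ?F `` {(\<U>, smzero (cech_cohomology ?F \<U> 0))} | \<U>. open_covering ?X \<U>}"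
    then obtain \<U> where "open_covering ?X \<U>" "B = colim_rel ?X ?F `` {(\<U>, smzero (cech_cohomology ?F \<U> 0))}"
      by blast
    then show "B = const_class M n 0" by (simp add: cohomology_0_ops colim_class_const)
  next
    show "{colim_rel ?X ?F `` {(\<U>, smzero (cech_cohomology ?F \<U> 0))} | \<U>. open_covering ?X \<U>} \<noteq> {}"
      using \<D> by blast
  qed
  finally show "smzero H = const_class M n 0" .
  have "smscale H k (const_class M n c) =
    \<Union>{colim_rel ?X ?F `` {(\<U>, smscale (cech_cohomology ?F \<U> 0) k \<xi>)} | \<U> \<xi>. (\<U>, \<xi>) \<in> const_class M n c}"
    by (simp add: H_def cech_H0_def)
  also have "\<dots> = const_class M n (k * c)"
  proof (rule Union_const_eq)
    fix B assume "B \<in> {colim_rel ?X ?F `` {(\<U>, smscale (cech_cohomology ?F \<U> 0) k \<xi>)} | \<U> \<xi>. (\<U>, \<xi>) \<in> const_class M n c}"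
    then obtain \<U> \<xi> where B: "B = colim_rel ?X ?F `` {(\<U>, smscale (cech_cohomology ?F \<U> 0) k \<xi>)}"
      and h: "(\<U>, \<xi>) \<in> const_class M n c" by blast
    then show "B = const_class M n (k * c)"
      unfolding B by (auto simp: const_class_def cohomology_0_ops colim_class_const simp del: Image_singleton_iff)
  next
    show "{colim_rel ?X ?F `` {(\<U>, smscale (cech_cohomology ?F \<U> 0) k \<xi>)} | \<U> \<xi>. (\<U>, \<xi>) \<in> const_class M n c} \<noteq> {}"
      using mem by blast
  qed
  finally show "smscale H k (const_class M n c) = const_class M n (k * c)" .
qed

theorem proposition4p9:
  fixes M :: "'k::idempotent_semifield itself" and n :: nat
  shows "semimodule_iso (cech_H0 (proj_space M n) (proj_structure_sheaf M n)) (self_semimodule M) \<and>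
    (\<forall>m\<ge>1. semimodule_trivial
      (cech_cohomology (proj_structure_sheaf M n) (proj_standard_covering M n) m))"
proof
  let ?H = "cech_H0 (proj_space M n) (proj_structure_sheaf M n)"
  \<comment> \<open>The required isomorphism maps cohomology to \<open>M\<close>, whereas
    \<open>const_class\<close> runs the other way.\<close>
  have inv: "inv (const_class M n) (const_class M n c) = c" for c
    by (rule inv_f_f[OF const_class_inj])
  have "inv (const_class M n) \<in> semimodule_hom ?H (self_semimodule M)"
    by (auto simp: semimodule_hom_def self_semimodule_def cech_H0_carrier cech_H0_ops inv)
  moreover have "bij_betw (inv (const_class M n)) (smcarrier ?H) (smcarrier (self_semimodule M))"
    unfolding cech_H0_carrier self_semimodule_def
    using bij_betw_inv_into[OF inj_on_imp_bij_betw[OF const_class_inj[of M n]]] by simp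
  ultimately show "semimodule_iso ?H (self_semimodule M)" by (auto simp: semimodule_iso_def)
next
  show "\<forall>m\<ge>1. semimodule_trivial (cech_cohomology (proj_structure_sheaf M n) (proj_standard_covering M n) m)"
    using std_cohomology_trivial by blast
qed

end
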